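(* Consider the redundancy-$d$ model with $K$ servers and identical copies, in which all servers implement Random Order of Service (ROS), and let $\vec N^{ROS}(t)$ be the corresponding process of numbers of jobs per type. Then the process $\vec N^{ROS}(t)$ is ergodic when $\rho<1$, where $\rho=\frac{\lambda}{\mu K}$.
   Context: Redundancy-$d$ model: there are $K$ homogeneous servers $S=\{1,\ldots,K\}$, each with capacity 1 and its own queue, and an integer $1\le d\le K$. Jobs arrive according to a Poisson process of rate $\lambda>0$. Each arriving job chooses $d$ of the $K$ servers uniformly at random and sends one copy of itself to each of them. The type of a job is the set $c\subset S$ of the $d$ chosen servers; $\mathcal C$ is the set of all types ($|\mathcal C|=\binom{K}{d}$). As soon as one copy of a job completes service, all its other copies are immediately removed and the job departs. $N_c(t)$ is the number of type-$c$ jobs at time $t$ and $\vec N(t)=(N_c(t),c\in\mathcal C)$; the superscript $ROS$ indicates the policy. Identical copies: the $d$ copies of a job are exact replicas with the same service requirement, which is exponentially distributed with mean $1/\mu$ (independent across jobs). ROS: a server that becomes idle chooses uniformly at random a new copy from its queue and serves it, at rate 1, until this copy completes or it is removed because an identical copy completed in another server. The Markovian descriptor of the system is $(N_c(t),A_c(t))_{c\in\mathcal C}$, where $A_c(t)$ records the attained service of each copy of each type-$c$ job. Ergodic means positive recurrent, i.e. the system is stable. *)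

theory Defs
  imports "HOL-Probability.Probability"
begin

text \<open>
  A copy of a job is served without interruption from the moment its server selects it until the
  job departs. Hence \<open>job_att j s = None\<close> means that the copy at server \<open>s\<close> is
  still waiting (or that \<open>s\<close> has no copy of \<open>j\<close>), and
  \<open>job_att j s = Some a\<close> means that it is in service at \<open>s\<close> with attained
  service \<open>a\<close>. All copies of a job share the single requirement \<open>job_req j\<close>.
\<close>

datatype job = Job (job_type: "nat set") (job_req: real) (job_att: "nat \<rightharpoonup> real")

text \<open>
  A state consists of the time until the next arrival and the jobs present, in order of arrival.
  It carries the (not yet observed) requirements; the Markovian descriptor, below, does not.
\<close>

type_synonym state = "real \<times> job list"

definition job_types :: "nat \<Rightarrow> nat \<Rightarrow> nat set set" where
  "job_types K d = {c. c \<subseteq> {1..K} \<and> card c = d}"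


section \<open>Dynamics\<close>

text \<open>Time until the next event: the next arrival or the first completion of a copy.\<close>

definition holding_time :: "state \<Rightarrow> real" where
  "holding_time x = Min (insert (fst x)
     (\<Union>j\<in>set (snd x). (\<lambda>a. job_req j - a) ` ran (job_att j)))"

definition serve :: "real \<Rightarrow> job \<Rightarrow> job" where
  "serve t j = Job (job_type j) (job_req j) (\<lambda>s. map_option (\<lambda>a. a + t) (job_att j s))"

definition completed :: "job \<Rightarrow> bool" where
  "completed j \<longleftrightarrow> (\<exists>a\<in>ran (job_att j). job_req j \<le> a)"

definition idle :: "job list \<Rightarrow> nat \<Rightarrow> bool" where
  "idle js s \<longleftrightarrow> (\<forall>j\<in>set js. job_att j s = None)"

definition queue :: "job list \<Rightarrow> nat \<Rightarrow> nat list" where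
  "queue js s = filter (\<lambda>i. s \<in> job_type (js ! i)) [0..<length js]"

text \<open>
  If \<open>u s\<close> is uniform on \<open>[0,1)\<close>, then \<open>ros_pick u js s\<close> is uniform on the
  positions (in \<open>js\<close>) of the jobs that have a copy at \<open>s\<close>.
\<close>

definition ros_pick :: "(nat \<Rightarrow> real) \<Rightarrow> job list \<Rightarrow> nat \<Rightarrow> nat" where
  "ros_pick u js s = queue js s ! nat \<lfloor>u s * real (length (queue js s))\<rfloor>"

text \<open>
  Every idle server with a nonempty queue starts the copy it picks. A server that is idle and
  has an empty queue starts nothing, as then \<open>s \<notin> job_type (js ! i)\<close> for all \<open>i\<close>.
\<close>

definition start_service :: "(nat \<Rightarrow> real) \<Rightarrow> job list \<Rightarrow> job list" where
  "start_service u js = map (\<lambda>i. Job (job_type (js ! i)) (job_req (js ! i))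
     (\<lambda>s. if idle js s \<and> s \<in> job_type (js ! i) \<and> ros_pick u js s = i
          then Some 0 else job_att (js ! i) s)) [0..<length js]"

text \<open>
  Fresh randomness available at an event: the next interarrival time, the type and the service
  requirement of an arriving job (these three are used at arrivals only), and the variables
  driving the servers' choices.
\<close>

type_synonym innovation = "real \<times> nat set \<times> real \<times> (nat \<Rightarrow> real)"

fun next_state :: "innovation \<Rightarrow> state \<Rightarrow> state" where
  "next_state (t, c, b, u) x =
     (let h = holding_time x;
          js = filter (\<lambda>j. \<not> completed j) (map (serve h) (snd x))
      in if fst x = h then (t, start_service u (js @ [Job c b Map.empty]))
         else (fst x - h, start_service u js))"


section \<open>The Markovian descriptor as initial condition\<close>

text \<open>The type and the attained services of each job present.\<close>

type_synonym descriptor = "(nat set \<times> (nat \<rightharpoonup> real)) list"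

definition descriptors :: "nat \<Rightarrow> nat \<Rightarrow> descriptor set" where
  "descriptors K d = {D.
     (\<forall>(c, A)\<in>set D. c \<in> job_types K d \<and> dom A \<subseteq> c \<and> (\<forall>a\<in>ran A. 0 \<le> a)) \<and>
     (\<forall>s. (\<exists>(c, A)\<in>set D. s \<in> c) \<longrightarrow> (\<exists>!i. i < length D \<and> snd (D ! i) s \<noteq> None))}"

definition max_attained :: "nat set \<times> (nat \<rightharpoonup> real) \<Rightarrow> real" where
  "max_attained p = Max (insert 0 (ran (snd p)))"


section \<open>Probability space\<close>

definition exp_law :: "real \<Rightarrow> real measure" where
  "exp_law l = density lborel (exponential_density l)"

definition innovation_law :: "nat \<Rightarrow> nat \<Rightarrow> real \<Rightarrow> real \<Rightarrow> innovation measure" where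
  "innovation_law K d lam \<mu> =
     exp_law lam \<Otimes>\<^sub>M measure_pmf (pmf_of_set (job_types K d)) \<Otimes>\<^sub>M exp_law \<mu> \<Otimes>\<^sub>M
     (\<Pi>\<^sub>M s\<in>{1..K}. uniform_measure lborel {0..<1})"

type_synonym outcome = "real \<times> (nat \<Rightarrow> real) \<times> innovation stream"

text \<open>
  The law of the system started from the descriptor \<open>D\<close>: independently, the first
  interarrival time, the requirements of the jobs initially present, and an i.i.d. sequence of
  innovations. A requirement is conditioned on the job not having completed yet, i.e. on
  exceeding the attained service of every copy.
\<close>

definition system_law :: "nat \<Rightarrow> nat \<Rightarrow> real \<Rightarrow> real \<Rightarrow> descriptor \<Rightarrow> outcome measure" where
  "system_law K d lam \<mu> D =
     exp_law lam \<Otimes>\<^sub>M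
     (\<Pi>\<^sub>M i\<in>{..<length D}. uniform_measure (exp_law \<mu>) {max_attained (D ! i)<..}) \<Otimes>\<^sub>M
     stream_space (innovation_law K d lam \<mu>)"


section \<open>The process of numbers of jobs per type\<close>

text \<open>The state immediately after the \<open>n\<close>-th event.\<close>

fun state_after :: "descriptor \<Rightarrow> outcome \<Rightarrow> nat \<Rightarrow> state" where
  "state_after D (t, b, z) 0 =
     (t, map (\<lambda>i. Job (fst (D ! i)) (b i) (snd (D ! i))) [0..<length D])"
| "state_after D (t, b, z) (Suc n) = next_state (z !! n) (state_after D (t, b, z) n)"

definition event_time :: "descriptor \<Rightarrow> outcome \<Rightarrow> nat \<Rightarrow> real" where
  "event_time D \<omega> n = (\<Sum>i<n. holding_time (state_after D \<omega> i))"

definition N_ROS :: "descriptor \<Rightarrow> outcome \<Rightarrow> real \<Rightarrow> nat set \<Rightarrow> nat" where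
  "N_ROS D \<omega> t c =
     (let n = (LEAST n. t < event_time D \<omega> (Suc n))
      in length (filter (\<lambda>j. job_type j = c) (snd (state_after D \<omega> n))))"

text \<open>
  First time, from the first event on, at which the vector of numbers of jobs per type is
  \<open>v\<close> (\<open>\<infinity>\<close> if there is none).
\<close>

definition return_time :: "descriptor \<Rightarrow> (nat set \<Rightarrow> nat) \<Rightarrow> outcome \<Rightarrow> ennreal" where
  "return_time D v \<omega> =
     (INF t\<in>{t. event_time D \<omega> 1 \<le> t \<and> N_ROS D \<omega> t = v}. ennreal t)"

text \<open>
  Positive recurrence. As the process of numbers of jobs per type is Markov only together with
  the attained services, the mean time to reach or return to any vector is required to be finite
  from every initial descriptor, not only from one compatible with that vector.
\<close>

definition ergodic_ROS :: "nat \<Rightarrow> nat \<Rightarrow> real \<Rightarrow> real \<Rightarrow> bool" where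
  "ergodic_ROS K d lam \<mu> \<longleftrightarrow>
     (\<forall>D\<in>descriptors K d. \<forall>v. (\<forall>c. c \<notin> job_types K d \<longrightarrow> v c = 0) \<longrightarrow>
        (\<integral>\<^sup>+\<omega>. return_time D v \<omega> \<partial>system_law K d lam \<mu> D) < \<infinity>)"

end

theory Submission
  imports Defs
begin

text \<open>
Why the system is stable. All copies of a job have the same exponential requirement, so a job in
service completes at rate \<open>\<mu>\<close>, no matter how many servers work on it and what their attained
services are. By memorylessness the system is therefore a continuous-time Markov chain on
\<^emph>\<open>configurations\<close>: lists recording, for each job present, its type and the set of servers
currently serving it. The proof works with the jump chain of this process.

The Lyapunov function is \<open>L = (\<Sum>s. Q s ^ 2)\<close>, where \<open>Q s\<close> counts the
\<^emph>\<open>waiting\<close> jobs at server \<open>s\<close>, those that no server has started. Jobs in service are left out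
deliberately: they may be badly spread (several servers on the same job), and this only recovers when they
complete. A completion changes \<open>L\<close> only through the freed servers' new picks. A pick of a waiting
job \<open>i\<close> with server set \<open>c\<close> lowers \<open>L\<close> by about
\<open>2 * w i\<close>, where \<open>w i = (\<Sum>s\<in>c. Q s)\<close>. Server \<open>s\<close> picks
\<open>i\<close> with probability at least \<open>1 / (Q s + K)\<close>, so over all
servers the picks of \<open>i\<close> contribute about \<open>(\<Sum>s\<in>c. Q s) * (\<Sum>s\<in>c. 1 / Q s)\<close>,
which is at least \<open>d ^ 2\<close> by Cauchy-Schwarz. This is where random order of service enters: every waiting
job has the same chance at a server, and unequal queues only help. With \<open>n\<close> waiting jobs, departures
lower \<open>L\<close> at rate \<open>2 * \<mu> * d ^ 2 * n\<close> up to a constant, while arrivals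
raise it at rate \<open>2 * lam / K * d ^ 2 * n\<close> up to a constant. Hence \<open>\<rho> < 1\<close> gives
negative drift outside a finite set (\<open>potential_drift\<close>). A server may pick a job that is already in
service, or that another freed server picks too; the losses from such coincidences sum to a constant.

From a configuration with boundedly many jobs, any vector of numbers of jobs is reached with probability bounded
away from \<open>0\<close> in a bounded number of events: let all jobs depart, then let the required jobs arrive
(\<open>reaches_always\<close>). Drift and reachability together bound the expected number of events before the
vector is hit (\<open>expected_hitting_time_bound\<close>, \<open>finite_expected_hitting\<close>).

It remains to connect the chain with the process, whose states carry real clocks. To a configuration with fresh
independent exponential clocks one attaches a running cost along a sample path, charging at each event the time to
the next scheduled arrival plus one, and \<open>\<infinity>\<close> on the null events of ties and degenerate
innovations. The regeneration property of exponential races (\<open>mean_one_step\<close>) says that after one event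
the clocks are again fresh given the new configuration, so mean costs obey the recursion of the jump chain
(\<open>mean_cost\<close>). Pathwise the cost dominates the return time
(\<open>return_time_le_total_cost\<close>); paths with ties need no analysis, as their cost is infinite.
\<close>

section \<open>Expected hitting times for Markov operators\<close>

lemma sum_lessThan_add: "(\<Sum>k<m+n. f k) = (\<Sum>k<m. f k) + (\<Sum>k<n. f (m + k))"
  for f :: "nat \<Rightarrow> 'a::comm_monoid_add"
  by (induction n) (simp_all add: add.assoc)

text \<open>
A Markov chain is represented by its operator \<open>f \<mapsto> (\<lambda>x. E[f(X\<^sub>1) | X\<^sub>0 = x])\<close>, which avoids
constructing a transition kernel. The set \<open>X\<close> holds the admissible states, which the chain does not leave:
this is the content of monotonicity relative to \<open>X\<close>.
\<close>

locale markov_operator =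
  fixes X :: "'s set" and T :: "('s \<Rightarrow> ennreal) \<Rightarrow> 's \<Rightarrow> ennreal"
  assumes T_mono: "\<lbrakk>\<And>y. y \<in> X \<Longrightarrow> f y \<le> g y; x \<in> X\<rbrakk> \<Longrightarrow> T f x \<le> T g x"
    and T_add: "x \<in> X \<Longrightarrow> T (\<lambda>y. f y + g y) x = T f x + T g x"
    and T_cmult: "x \<in> X \<Longrightarrow> T (\<lambda>y. a * f y) x = a * T f x"
    and T_one: "x \<in> X \<Longrightarrow> T (\<lambda>_. 1) x = 1"
begin

text \<open>
The operator of the chain killed when it enters \<open>A\<close>. Only times from \<open>1\<close> on count, so a
start inside \<open>A\<close> is not killed, which makes hitting times return times.
\<close>

definition taboo :: "'s set \<Rightarrow> ('s \<Rightarrow> ennreal) \<Rightarrow> 's \<Rightarrow> ennreal" where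
  "taboo A f = T (\<lambda>y. if y \<in> A then 0 else f y)"

text \<open>
The probability that the chain avoids \<open>A\<close> at the times \<open>1, \<dots>, n\<close>.
\<close>

definition survival :: "'s set \<Rightarrow> nat \<Rightarrow> 's \<Rightarrow> ennreal" where
  "survival A n = (taboo A ^^ n) (\<lambda>_. 1)"

lemma taboo_mono: "\<lbrakk>\<And>y. y \<in> X \<Longrightarrow> f y \<le> g y; x \<in> X\<rbrakk> \<Longrightarrow> taboo A f x \<le> taboo A g x"
  unfolding taboo_def by (rule T_mono) auto

lemma taboo_add: "x \<in> X \<Longrightarrow> taboo A (\<lambda>y. f y + g y) x = taboo A f x + taboo A g x"
  unfolding taboo_def by (subst T_add[symmetric]) (auto intro!: arg_cong2[where f=T])

lemma taboo_cmult: "x \<in> X \<Longrightarrow> taboo A (\<lambda>y. a * f y) x = a * taboo A f x"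
  unfolding taboo_def by (subst T_cmult[symmetric]) (auto intro!: arg_cong2[where f=T])

lemma taboo_le: "x \<in> X \<Longrightarrow> taboo A f x \<le> T f x"
  unfolding taboo_def by (rule T_mono) auto

lemma taboo_pow_mono:
  "\<lbrakk>\<And>y. y \<in> X \<Longrightarrow> f y \<le> g y; x \<in> X\<rbrakk> \<Longrightarrow> (taboo A ^^ n) f x \<le> (taboo A ^^ n) g x"
  by (induction n arbitrary: x) (auto intro: taboo_mono)

lemma taboo_cong: "\<lbrakk>\<And>y. y \<in> X \<Longrightarrow> f y = g y; x \<in> X\<rbrakk> \<Longrightarrow> taboo A f x = taboo A g x"
  by (intro antisym taboo_mono) auto

lemma taboo_pow_add:
  "x \<in> X \<Longrightarrow> (taboo A ^^ n) (\<lambda>y. f y + g y) x = (taboo A ^^ n) f x + (taboo A ^^ n) g x"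
proof (induction n arbitrary: x)
  case (Suc n)
  then show ?case
    using taboo_cong[of "(taboo A ^^ n) (\<lambda>y. f y + g y)"
        "\<lambda>y. (taboo A ^^ n) f y + (taboo A ^^ n) g y" x A]
    by (simp add: taboo_add)
qed simp

lemma taboo_pow_cmult: "x \<in> X \<Longrightarrow> (taboo A ^^ n) (\<lambda>y. a * f y) x = a * (taboo A ^^ n) f x"
proof (induction n arbitrary: x)
  case (Suc n)
  then show ?case
    using taboo_cong[of "(taboo A ^^ n) (\<lambda>y. a * f y)" "\<lambda>y. a * (taboo A ^^ n) f y" x A]
    by (simp add: taboo_cmult)
qed simp

lemma survival_Suc: "survival A (Suc n) x = taboo A (survival A n) x"
  by (simp add: survival_def)

lemma survival_0 [simp]: "survival A 0 x = 1"
  by (simp add: survival_def)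

lemma survival_le_1: "x \<in> X \<Longrightarrow> survival A n x \<le> 1"
proof (induction n arbitrary: x)
  case (Suc n)
  have "survival A (Suc n) x \<le> T (\<lambda>_. 1) x"
    unfolding survival_Suc using Suc by (intro order.trans[OF taboo_le] T_mono) auto
  with Suc.prems show ?case by (simp add: T_one)
qed simp

lemma survival_antimono:
  assumes "m \<le> n" "x \<in> X" shows "survival A n x \<le> survival A m x"
proof -
  have "survival A n = (taboo A ^^ m) (survival A (n - m))"
    using assms(1) by (metis survival_def funpow_add comp_apply le_add_diff_inverse)
  moreover have "(taboo A ^^ m) (survival A (n - m)) x \<le> survival A m x"
    unfolding survival_def[of A m] by (intro taboo_pow_mono survival_le_1 assms)
  ultimately show ?thesis by simp
qed

text \<open>
Each visit to \<open>B\<close> costs survival probability at least \<open>p\<close> during the next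
\<open>m\<close> steps, so \<open>p\<close> times the probability of being in \<open>B\<close> at time
\<open>k\<close>, not yet killed, is at most the decrease of the survival probability from \<open>k\<close> to
\<open>m + k\<close>. These decreases telescope to at most \<open>m\<close>.
\<close>

lemma visits_bound:
  assumes reach: "\<And>x. x \<in> X \<Longrightarrow> x \<in> B \<Longrightarrow> survival A m x + p \<le> 1"
    and x: "x \<in> X"
  shows "p * (\<Sum>k<n. (taboo A ^^ k) (indicator B) x) \<le> of_nat m"
proof -
  let ?S = "\<lambda>k. survival A k x"
  have le: "p * indicator B y + survival A m y \<le> 1" if "y \<in> X" for y
    using reach[OF that] survival_le_1[OF that, of A m]
    by (auto simp: indicator_def add.commute)
  have "p * (taboo A ^^ k) (indicator B) x + ?S (m + k) \<le> ?S k" for k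
  proof -
    have "p * (taboo A ^^ k) (indicator B) x + ?S (m + k)
      = (taboo A ^^ k) (\<lambda>y. p * indicator B y + survival A m y) x"
      unfolding taboo_pow_add[OF x] taboo_pow_cmult[OF x] survival_def
      by (subst (2) add.commute) (simp add: funpow_add)
    also have "\<dots> \<le> ?S k"
      unfolding survival_def[of A k] by (intro taboo_pow_mono le x)
    finally show ?thesis .
  qed
  then have "(\<Sum>k<n. p * (taboo A ^^ k) (indicator B) x + ?S (m + k)) \<le> (\<Sum>k<n. ?S k)"
    by (intro sum_mono) auto
  also have "\<dots> \<le> (\<Sum>k<m+n. ?S k)"
    by (intro sum_mono2) auto
  also have "\<dots> = (\<Sum>k<m. ?S k) + (\<Sum>k<n. ?S (m + k))"
    by (rule sum_lessThan_add)
  also have "\<dots> \<le> of_nat m + (\<Sum>k<n. ?S (m + k))"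
    using sum_mono[of "{..<m}" ?S "\<lambda>_. 1"] survival_le_1[OF x] by (intro add_right_mono) simp
  finally have "p * (\<Sum>k<n. (taboo A ^^ k) (indicator B) x) + (\<Sum>k<n. ?S (m + k))
      \<le> of_nat m + (\<Sum>k<n. ?S (m + k))"
    by (simp add: sum.distrib sum_distrib_left)
  moreover have "(\<Sum>k<n. ?S (m + k)) \<noteq> \<infinity>"
  proof -
    have "(\<Sum>k<n. ?S (m + k)) \<le> of_nat n"
      using sum_mono[of "{..<n}" "\<lambda>k. ?S (m + k)" "\<lambda>_. 1"] survival_le_1[OF x] by simp
    then show ?thesis using neq_top_trans[OF ennreal_of_nat_neq_top] by simp
  qed
  ultimately show ?thesis
    by (simp add: ennreal_add_left_cancel_le add.commute)
qed

text \<open>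
The drift inequality, applied along the killed chain and summed over the first \<open>n\<close> steps.
\<close>

lemma drift_iterate:
  assumes drift: "\<And>x. x \<in> X \<Longrightarrow> T L x + e \<le> L x + b * indicator B x"
    and x: "x \<in> X"
  shows "(taboo A ^^ n) L x + e * (\<Sum>k<n. survival A k x)
     \<le> L x + b * (\<Sum>k<n. (taboo A ^^ k) (indicator B) x)"
proof (induction n)
  case (Suc n)
  have d: "taboo A L y + e \<le> L y + b * indicator B y" if "y \<in> X" for y
    using drift[OF that] taboo_le[OF that, of A L] by (meson add_right_mono order.trans)
  have "(taboo A ^^ Suc n) L x + e * survival A n x
     = (taboo A ^^ n) (\<lambda>y. taboo A L y + e * 1) x"
    by (simp only: taboo_pow_add[OF x] taboo_pow_cmult[OF x] survival_def funpow_Suc_right comp_apply)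
  also have "\<dots> \<le> (taboo A ^^ n) (\<lambda>y. L y + b * indicator B y) x"
    using d by (intro taboo_pow_mono x) auto
  also have "\<dots> = (taboo A ^^ n) L x + b * (taboo A ^^ n) (indicator B) x"
    by (simp add: taboo_pow_add[OF x] taboo_pow_cmult[OF x])
  finally have "(taboo A ^^ Suc n) L x + e * survival A n x + e * (\<Sum>k<n. survival A k x)
    \<le> (taboo A ^^ n) L x + b * (taboo A ^^ n) (indicator B) x + e * (\<Sum>k<n. survival A k x)"
    by (rule add_right_mono)
  also have "\<dots> = ((taboo A ^^ n) L x + e * (\<Sum>k<n. survival A k x)) + b * (taboo A ^^ n) (indicator B) x"
    by (simp add: ac_simps)
  also have "\<dots> \<le> (L x + b * (\<Sum>k<n. (taboo A ^^ k) (indicator B) x)) + b * (taboo A ^^ n) (indicator B) x"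
    by (intro add_right_mono Suc.IH)
  finally show ?case by (simp add: algebra_simps)
qed simp

text \<open>
Foster's criterion in quantitative form: the drift condition bounds the time spent before hitting by the number of
visits to \<open>B\<close>, and \<open>visits_bound\<close> bounds the latter.
\<close>

theorem expected_hitting_time_bound:
  assumes drift: "\<And>x. x \<in> X \<Longrightarrow> T L x + e \<le> L x + b * indicator B x"
    and reach: "\<And>x. x \<in> X \<Longrightarrow> x \<in> B \<Longrightarrow> survival A m x + p \<le> 1"
    and p: "0 < p" "p < \<infinity>" and x: "x \<in> X"
  shows "e * (\<Sum>k<n. survival A k x) \<le> L x + b * (of_nat m / p)"
proof -
  let ?V = "\<Sum>k<n. (taboo A ^^ k) (indicator B) x"
  have "?V = p * ?V / p"
    using ennreal_mult_divide_eq[of p ?V] p by (metis mult.commute less_irrefl infinity_ennreal_def)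
  also have "\<dots> \<le> of_nat m / p"
    by (intro divide_right_mono_ennreal visits_bound reach x)
  finally have V: "?V \<le> of_nat m / p" .
  have "e * (\<Sum>k<n. survival A k x) \<le> (taboo A ^^ n) L x + e * (\<Sum>k<n. survival A k x)"
    by simp
  also have "\<dots> \<le> L x + b * ?V" by (rule drift_iterate[OF drift x])
  also have "\<dots> \<le> L x + b * (of_nat m / p)"
    by (intro add_left_mono mult_left_mono V) auto
  finally show ?thesis .
qed

end

section \<open>Exponential clocks\<close>

lemma sets_exp_law [simp, measurable_cong]: "sets (exp_law l) = sets borel"
  by (simp add: exp_law_def)

lemma space_exp_law [simp]: "space (exp_law l) = UNIV"
  by (simp add: exp_law_def)

lemma prob_space_exp_law: "0 < l \<Longrightarrow> prob_space (exp_law l)"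
  unfolding exp_law_def by (rule prob_space_exponential_density)

lemma nn_integral_exp_law:
  assumes [measurable]: "f \<in> borel_measurable borel"
  shows "(\<integral>\<^sup>+x. f x \<partial>exp_law l) = (\<integral>\<^sup>+x. ennreal (exponential_density l x) * f x \<partial>lborel)"
  unfolding exp_law_def by (subst nn_integral_density) simp_all

text \<open>
Memorylessness, in the form in which it is integrated against: the part of the law beyond \<open>x\<close>, shifted
back to the origin, is the law itself up to a factor.
\<close>

lemma exp_law_memoryless:
  assumes l: "0 < l" and x: "0 \<le> x" and f [measurable]: "f \<in> borel_measurable borel"
  shows "(\<integral>\<^sup>+y. (if x < y then f (y - x) else 0) \<partial>exp_law l) = ennreal (exp (- l * x)) * (\<integral>\<^sup>+y. f y \<partial>exp_law l)"
proof -
  have "(\<integral>\<^sup>+y. (if x < y then f (y - x) else 0) \<partial>exp_law l)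
     = (\<integral>\<^sup>+y. ennreal (exponential_density l y) * (if x < y then f (y - x) else 0) \<partial>lborel)"
    by (rule nn_integral_exp_law) simp
  also have "\<dots> = (\<integral>\<^sup>+y. ennreal (exponential_density l (x + y)) * (if 0 < y then f y else 0) \<partial>lborel)"
    by (subst nn_integral_real_affine[where c=1 and t=x]) (auto intro!: nn_integral_cong)
  also have "\<dots> = (\<integral>\<^sup>+y. ennreal (exp (- l * x)) * (ennreal (exponential_density l y) * f y) \<partial>lborel)"
  proof (rule nn_integral_cong_AE)
    show "AE y in lborel. ennreal (exponential_density l (x + y)) * (if 0 < y then f y else 0)
        = ennreal (exp (- l * x)) * (ennreal (exponential_density l y) * f y)"
      using AE_lborel_singleton[of 0]
    proof eventually_elim
      case (elim y)
      show ?case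
      proof (cases "0 < y")
        case True
        then have "exponential_density l (x + y) = exp (- l * x) * exponential_density l y"
          using x by (simp add: exponential_density_def exp_add[symmetric] algebra_simps)
        with True l show ?thesis
          by (simp add: ennreal_mult exponential_density_nonneg mult.assoc)
      qed (use elim in \<open>simp add: exponential_density_def\<close>)
    qed
  qed
  also have "\<dots> = ennreal (exp (- l * x)) * (\<integral>\<^sup>+y. f y \<partial>exp_law l)"
    by (simp add: nn_integral_cmult nn_integral_exp_law)
  finally show ?thesis .
qed

lemma AE_exp_law_pos: "AE x in exp_law l. 0 < x"
proof -
  have "AE x in lborel. 0 < ennreal (exponential_density l x) \<longrightarrow> 0 < x"
    using AE_lborel_singleton[of 0] by eventually_elim (auto simp: exponential_density_def)
  then show ?thesis
    unfolding exp_law_def by (subst AE_density) auto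
qed

text \<open>
The Laplace transform turns the probability of winning a race, given the winning time, into a ratio of rates.
\<close>

lemma exp_law_laplace:
  assumes l: "0 < l" and a: "0 \<le> a"
  shows "(\<integral>\<^sup>+x. ennreal (exp (- a * x)) \<partial>exp_law l) = ennreal (l / (l + a))"
proof -
  interpret prob_space "exp_law (l + a)" using l a by (intro prob_space_exp_law) simp
  have "(\<integral>\<^sup>+x. ennreal (exp (- a * x)) \<partial>exp_law l)
    = (\<integral>\<^sup>+x. ennreal (exponential_density l x) * ennreal (exp (- a * x)) \<partial>lborel)"
    by (rule nn_integral_exp_law) simp
  also have "\<dots> = (\<integral>\<^sup>+x. ennreal (l / (l + a)) * (ennreal (exponential_density (l + a) x) * 1) \<partial>lborel)"
  proof (rule nn_integral_cong)
    fix x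
    have "exponential_density l x * exp (- a * x) = l / (l + a) * exponential_density (l + a) x"
    proof -
      have "exp (- x * l) * exp (- a * x) = exp (- x * (l + a))"
        by (simp add: exp_add[symmetric] algebra_simps)
      then show ?thesis using l a by (simp add: exponential_density_def)
    qed
    then show "ennreal (exponential_density l x) * ennreal (exp (- a * x))
        = ennreal (l / (l + a)) * (ennreal (exponential_density (l + a) x) * 1)"
      using l a by (simp add: ennreal_mult[symmetric] exponential_density_nonneg)
  qed
  also have "\<dots> = ennreal (l / (l + a)) * (\<integral>\<^sup>+x. 1 \<partial>exp_law (l + a))"
    by (subst nn_integral_cmult) (simp, subst nn_integral_exp_law, simp_all)
  also have "(\<integral>\<^sup>+x. 1 \<partial>exp_law (l + a)) = 1"
    using emeasure_space_1 by simp
  finally show ?thesis by simp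
qed

lemma exp_law_mean:
  assumes l: "0 < l"
  shows "(\<integral>\<^sup>+x. ennreal x \<partial>exp_law l) = ennreal (1 / l)"
proof -
  have "(\<integral>\<^sup>+x. ennreal x \<partial>exp_law l) = (\<integral>\<^sup>+x. ennreal (exponential_density l x) * ennreal x \<partial>lborel)"
    by (rule nn_integral_exp_law) simp
  also have "\<dots> = (\<integral>\<^sup>+x. ennreal (erlang_density 0 l x * x ^ 1) \<partial>lborel)"
    using l by (intro nn_integral_cong) (auto simp: ennreal_mult' exponential_density_nonneg)
  also have "\<dots> = ennreal (1 / l)"
    using l by (subst nn_integral_erlang_ith_moment) simp_all
  finally show ?thesis .
qed

text \<open>
Coordinatewise changes of variables with weights pass to finite products. With a weight that cuts off at
\<open>x\<close> this gives memorylessness of several clocks at once; with constant weight it transports the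
requirements conditioned on the attained services to unconditioned residuals.
\<close>

lemma nn_integral_PiM_weighted_map:
  fixes M N :: "'i \<Rightarrow> real measure"
  assumes A: "finite A"
    and M: "\<And>i. sigma_finite_measure (M i)" and N: "\<And>i. sigma_finite_measure (N i)"
    and sM: "\<And>i. sets (M i) = sets borel" and sN: "\<And>i. sets (N i) = sets borel"
    and g: "\<And>i. i \<in> A \<Longrightarrow> g i \<in> borel_measurable borel"
    and f: "\<And>i. i \<in> A \<Longrightarrow> f i \<in> borel_measurable borel"
    and eq: "\<And>i \<phi>. i \<in> A \<Longrightarrow> \<phi> \<in> borel_measurable borel \<Longrightarrow>
        (\<integral>\<^sup>+y. g i y * \<phi> (f i y) \<partial>M i) = a i * (\<integral>\<^sup>+y. \<phi> y \<partial>N i)"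
    and F: "F \<in> borel_measurable (PiM A (\<lambda>_. borel))"
  shows "(\<integral>\<^sup>+x. (\<Prod>i\<in>A. g i (x i)) * F (\<lambda>i\<in>A. f i (x i)) \<partial>PiM A M)
     = (\<Prod>i\<in>A. a i) * (\<integral>\<^sup>+x. F x \<partial>PiM A N)"
  using A g f eq F
proof (induction A arbitrary: F rule: finite_induct)
  case empty
  interpret M: product_sigma_finite M by (rule product_sigma_finite.intro) (rule M)
  interpret N: product_sigma_finite N by (rule product_sigma_finite.intro) (rule N)
  show ?case by (simp add: PiM_empty nn_integral_count_space_finite)
next
  case (insert i A)
  interpret M: product_sigma_finite M by (rule product_sigma_finite.intro) (rule M)
  interpret N: product_sigma_finite N by (rule product_sigma_finite.intro) (rule N)
  note [measurable_cong] = sM sN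
  note sets_PiM_cong[OF refl sM, measurable_cong] sets_PiM_cong[OF refl sN, measurable_cong]
  have [measurable]: "\<And>j. j \<in> insert i A \<Longrightarrow> g j \<in> borel_measurable borel"
      "\<And>j. j \<in> insert i A \<Longrightarrow> f j \<in> borel_measurable borel"
    using insert.prems by auto
  note Fm [measurable] = insert.prems(4)
  let ?P = "\<lambda>x. (\<Prod>j\<in>A. g j (x j))"
  have upd: "(\<lambda>(x, y). x(i := y)) \<in> measurable (PiM A (\<lambda>_. borel) \<Otimes>\<^sub>M borel) (PiM (insert i A) (\<lambda>_. borel))"
    unfolding case_prod_beta by (rule measurable_fun_upd) auto
  have Fu: "(\<lambda>p. F ((fst p)(i := snd p))) \<in> borel_measurable (PiM A (\<lambda>_. borel) \<Otimes>\<^sub>M borel)"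
    using measurable_compose[OF upd Fm] by (simp add: case_prod_beta)
  have lam: "(\<lambda>j\<in>insert i A. f j ((x(i := y)) j)) = (\<lambda>j\<in>A. f j (x j))(i := f i y)" for x :: "'i \<Rightarrow> real" and y
    using insert.hyps by (auto simp: fun_eq_iff)
  have sp: "space (PiM A N) = space (PiM A (\<lambda>_. borel))" "space (PiM A M) = space (PiM A (\<lambda>_. borel))"
    using sM sN by (auto simp: space_PiM sets_eq_imp_space_eq)
  have mM: "measurable (PiM B M) = (measurable (PiM B (\<lambda>_. borel)) :: real measure \<Rightarrow> _)"
     "measurable (PiM B M) = (measurable (PiM B (\<lambda>_. borel)) :: ennreal measure \<Rightarrow> _)"
     "measurable (PiM B N) = (measurable (PiM B (\<lambda>_. borel)) :: ennreal measure \<Rightarrow> _)"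
     "measurable (PiM B M) = (measurable (PiM B (\<lambda>_. borel)) :: ('i\<Rightarrow>real) measure \<Rightarrow> _)"
     for B using sM sN by (auto intro!: ext measurable_cong_sets sets_PiM_cong)
  define H where "H x = (\<integral>\<^sup>+y. F (x(i := y)) \<partial>N i)" for x
  have H[measurable]: "H \<in> borel_measurable (PiM A (\<lambda>_. borel))"
    unfolding H_def
    using sigma_finite_measure.borel_measurable_nn_integral[OF N, of "\<lambda>x y. F (x(i := y))" "PiM A (\<lambda>_. borel)" i] Fu
    by (simp add: case_prod_beta measurable_cong_sets[OF sets_pair_measure_cong[OF refl sN] refl])
  have Fx: "(\<lambda>y. F (x(i := y))) \<in> borel_measurable borel" if "x \<in> space (PiM A (\<lambda>_. borel))" for x
    using measurable_compose[OF measurable_Pair1'[OF that] Fu] by simp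
  have fA: "(\<lambda>j\<in>A. f j (x j)) \<in> space (PiM A (\<lambda>_. borel))" for x
    by (simp add: space_PiM)
  have fAm[measurable]: "(\<lambda>x. \<lambda>j\<in>A. f j (x j)) \<in> measurable (PiM A (\<lambda>_. borel)) (PiM A (\<lambda>_. borel))"
    by (rule measurable_restrict) auto
  have Pm [measurable]: "?P \<in> borel_measurable (PiM A (\<lambda>_. borel))"
    by (rule borel_measurable_prod_ennreal) auto
  have meas: "(\<lambda>x. (\<Prod>j\<in>insert i A. g j (x j)) * F (\<lambda>j\<in>insert i A. f j (x j))) \<in> borel_measurable (PiM (insert i A) M)"
  proof -
    have "(\<lambda>x. \<lambda>j\<in>insert i A. f j (x j)) \<in> measurable (PiM (insert i A) (\<lambda>_. borel)) (PiM (insert i A) (\<lambda>_. borel))"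
      by (rule measurable_restrict) auto
    from measurable_compose[OF this Fm]
    have [measurable]: "(\<lambda>x. F (\<lambda>j\<in>insert i A. f j (x j))) \<in> borel_measurable (PiM (insert i A) (\<lambda>_. borel))" .
    have [measurable]: "(\<lambda>x. \<Prod>j\<in>insert i A. g j (x j)) \<in> borel_measurable (PiM (insert i A) (\<lambda>_. borel))"
      by (rule borel_measurable_prod_ennreal) auto
    show ?thesis unfolding mM by measurable
  qed
  have "(\<integral>\<^sup>+x. (\<Prod>j\<in>insert i A. g j (x j)) * F (\<lambda>j\<in>insert i A. f j (x j)) \<partial>PiM (insert i A) M)
     = (\<integral>\<^sup>+x. \<integral>\<^sup>+y. (\<Prod>j\<in>insert i A. g j ((x(i := y)) j)) * F (\<lambda>j\<in>insert i A. f j ((x(i := y)) j)) \<partial>M i \<partial>PiM A M)"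
    by (rule M.product_nn_integral_insert[OF insert.hyps meas])
  also have "\<dots> = (\<integral>\<^sup>+x. ?P x * (a i * H (\<lambda>j\<in>A. f j (x j))) \<partial>PiM A M)"
  proof (rule nn_integral_cong)
    fix x assume "x \<in> space (PiM A M)"
    have "(\<integral>\<^sup>+y. (\<Prod>j\<in>insert i A. g j ((x(i := y)) j)) * F (\<lambda>j\<in>insert i A. f j ((x(i := y)) j)) \<partial>M i)
       = (\<integral>\<^sup>+y. ?P x * (g i y * F ((\<lambda>j\<in>A. f j (x j))(i := f i y))) \<partial>M i)"
    proof (rule nn_integral_cong)
      fix y
      have "(\<Prod>j\<in>A. g j ((x(i := y)) j)) = ?P x"
        by (rule prod.cong) (use insert.hyps in auto)
      then have "(\<Prod>j\<in>insert i A. g j ((x(i := y)) j)) = g i y * ?P x"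
        using insert.hyps by simp
      then show "(\<Prod>j\<in>insert i A. g j ((x(i := y)) j)) * F (\<lambda>j\<in>insert i A. f j ((x(i := y)) j))
          = ?P x * (g i y * F ((\<lambda>j\<in>A. f j (x j))(i := f i y)))"
        unfolding lam by (simp add: ac_simps)
    qed
    also have "\<dots> = ?P x * (\<integral>\<^sup>+y. g i y * F ((\<lambda>j\<in>A. f j (x j))(i := f i y)) \<partial>M i)"
      proof (rule nn_integral_cmult)
      note [measurable] = measurable_compose[OF _ Fx[OF fA]]
      show "(\<lambda>y. g i y * F ((\<lambda>j\<in>A. f j (x j))(i := f i y))) \<in> borel_measurable (M i)"
        unfolding measurable_cong_sets[OF sM refl] by measurable
    qed
    also have "(\<integral>\<^sup>+y. g i y * F ((\<lambda>j\<in>A. f j (x j))(i := f i y)) \<partial>M i) = a i * H (\<lambda>j\<in>A. f j (x j))"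
      unfolding H_def by (rule insert.prems(3)) (auto intro: Fx[OF fA])
    finally show "(\<integral>\<^sup>+y. (\<Prod>j\<in>insert i A. g j ((x(i := y)) j)) * F (\<lambda>j\<in>insert i A. f j ((x(i := y)) j)) \<partial>M i)
       = ?P x * (a i * H (\<lambda>j\<in>A. f j (x j)))" .
  qed
  also have "\<dots> = a i * (\<integral>\<^sup>+x. ?P x * H (\<lambda>j\<in>A. f j (x j)) \<partial>PiM A M)"
    by (subst nn_integral_cmult[symmetric]) (auto simp: mM ac_simps)
  also have "(\<integral>\<^sup>+x. ?P x * H (\<lambda>j\<in>A. f j (x j)) \<partial>PiM A M) = (\<Prod>j\<in>A. a j) * (\<integral>\<^sup>+x. H x \<partial>PiM A N)"
    by (rule insert.IH) (use insert.prems H in auto)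
  also have "(\<integral>\<^sup>+x. H x \<partial>PiM A N) = (\<integral>\<^sup>+x. F x \<partial>PiM (insert i A) N)"
    unfolding H_def by (rule N.product_nn_integral_insert[OF insert.hyps, symmetric]) (simp add: mM Fm)
  finally show ?case using insert.hyps by (simp add: ac_simps)
qed

lemma exp_clocks_memoryless:
  fixes l x :: real
  assumes A: "finite A" and R: "R \<subseteq> A" and l: "0 < l" and x: "0 \<le> x"
    and F: "F \<in> borel_measurable (PiM A (\<lambda>_. borel))"
  shows "(\<integral>\<^sup>+y. (if \<forall>i\<in>R. x < y i then F (\<lambda>i\<in>A. if i \<in> R then y i - x else y i) else 0) \<partial>PiM A (\<lambda>_. exp_law l))
    = ennreal (exp (- (real (card R) * l) * x)) * (\<integral>\<^sup>+y. F y \<partial>PiM A (\<lambda>_. exp_law l))"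
proof -
  interpret prob_space "exp_law l" by (rule prob_space_exp_law[OF l])
  define g :: "'a \<Rightarrow> real \<Rightarrow> ennreal" where "g i y = (if i \<in> R \<and> \<not> x < y then 0 else 1)" for i y
  define f where "f i y = (if i \<in> R then y - x else y)" for i :: 'a and y
  define a :: "'a \<Rightarrow> ennreal" where "a i = (if i \<in> R then ennreal (exp (- l * x)) else 1)" for i
  have finR: "finite R" using A R by (rule finite_subset[rotated])
  have "(if \<forall>i\<in>R. x < y i then F (\<lambda>i\<in>A. if i \<in> R then y i - x else y i) else 0)
     = (\<Prod>i\<in>A. g i (y i)) * F (\<lambda>i\<in>A. f i (y i))" for y
  proof (cases "\<forall>i\<in>R. x < y i")
    case True
    then have "(\<Prod>i\<in>A. g i (y i)) = 1" by (intro prod.neutral) (auto simp: g_def)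
    with True show ?thesis by (simp add: f_def)
  next
    case False
    then have "\<exists>i\<in>A. g i (y i) = 0" using R by (auto simp: g_def)
    with A have "(\<Prod>i\<in>A. g i (y i)) = 0" by (rule prod_zero)
    then show ?thesis unfolding if_not_P[OF False] by simp
  qed
  then have "(\<integral>\<^sup>+y. (if \<forall>i\<in>R. x < y i then F (\<lambda>i\<in>A. if i \<in> R then y i - x else y i) else 0) \<partial>PiM A (\<lambda>_. exp_law l))
     = (\<integral>\<^sup>+y. (\<Prod>i\<in>A. g i (y i)) * F (\<lambda>i\<in>A. f i (y i)) \<partial>PiM A (\<lambda>_. exp_law l))"
    by simp
  also have "\<dots> = (\<Prod>i\<in>A. a i) * (\<integral>\<^sup>+y. F y \<partial>PiM A (\<lambda>_. exp_law l))"
  proof (rule nn_integral_PiM_weighted_map[OF A _ _ _ _ _ _ _ F])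
    fix i \<phi> assume \<phi>: "(\<phi> :: real \<Rightarrow> ennreal) \<in> borel_measurable borel"
    have "(\<integral>\<^sup>+y. g i y * \<phi> (f i y) \<partial>exp_law l) = (\<integral>\<^sup>+y. (if x < y then \<phi> (y - x) else 0) \<partial>exp_law l)" if "i \<in> R"
      using that by (intro nn_integral_cong) (auto simp: g_def f_def)
    then show "(\<integral>\<^sup>+y. g i y * \<phi> (f i y) \<partial>exp_law l) = a i * (\<integral>\<^sup>+y. \<phi> y \<partial>exp_law l)"
      using exp_law_memoryless[OF l x \<phi>] by (cases "i \<in> R") (auto simp: g_def f_def a_def)
  qed (auto simp: g_def f_def sigma_finite_measure_axioms)
  also have "(\<Prod>i\<in>A. a i) = (\<Prod>i\<in>R. ennreal (exp (- l * x)))"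
    unfolding a_def using A R by (subst prod.mono_neutral_right[of A R]) auto
  also have "\<dots> = ennreal (exp (- l * x) ^ card R)"
    by (simp add: ennreal_power)
  also have "exp (- l * x) ^ card R = exp (- (real (card R) * l) * x)"
    by (simp add: exp_of_nat_mult[symmetric] mult.assoc)
  finally show ?thesis .
qed

abbreviation clocks :: "nat set \<Rightarrow> (nat \<Rightarrow> real) measure" where
  "clocks A \<equiv> PiM A (\<lambda>_. borel)"

text \<open>
The embedding of positions that deleting entry \<open>j\<close> of a list induces.
\<close>

definition skip :: "nat \<Rightarrow> nat \<Rightarrow> nat" where
  "skip j i = (if i < j then i else Suc i)"

text \<open>
The clocks in \<open>R\<close> have run for time \<open>x\<close>, the others have not been started. The
restriction to \<open>A\<close> keeps the result in the space of a product measure over \<open>A\<close>.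
\<close>

definition run_down :: "nat set \<Rightarrow> nat set \<Rightarrow> real \<Rightarrow> (nat \<Rightarrow> real) \<Rightarrow> nat \<Rightarrow> real" where
  "run_down A R x y = (\<lambda>i\<in>A. if i \<in> R then y i - x else y i)"

lemma measurable_run_down:
  assumes x: "x \<in> borel_measurable M" and y: "\<And>i. i \<in> A \<Longrightarrow> (\<lambda>w. y w i) \<in> borel_measurable M"
  shows "(\<lambda>w. run_down A R (x w) (y w)) \<in> measurable M (clocks A)"
  unfolding run_down_def
proof (rule measurable_restrict)
  fix i assume [measurable]: "i \<in> A"
  note x[measurable] y[OF \<open>i \<in> A\<close>, measurable]
  show "(\<lambda>w. if i \<in> R then y w i - x w else y w i) \<in> borel_measurable M" by measurable
qed

lemma sets_PiM_exp_law [simp, measurable_cong]: "sets (PiM A (\<lambda>_. exp_law l)) = sets (clocks A)"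
  by (rule sets_PiM_cong) auto

lemma space_PiM_exp_law [simp]: "space (PiM A (\<lambda>_. exp_law l)) = space (clocks A)"
  by (simp add: space_PiM)

lemma prob_space_PiM_exp_law: "0 < l \<Longrightarrow> prob_space (PiM A (\<lambda>_. exp_law l))"
  by (intro prob_space_PiM prob_space_exp_law)

lemma product_sigma_finite_exp_law: "0 < l \<Longrightarrow> product_sigma_finite (\<lambda>_. exp_law l)"
  by (intro product_sigma_finite.intro prob_space_imp_sigma_finite prob_space_exp_law)

lemma measurable_all_less:
  fixes t :: "'w \<Rightarrow> real"
  assumes "finite R" "t \<in> borel_measurable M" "\<And>i. i \<in> R \<Longrightarrow> (\<lambda>w. y w i) \<in> borel_measurable M"
  shows "Measurable.pred M (\<lambda>w. \<forall>i\<in>R. t w < y w i)"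
  using assms by (intro pred_intros_finite) auto

text \<open>
For a fixed arrival time \<open>t\<close>, memorylessness says that the running clocks survive to
\<open>t\<close> with probability \<open>exp (- card R * m * t)\<close> and are then fresh; integrating over
\<open>t\<close> gives the probability that the arrival comes first.
\<close>

lemma clock_race_arrival:
  assumes A: "finite A" and R: "R \<subseteq> A" and l: "0 < l" "0 < m"
    and F: "F \<in> borel_measurable (clocks A)"
  shows "(\<integral>\<^sup>+t. \<integral>\<^sup>+y. (if \<forall>i\<in>R. t < y i then F (run_down A R t y) else 0) \<partial>PiM A (\<lambda>_. exp_law m) \<partial>exp_law l)
    = ennreal (l / (l + real (card R) * m)) * (\<integral>\<^sup>+y. F y \<partial>PiM A (\<lambda>_. exp_law m))"
proof -
  have "(\<integral>\<^sup>+t. \<integral>\<^sup>+y. (if \<forall>i\<in>R. t < y i then F (run_down A R t y) else 0) \<partial>PiM A (\<lambda>_. exp_law m) \<partial>exp_law l)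
    = (\<integral>\<^sup>+t. ennreal (exp (- (real (card R) * m) * t)) * (\<integral>\<^sup>+y. F y \<partial>PiM A (\<lambda>_. exp_law m)) \<partial>exp_law l)"
    using AE_exp_law_pos[of l]
    by (intro nn_integral_cong_AE, eventually_elim)
      (simp add: exp_clocks_memoryless[OF A R l(2) _ F, folded run_down_def])
  also have "\<dots> = ennreal (l / (l + real (card R) * m)) * (\<integral>\<^sup>+y. F y \<partial>PiM A (\<lambda>_. exp_law m))"
    using l by (subst nn_integral_multc, measurable, subst exp_law_laplace) auto
  finally show ?thesis .
qed

text \<open>
As in \<open>clock_race_arrival\<close>, now conditioning on the value of the winning clock \<open>j\<close>; the
arrival clock is among those that become fresh.
\<close>

lemma clock_race_departure:
  assumes A: "finite A" and R: "R \<subseteq> A" and j: "j \<in> R" and l: "0 < l" "0 < m"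
    and F: "(\<lambda>(t, y). F t y) \<in> borel_measurable (borel \<Otimes>\<^sub>M clocks (A - {j}))"
  shows "(\<integral>\<^sup>+t. \<integral>\<^sup>+y. (if y j < t \<and> (\<forall>i\<in>R - {j}. y j < y i)
        then F (t - y j) (run_down (A - {j}) R (y j) y) else 0) \<partial>PiM A (\<lambda>_. exp_law m) \<partial>exp_law l)
    = ennreal (m / (l + real (card R) * m)) * (\<integral>\<^sup>+t. \<integral>\<^sup>+y. F t y \<partial>PiM (A - {j}) (\<lambda>_. exp_law m) \<partial>exp_law l)"
proof -
  let ?B = "A - {j}" and ?S = "R - {j}"
  let ?PB = "PiM ?B (\<lambda>_. exp_law m)"
  interpret P: product_sigma_finite "\<lambda>_::nat. exp_law m" by (rule product_sigma_finite_exp_law[OF l(2)])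
  interpret L: prob_space "exp_law l" by (rule prob_space_exp_law[OF l(1)])
  interpret M: prob_space "exp_law m" by (rule prob_space_exp_law[OF l(2)])
  interpret B: prob_space "?PB" by (rule prob_space_PiM_exp_law[OF l(2)])
  interpret LM: pair_sigma_finite "exp_law l" "exp_law m" ..
  note F[measurable]
  have fS: "finite ?S" and SB: "?S \<subseteq> ?B" using A R by (auto intro: finite_subset)
  have ins: "insert j ?B = A" using j R by auto
  have Sc: "card R = Suc (card ?S)" using j fS by (metis card.insert_remove finite_insert insert_Diff_single insert_absorb)
  define G where "G x t y = (if x < t \<and> (\<forall>i\<in>?S. x < y i) then F (t - x) (run_down ?B ?S x y) else 0)" for x t y
  have rd: "run_down ?B R x y = run_down ?B ?S x y" for x y
    by (auto simp: run_down_def)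
  have upd: "run_down ?B ?S x (y(j := z)) = run_down ?B ?S x y" for x y z
    by (auto simp: run_down_def fun_eq_iff)
  have Gm: "(\<lambda>w. G (x w) (t w) (y w)) \<in> borel_measurable N"
    if [measurable]: "x \<in> borel_measurable N" "t \<in> borel_measurable N" "\<And>i. i \<in> ?B \<Longrightarrow> (\<lambda>w. y w i) \<in> borel_measurable N"
    for x t :: "'w \<Rightarrow> real" and y N
  proof -
    have [measurable]: "Measurable.pred N (\<lambda>w. \<forall>i\<in>?S. x w < y w i)"
      using SB by (intro measurable_all_less fS) (auto intro!: that)
    have [measurable]: "(\<lambda>w. run_down ?B ?S (x w) (y w)) \<in> measurable N (clocks ?B)"
      by (rule measurable_run_down) (use that in auto)
    show ?thesis unfolding G_def by measurable
  qed
  have "(\<integral>\<^sup>+t. \<integral>\<^sup>+y. (if y j < t \<and> (\<forall>i\<in>?S. y j < y i)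
        then F (t - y j) (run_down ?B R (y j) y) else 0) \<partial>PiM A (\<lambda>_. exp_law m) \<partial>exp_law l)
     = (\<integral>\<^sup>+t. \<integral>\<^sup>+y. G (y j) t y \<partial>PiM A (\<lambda>_. exp_law m) \<partial>exp_law l)"
    unfolding G_def rd ..
  also have "\<dots> = (\<integral>\<^sup>+t. \<integral>\<^sup>+x. \<integral>\<^sup>+y. G x t y \<partial>?PB \<partial>exp_law m \<partial>exp_law l)"
  proof (rule nn_integral_cong)
    fix t
    have "(\<integral>\<^sup>+y. G (y j) t y \<partial>PiM (insert j ?B) (\<lambda>_. exp_law m))
       = (\<integral>\<^sup>+x. \<integral>\<^sup>+y. G ((y(j := x)) j) t (y(j := x)) \<partial>?PB \<partial>exp_law m)"
      by (rule P.product_nn_integral_insert_rev) (use A in \<open>auto intro!: Gm\<close>)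
    also have "\<dots> = (\<integral>\<^sup>+x. \<integral>\<^sup>+y. G x t y \<partial>?PB \<partial>exp_law m)"
      by (intro nn_integral_cong) (auto simp: G_def upd)
    finally show "(\<integral>\<^sup>+y. G (y j) t y \<partial>PiM A (\<lambda>_. exp_law m)) = (\<integral>\<^sup>+x. \<integral>\<^sup>+y. G x t y \<partial>?PB \<partial>exp_law m)"
      by (simp only: ins)
  qed
  also have "\<dots> = (\<integral>\<^sup>+x. \<integral>\<^sup>+t. \<integral>\<^sup>+y. G x t y \<partial>?PB \<partial>exp_law l \<partial>exp_law m)"
  proof -
    have "(\<lambda>p. \<integral>\<^sup>+y. G (snd p) (fst p) y \<partial>?PB) \<in> borel_measurable (exp_law l \<Otimes>\<^sub>M exp_law m)"
      using Gm[of "\<lambda>w. snd (fst w)" "(exp_law l \<Otimes>\<^sub>M exp_law m) \<Otimes>\<^sub>M ?PB" "\<lambda>w. fst (fst w)" snd]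
      by (intro B.borel_measurable_nn_integral) (auto simp: case_prod_beta')
    then have "(\<lambda>(t, x). \<integral>\<^sup>+y. G x t y \<partial>?PB) \<in> borel_measurable (exp_law l \<Otimes>\<^sub>M exp_law m)"
      by (simp add: case_prod_beta)
    then show ?thesis by (rule LM.Fubini'[symmetric])
  qed
  also have "\<dots> = (\<integral>\<^sup>+x. ennreal (exp (- (real (card ?S) * m + l) * x)) * (\<integral>\<^sup>+t. \<integral>\<^sup>+y. F t y \<partial>?PB \<partial>exp_law l) \<partial>exp_law m)"
  proof (rule nn_integral_cong_AE)
    show "AE x in exp_law m. (\<integral>\<^sup>+t. \<integral>\<^sup>+y. G x t y \<partial>?PB \<partial>exp_law l)
       = ennreal (exp (- (real (card ?S) * m + l) * x)) * (\<integral>\<^sup>+t. \<integral>\<^sup>+y. F t y \<partial>?PB \<partial>exp_law l)"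
      using AE_exp_law_pos[of m]
    proof eventually_elim
      case (elim x)
      let ?e = "ennreal (exp (- (real (card ?S) * m) * x))"
      define f where "f t = (\<integral>\<^sup>+y. F t y \<partial>?PB)" for t
      have f[measurable]: "f \<in> borel_measurable borel" unfolding f_def by measurable
      have "(\<integral>\<^sup>+y. G x t y \<partial>?PB) = ?e * (if x < t then f (t - x) else 0)" for t
      proof (cases "x < t")
        case True
        have "(\<integral>\<^sup>+y. G x t y \<partial>?PB) = (\<integral>\<^sup>+y. (if \<forall>i\<in>?S. x < y i then F (t - x) (run_down ?B ?S x y) else 0) \<partial>?PB)"
          using True by (simp add: G_def)
        also have "\<dots> = ?e * f (t - x)"
          unfolding run_down_def f_def
          by (rule exp_clocks_memoryless[OF _ SB l(2)]) (use A elim in auto)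
        finally show ?thesis using True by simp
      qed (simp add: G_def)
      then have "(\<integral>\<^sup>+t. \<integral>\<^sup>+y. G x t y \<partial>?PB \<partial>exp_law l) = ?e * (\<integral>\<^sup>+t. (if x < t then f (t - x) else 0) \<partial>exp_law l)"
        by (simp add: nn_integral_cmult)
      also have "(\<integral>\<^sup>+t. (if x < t then f (t - x) else 0) \<partial>exp_law l) = ennreal (exp (- l * x)) * (\<integral>\<^sup>+t. f t \<partial>exp_law l)"
        by (rule exp_law_memoryless[OF l(1) _ f]) (use elim in simp)
      also have "?e * (ennreal (exp (- l * x)) * (\<integral>\<^sup>+t. f t \<partial>exp_law l))
         = ennreal (exp (- (real (card ?S) * m + l) * x)) * (\<integral>\<^sup>+t. f t \<partial>exp_law l)"
      proof -
        have "exp (- (real (card ?S) * m + l) * x) = exp (- (real (card ?S) * m) * x) * exp (- l * x)"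
          unfolding exp_add[symmetric] by (simp add: algebra_simps)
        then show ?thesis by (simp only: ennreal_mult[OF exp_ge_zero exp_ge_zero] mult.assoc)
      qed
      finally show ?case by (simp add: f_def)
    qed
  qed
  also have "\<dots> = ennreal (m / (m + (real (card ?S) * m + l))) * (\<integral>\<^sup>+t. \<integral>\<^sup>+y. F t y \<partial>?PB \<partial>exp_law l)"
    using l by (subst nn_integral_multc, measurable, subst exp_law_laplace) auto
  also have "m + (real (card ?S) * m + l) = l + real (card R) * m"
    by (simp add: Sc algebra_simps)
  finally show ?thesis .
qed

text \<open>
Independent identically distributed clocks may be renumbered after a deletion.
\<close>

lemma nn_integral_delete_clock:
  assumes l: "0 < l" and j: "j < Suc n" and F: "F \<in> borel_measurable (clocks {..<n})"
  shows "(\<integral>\<^sup>+y. F (\<lambda>i\<in>{..<n}. y (skip j i)) \<partial>PiM ({..<Suc n} - {j}) (\<lambda>_. exp_law l))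
     = (\<integral>\<^sup>+y. F y \<partial>PiM {..<n} (\<lambda>_. exp_law l))"
proof -
  have inj: "inj_on (skip j) {..<n}" by (auto simp: inj_on_def skip_def split: if_splits)
  have rng: "skip j \<in> {..<n} \<rightarrow> {..<Suc n} - {j}" by (auto simp: skip_def)
  have m: "(\<lambda>y. \<lambda>i\<in>{..<n}. y (skip j i)) \<in> measurable (PiM ({..<Suc n} - {j}) (\<lambda>_. exp_law l)) (PiM {..<n} (\<lambda>_. exp_law l))"
    by (rule measurable_restrict) (use rng in \<open>auto intro!: measurable_component_singleton\<close>)
  have "(\<integral>\<^sup>+y. F y \<partial>PiM {..<n} (\<lambda>_. exp_law l))
      = (\<integral>\<^sup>+y. F y \<partial>distr (PiM ({..<Suc n} - {j}) (\<lambda>_. exp_law l)) (PiM {..<n} (\<lambda>_. exp_law l)) (\<lambda>y. \<lambda>i\<in>{..<n}. y (skip j i)))"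
    by (subst distr_PiM_reindex[OF _ inj rng, of "\<lambda>_. exp_law l"]) (auto intro: prob_space_exp_law l)
  also have "\<dots> = (\<integral>\<^sup>+y. F (\<lambda>i\<in>{..<n}. y (skip j i)) \<partial>PiM ({..<Suc n} - {j}) (\<lambda>_. exp_law l))"
    by (rule nn_integral_distr[OF m]) (use F in simp)
  finally show ?thesis by simp
qed

text \<open>
The regeneration lemmas integrate out the choices of the servers last, whereas they occur innermost in the law of an
innovation.
\<close>

lemma nn_integral_rotate:
  assumes A: "sigma_finite_measure A" and B: "sigma_finite_measure B"
    and C: "sigma_finite_measure C" and D: "sigma_finite_measure D"
    and F: "(\<lambda>(a, b, c, e). F a b c e) \<in> borel_measurable (A \<Otimes>\<^sub>M B \<Otimes>\<^sub>M C \<Otimes>\<^sub>M D)"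
  shows "(\<integral>\<^sup>+a. \<integral>\<^sup>+b. \<integral>\<^sup>+c. \<integral>\<^sup>+e. F a b c e \<partial>D \<partial>C \<partial>B \<partial>A) = (\<integral>\<^sup>+e. \<integral>\<^sup>+b. \<integral>\<^sup>+a. \<integral>\<^sup>+c. F a b c e \<partial>C \<partial>A \<partial>B \<partial>D)"
proof -
  interpret A: sigma_finite_measure A by fact
  interpret B: sigma_finite_measure B by fact
  interpret C: sigma_finite_measure C by fact
  interpret D: sigma_finite_measure D by fact
  interpret AB: pair_sigma_finite A B ..
  interpret DC: pair_sigma_finite D C ..
  interpret AD: pair_sigma_finite A D ..
  interpret BD: pair_sigma_finite B D ..
  have [measurable (raw)]: "(\<lambda>w. F (a w) (b w) (c w) (e w)) \<in> borel_measurable N"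
    if "a \<in> measurable N A" "b \<in> measurable N B" "c \<in> measurable N C" "e \<in> measurable N D"
    for a b c e and N :: "'w measure"
    using measurable_compose[OF measurable_Pair[OF that(1) measurable_Pair[OF that(2) measurable_Pair[OF that(3,4)]]] F]
    by simp
  have "(\<integral>\<^sup>+a. \<integral>\<^sup>+b. \<integral>\<^sup>+c. \<integral>\<^sup>+e. F a b c e \<partial>D \<partial>C \<partial>B \<partial>A) = (\<integral>\<^sup>+b. \<integral>\<^sup>+a. \<integral>\<^sup>+c. \<integral>\<^sup>+e. F a b c e \<partial>D \<partial>C \<partial>A \<partial>B)"
    by (rule AB.Fubini'[symmetric]) measurable
  also have "\<dots> = (\<integral>\<^sup>+b. \<integral>\<^sup>+a. \<integral>\<^sup>+e. \<integral>\<^sup>+c. F a b c e \<partial>C \<partial>D \<partial>A \<partial>B)"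
    by (intro nn_integral_cong DC.Fubini') measurable
  also have "\<dots> = (\<integral>\<^sup>+b. \<integral>\<^sup>+e. \<integral>\<^sup>+a. \<integral>\<^sup>+c. F a b c e \<partial>C \<partial>A \<partial>D \<partial>B)"
    by (intro nn_integral_cong AD.Fubini'[symmetric]) measurable
  also have "\<dots> = (\<integral>\<^sup>+e. \<integral>\<^sup>+b. \<integral>\<^sup>+a. \<integral>\<^sup>+c. F a b c e \<partial>C \<partial>A \<partial>B \<partial>D)"
    by (rule BD.Fubini'[symmetric]) measurable
  finally show ?thesis .
qed

lemma prob_space_nn_integral_const: "prob_space M \<Longrightarrow> (\<integral>\<^sup>+x. c \<partial>M) = c"
  by (simp add: prob_space.emeasure_space_1)

lemma nn_integral_move_last:
  assumes A: "sigma_finite_measure A" and B: "sigma_finite_measure B" and D: "sigma_finite_measure D"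
    and F: "(\<lambda>(a, b, e). F a b e) \<in> borel_measurable (A \<Otimes>\<^sub>M B \<Otimes>\<^sub>M D)"
  shows "(\<integral>\<^sup>+a. \<integral>\<^sup>+b. \<integral>\<^sup>+e. F a b e \<partial>D \<partial>B \<partial>A) = (\<integral>\<^sup>+e. \<integral>\<^sup>+a. \<integral>\<^sup>+b. F a b e \<partial>B \<partial>A \<partial>D)"
proof -
  interpret A: sigma_finite_measure A by fact
  interpret B: sigma_finite_measure B by fact
  interpret D: sigma_finite_measure D by fact
  interpret DB: pair_sigma_finite D B ..
  interpret DA: pair_sigma_finite D A ..
  have [measurable (raw)]: "(\<lambda>w. F (a w) (b w) (e w)) \<in> borel_measurable N"
    if "a \<in> measurable N A" "b \<in> measurable N B" "e \<in> measurable N D"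
    for a b e and N :: "'w measure"
    using measurable_compose[OF measurable_Pair[OF that(1) measurable_Pair[OF that(2,3)]] F] by simp
  have "(\<integral>\<^sup>+a. \<integral>\<^sup>+b. \<integral>\<^sup>+e. F a b e \<partial>D \<partial>B \<partial>A) = (\<integral>\<^sup>+a. \<integral>\<^sup>+e. \<integral>\<^sup>+b. F a b e \<partial>B \<partial>D \<partial>A)"
    by (intro nn_integral_cong DB.Fubini') measurable
  also have "\<dots> = (\<integral>\<^sup>+e. \<integral>\<^sup>+a. \<integral>\<^sup>+b. F a b e \<partial>B \<partial>A \<partial>D)"
    by (rule DA.Fubini') measurable
  finally show ?thesis .
qed

section \<open>Configurations\<close>

text \<open>
For each job present, in order of arrival, its type and the set of servers that serve it.
\<close>

type_synonym config = "(nat set \<times> nat set) list"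

definition drop_nth :: "nat \<Rightarrow> 'a list \<Rightarrow> 'a list" where
  "drop_nth j xs = take j xs @ drop (Suc j) xs"

text \<open>
The following four functions express \<open>queue\<close>, \<open>idle\<close>, \<open>ros_pick\<close>
and \<open>start_service\<close> on configurations.
\<close>

definition config_queue :: "config \<Rightarrow> nat \<Rightarrow> nat list" where
  "config_queue C s = filter (\<lambda>i. s \<in> fst (C ! i)) [0..<length C]"

definition config_idle :: "config \<Rightarrow> nat \<Rightarrow> bool" where
  "config_idle C s \<longleftrightarrow> (\<forall>p\<in>set C. s \<notin> snd p)"

definition config_pick :: "(nat \<Rightarrow> real) \<Rightarrow> config \<Rightarrow> nat \<Rightarrow> nat" where
  "config_pick u C s = config_queue C s ! nat \<lfloor>u s * real (length (config_queue C s))\<rfloor>"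

definition new_servers :: "(nat \<Rightarrow> real) \<Rightarrow> config \<Rightarrow> nat \<Rightarrow> nat set" where
  "new_servers u C i = {s. config_idle C s \<and> s \<in> fst (C ! i) \<and> config_pick u C s = i}"

definition config_start :: "(nat \<Rightarrow> real) \<Rightarrow> config \<Rightarrow> config" where
  "config_start u C = map (\<lambda>i. (fst (C ! i), snd (C ! i) \<union> new_servers u C i)) [0..<length C]"

definition busy_jobs :: "config \<Rightarrow> nat set" where
  "busy_jobs C = {i. i < length C \<and> snd (C ! i) \<noteq> {}}"

definition waiting_jobs :: "config \<Rightarrow> nat set" where
  "waiting_jobs C = {i. i < length C \<and> snd (C ! i) = {}}"

text \<open>
The energy below depends on a configuration only through this list. Lists rather than sets of positions are used
because deleting a job in service leaves the list unchanged, while it renumbers positions.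
\<close>

definition waiting_types :: "config \<Rightarrow> nat set list" where
  "waiting_types C = map fst (filter (\<lambda>p. snd p = {}) C)"

definition backlog :: "nat set list \<Rightarrow> nat \<Rightarrow> nat" where
  "backlog W s = length (filter (\<lambda>c. s \<in> c) W)"

text \<open>
What the dynamics preserve even between a completion and the moment when the freed servers start new copies; in
particular no server serves two jobs.
\<close>

definition consistent :: "nat \<Rightarrow> nat \<Rightarrow> config \<Rightarrow> bool" where
  "consistent K d C \<longleftrightarrow>
     (\<forall>p\<in>set C. fst p \<in> job_types K d \<and> snd p \<subseteq> fst p) \<and>
     (\<forall>s i j. i < length C \<longrightarrow> j < length C \<longrightarrow> s \<in> snd (C ! i) \<longrightarrow> s \<in> snd (C ! j) \<longrightarrow> i = j)"

definition work_conserving :: "config \<Rightarrow> bool" where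
  "work_conserving C \<longleftrightarrow> (\<forall>p\<in>set C. \<forall>s\<in>fst p. \<not> config_idle C s)"

text \<open>
After the servers have made their choices, no server with a copy in its queue is idle.
\<close>

definition valid :: "nat \<Rightarrow> nat \<Rightarrow> config \<Rightarrow> bool" where
  "valid K d C \<longleftrightarrow> consistent K d C \<and> work_conserving C"

definition choices_ok :: "nat \<Rightarrow> (nat \<Rightarrow> real) \<Rightarrow> bool" where
  "choices_ok K u \<longleftrightarrow> (\<forall>s\<in>{1..K}. 0 \<le> u s \<and> u s < 1)"

lemma length_drop_nth [simp]: "j < length xs \<Longrightarrow> length (drop_nth j xs) = length xs - 1"
  by (simp add: drop_nth_def)

lemma nth_drop_nth: "j < length xs \<Longrightarrow> i < length xs - 1 \<Longrightarrow> drop_nth j xs ! i = xs ! skip j i"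
  by (auto simp: drop_nth_def skip_def nth_append)

lemma skip_less: "j < n \<Longrightarrow> i < n - 1 \<Longrightarrow> skip j i < n"
  by (auto simp: skip_def)

lemma skip_neq: "skip j i \<noteq> j"
  by (auto simp: skip_def)

lemma skip_inject [simp]: "skip j i = skip j i' \<longleftrightarrow> i = i'"
  by (auto simp: skip_def)

lemma filter_eq_drop_nth:
  assumes "j < length xs" "\<And>i. i < length xs \<Longrightarrow> P (xs ! i) \<longleftrightarrow> i \<noteq> j"
  shows "filter P xs = drop_nth j xs"
proof -
  have "filter P xs = filter P (take j xs @ xs ! j # drop (Suc j) xs)"
    using assms(1) by (simp add: id_take_nth_drop[symmetric])
  also have "\<dots> = filter P (take j xs) @ filter P (drop (Suc j) xs)"
    using assms by simp
  also have "filter P (take j xs) = take j xs"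
    using assms by (auto simp: filter_id_conv in_set_conv_nth)
  also have "filter P (drop (Suc j) xs) = drop (Suc j) xs"
    using assms by (auto simp: filter_id_conv in_set_conv_nth)
  finally show ?thesis by (simp add: drop_nth_def)
qed

lemma set_drop_nth: "set (drop_nth j xs) \<subseteq> set xs"
  by (auto simp: drop_nth_def dest: in_set_takeD in_set_dropD)

lemma length_config_start [simp]: "length (config_start u C) = length C"
  by (simp add: config_start_def)

lemma nth_config_start: "i < length C \<Longrightarrow> config_start u C ! i = (fst (C ! i), snd (C ! i) \<union> new_servers u C i)"
  by (simp add: config_start_def)

lemma map_fst_config_start [simp]: "map fst (config_start u C) = map fst C"
  by (rule nth_equalityI) (auto simp: nth_config_start)

lemma finite_busy_jobs [simp]: "finite (busy_jobs C)"
  and finite_waiting_jobs [simp]: "finite (waiting_jobs C)"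
  by (simp_all add: busy_jobs_def waiting_jobs_def)

lemma set_config_queue: "set (config_queue C s) = {i. i < length C \<and> s \<in> fst (C ! i)}"
  by (auto simp: config_queue_def)

lemma distinct_config_queue: "distinct (config_queue C s)"
  by (simp add: config_queue_def)

lemma job_typesD: "c \<in> job_types K d \<Longrightarrow> c \<subseteq> {1..K} \<and> card c = d \<and> finite c"
  by (auto simp: job_types_def intro: finite_subset)

lemma finite_job_types [simp]: "finite (job_types K d)"
  by (rule finite_subset[of _ "Pow {1..K}"]) (auto simp: job_types_def)

lemma consistent_nthD:
  assumes "consistent K d C" "i < length C"
  shows "fst (C ! i) \<in> job_types K d" "fst (C ! i) \<subseteq> {1..K}" "snd (C ! i) \<subseteq> fst (C ! i)"
    "finite (fst (C ! i))" "card (fst (C ! i)) = d"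
  using assms job_typesD[of "fst (C ! i)" K d] unfolding consistent_def by (auto dest: nth_mem)

lemma consistent_unique:
  "\<lbrakk>consistent K d C; i < length C; j < length C; s \<in> snd (C ! i); s \<in> snd (C ! j)\<rbrakk> \<Longrightarrow> i = j"
  unfolding consistent_def by blast

lemma config_idle_iff: "config_idle C s \<longleftrightarrow> (\<forall>i<length C. s \<notin> snd (C ! i))"
  by (auto simp: config_idle_def all_set_conv_all_nth)

lemma config_pick_in_queue:
  assumes "0 \<le> u s" "u s < 1" "i < length C" "s \<in> fst (C ! i)"
  shows "config_pick u C s < length C" "s \<in> fst (C ! config_pick u C s)"
proof -
  let ?q = "length (config_queue C s)"
  have "i \<in> set (config_queue C s)" using assms by (simp add: set_config_queue)
  then have "0 < ?q" by (rule length_pos_if_in_set)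
  then have "u s * real ?q < real ?q" "0 \<le> u s * real ?q" using assms by auto
  then have "nat \<lfloor>u s * real ?q\<rfloor> < ?q" by linarith
  then have "config_pick u C s \<in> set (config_queue C s)" unfolding config_pick_def by (rule nth_mem)
  then show "config_pick u C s < length C" "s \<in> fst (C ! config_pick u C s)" by (auto simp: set_config_queue)
qed

lemma consistent_config_start:
  assumes "consistent K d C"
  shows "consistent K d (config_start u C)"
  unfolding consistent_def
proof (intro conjI ballI allI impI)
  fix p assume "p \<in> set (config_start u C)"
  then obtain i where i: "i < length C" "p = config_start u C ! i" by (auto simp: in_set_conv_nth)
  then show "fst p \<in> job_types K d" "snd p \<subseteq> fst p"
    using consistent_nthD[OF assms i(1)] by (auto simp: nth_config_start new_servers_def)
next
  fix s i j assume "i < length (config_start u C)" "j < length (config_start u C)"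
    and s: "s \<in> snd (config_start u C ! i)" "s \<in> snd (config_start u C ! j)"
  then have ij: "i < length C" "j < length C" by auto
  show "i = j"
  proof (cases "config_idle C s")
    case True
    with s ij have "s \<in> new_servers u C i" "s \<in> new_servers u C j" by (auto simp: nth_config_start config_idle_iff)
    then show ?thesis by (simp add: new_servers_def)
  next
    case False
    then have "s \<in> snd (C ! i)" "s \<in> snd (C ! j)" using s ij by (auto simp: nth_config_start new_servers_def)
    then show ?thesis using consistent_unique[OF assms ij] by blast
  qed
qed

lemma valid_config_start:
  assumes C: "consistent K d C" and u: "choices_ok K u"
  shows "valid K d (config_start u C)"
  unfolding valid_def work_conserving_def
proof (intro conjI ballI consistent_config_start[OF C] notI)
  fix p s assume "p \<in> set (config_start u C)" "s \<in> fst p" and idle: "config_idle (config_start u C) s"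
  then obtain i where i: "i < length C" "s \<in> fst (C ! i)"
    by (auto simp: in_set_conv_nth nth_config_start)
  have idleC: "config_idle C s" using idle by (auto simp: config_idle_iff nth_config_start)
  have "0 \<le> u s" "u s < 1" using consistent_nthD(2)[OF C i(1)] i(2) u by (auto simp: choices_ok_def)
  note q = config_pick_in_queue[of u s i C, OF this i]
  then have "s \<in> new_servers u C (config_pick u C s)" using idleC by (simp add: new_servers_def)
  then show False using idle q by (auto simp: config_idle_iff nth_config_start)
qed

lemma consistent_arrival:
  assumes "consistent K d C" "c \<in> job_types K d"
  shows "consistent K d (C @ [(c, {})])"
proof -
  have sub: "i < length C" if "i < length (C @ [(c, {})])" "s \<in> snd ((C @ [(c, {})]) ! i)" for s i
    using that by (cases "i < length C") (auto simp: nth_append split: if_splits)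
  have "i = j" if "i < length (C @ [(c, {})])" "j < length (C @ [(c, {})])"
      "s \<in> snd ((C @ [(c, {})]) ! i)" "s \<in> snd ((C @ [(c, {})]) ! j)" for s i j
    using sub[OF that(1,3)] sub[OF that(2,4)] that consistent_unique[OF assms(1), of i j s]
    by (simp add: nth_append)
  with assms show ?thesis unfolding consistent_def by auto
qed

lemma consistent_drop_nth:
  assumes C: "consistent K d C" and j: "j < length C"
  shows "consistent K d (drop_nth j C)"
  unfolding consistent_def
proof (intro conjI ballI allI impI)
  fix p assume "p \<in> set (drop_nth j C)"
  then have "p \<in> set C" using set_drop_nth[of j C] by blast
  then show "fst p \<in> job_types K d" "snd p \<subseteq> fst p" using C unfolding consistent_def by blast+
next
  fix s i i' assume i: "i < length (drop_nth j C)" "i' < length (drop_nth j C)"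
    and s: "s \<in> snd (drop_nth j C ! i)" "s \<in> snd (drop_nth j C ! i')"
  have l: "i < length C - 1" "i' < length C - 1" using i j by simp_all
  have "skip j i = skip j i'"
    by (rule consistent_unique[OF C skip_less[OF j l(1)] skip_less[OF j l(2)]])
      (use s in \<open>simp_all only: nth_drop_nth[OF j l(1)] nth_drop_nth[OF j l(2)]\<close>)
  then show "i = i'" by simp
qed

lemma card_busy_jobs_le:
  assumes C: "consistent K d C" shows "card (busy_jobs C) \<le> K"
proof -
  have "\<exists>s. s \<in> snd (C ! i)" if "i \<in> busy_jobs C" for i using that by (auto simp: busy_jobs_def)
  then obtain f where f: "\<And>i. i \<in> busy_jobs C \<Longrightarrow> f i \<in> snd (C ! i)" by metis
  have "inj_on f (busy_jobs C)"
    using f consistent_unique[OF C] by (intro inj_onI) (metis (no_types, lifting) busy_jobs_def mem_Collect_eq)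
  moreover have "f ` busy_jobs C \<subseteq> {1..K}"
  proof clarify
    fix i assume i: "i \<in> busy_jobs C"
    then have "i < length C" by (simp add: busy_jobs_def)
    with f[OF i] consistent_nthD[OF C this] show "f i \<in> {1..K}" by blast
  qed
  ultimately show ?thesis using card_inj_on_le[of f "busy_jobs C" "{1..K}"] by simp
qed

lemma backlog_waiting:
  "backlog (waiting_types C) s = card {i \<in> waiting_jobs C. s \<in> fst (C ! i)}"
proof -
  have "backlog (waiting_types C) s = length (filter (\<lambda>p. snd p = {} \<and> s \<in> fst p) C)"
    by (simp add: backlog_def waiting_types_def filter_map o_def conj_commute)
  also have "\<dots> = card {i. i < length C \<and> snd (C ! i) = {} \<and> s \<in> fst (C ! i)}"
    by (rule length_filter_conv_card)
  finally show ?thesis by (simp add: waiting_jobs_def conj_assoc)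
qed

text \<open>
A job in the queue of \<open>s\<close> is either waiting or in service, and each of the \<open>K\<close>
servers serves at most one job.
\<close>

lemma length_config_queue_le:
  assumes "consistent K d C"
  shows "length (config_queue C s) \<le> backlog (waiting_types C) s + K"
proof -
  have "length (config_queue C s) = card {i. i < length C \<and> s \<in> fst (C ! i)}"
    using distinct_card[OF distinct_config_queue, of C s] by (simp add: set_config_queue)
  also have "\<dots> \<le> card ({i \<in> waiting_jobs C. s \<in> fst (C ! i)} \<union> busy_jobs C)"
    by (rule card_mono) (auto simp: waiting_jobs_def busy_jobs_def)
  also have "\<dots> \<le> card {i \<in> waiting_jobs C. s \<in> fst (C ! i)} + card (busy_jobs C)"
    by (rule card_Un_le)
  also have "\<dots> \<le> backlog (waiting_types C) s + K"
    using card_busy_jobs_le[OF assms] by (simp add: backlog_waiting)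
  finally show ?thesis .
qed

lemma sum_list_waiting_types:
  "(\<Sum>c\<leftarrow>waiting_types C. f c) = (\<Sum>i\<in>waiting_jobs C. f (fst (C ! i)))"
  for f :: "nat set \<Rightarrow> 'a::comm_monoid_add"
proof (induction C rule: rev_induct)
  case (snoc p C)
  have "waiting_jobs (C @ [p]) = (if snd p = {} then insert (length C) (waiting_jobs C) else waiting_jobs C)"
    by (auto simp: waiting_jobs_def nth_append less_Suc_eq)
  moreover have "(\<Sum>i\<in>waiting_jobs C. f (fst ((C @ [p]) ! i))) = (\<Sum>i\<in>waiting_jobs C. f (fst (C ! i)))"
    by (rule sum.cong) (auto simp: waiting_jobs_def nth_append)
  ultimately show ?case using snoc
    by (auto simp: waiting_types_def waiting_jobs_def add.commute)
qed (simp add: waiting_types_def waiting_jobs_def)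

lemma waiting_types_drop_nth:
  assumes "j \<in> busy_jobs C"
  shows "waiting_types (drop_nth j C) = waiting_types C"
proof -
  have j: "j < length C" "snd (C ! j) \<noteq> {}" using assms by (auto simp: busy_jobs_def)
  have "filter (\<lambda>p. snd p = {}) C = filter (\<lambda>p. snd p = {}) (take j C @ C ! j # drop (Suc j) C)"
    using j(1) by (simp add: id_take_nth_drop[symmetric])
  then show ?thesis using j(2) by (simp add: waiting_types_def drop_nth_def)
qed

definition energy :: "nat \<Rightarrow> nat set list \<Rightarrow> nat" where
  "energy K W = (\<Sum>s\<in>{1..K}. (backlog W s)\<^sup>2)"

definition weight :: "nat set list \<Rightarrow> nat set \<Rightarrow> nat" where
  "weight W c = (\<Sum>s\<in>c. backlog W s)"

lemma waiting_jobs_config_start: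
  "waiting_jobs (config_start u C) = {i \<in> waiting_jobs C. new_servers u C i = {}}"
  by (auto simp: waiting_jobs_def nth_config_start)

text \<open>
If the picks remove \<open>p s \<le> K\<close> waiting jobs from the queue of \<open>s\<close>, the square of the
backlog \<open>b s\<close> changes by \<open>- 2 * p s * b s + (p s)\<^sup>2\<close>. Exchanging sums turns
\<open>\<Sum>s. p s * b s\<close> into the total weight of the jobs picked. The inequality is stated without
subtraction so that it can be integrated in the extended nonnegative reals.
\<close>

lemma energy_config_start:
  assumes C: "consistent K d C"
  shows "energy K (waiting_types (config_start u C))
      + 2 * (\<Sum>i\<in>waiting_jobs C. if new_servers u C i \<noteq> {} then weight (waiting_types C) (fst (C ! i)) else 0)
    \<le> energy K (waiting_types C) + K ^ 3"
proof -
  let ?b = "backlog (waiting_types C)" and ?b' = "backlog (waiting_types (config_start u C))"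
  define P where "P = {i \<in> waiting_jobs C. new_servers u C i \<noteq> {}}"
  define p where "p s = card {i \<in> P. s \<in> fst (C ! i)}" for s
  have finP: "finite P" by (simp add: P_def)
  have "P \<subseteq> config_pick u C ` {1..K}"
  proof
    fix i assume "i \<in> P"
    then obtain s where "i < length C" "s \<in> fst (C ! i)" "config_pick u C s = i"
      by (auto simp: P_def new_servers_def waiting_jobs_def)
    with consistent_nthD(2)[OF C, of i] show "i \<in> config_pick u C ` {1..K}" by blast
  qed
  then have "card P \<le> K" using surj_card_le[of "{1..K}" P "config_pick u C"] by simp
  moreover have "p s \<le> card P" for s unfolding p_def by (rule card_mono) (auto simp: finP)
  ultimately have p: "p s \<le> K" for s using le_trans by blast
  have b: "?b s = ?b' s + p s" for s
  proof -
    have "{i \<in> waiting_jobs C. s \<in> fst (C ! i)}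
      = {i \<in> waiting_jobs (config_start u C). s \<in> fst (config_start u C ! i)} \<union> {i \<in> P. s \<in> fst (C ! i)}"
      by (auto simp: waiting_jobs_config_start P_def nth_config_start waiting_jobs_def)
    then show ?thesis unfolding backlog_waiting p_def
      by (subst card_Un_disjoint[symmetric]) (auto simp: waiting_jobs_config_start P_def)
  qed
  have "(\<Sum>i\<in>waiting_jobs C. if new_servers u C i \<noteq> {} then weight (waiting_types C) (fst (C ! i)) else 0)
      = (\<Sum>i\<in>P. \<Sum>s\<in>fst (C ! i). ?b s)"
    unfolding P_def weight_def by (rule sum.inter_filter[symmetric]) simp
  also have "\<dots> = (\<Sum>i\<in>P. \<Sum>s\<in>{1..K}. if s \<in> fst (C ! i) then ?b s else 0)"
  proof (rule sum.cong[OF refl])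
    fix i assume "i \<in> P"
    then have "fst (C ! i) \<subseteq> {1..K}" using consistent_nthD(2)[OF C] by (auto simp: P_def waiting_jobs_def)
    then show "(\<Sum>s\<in>fst (C ! i). ?b s) = (\<Sum>s\<in>{1..K}. if s \<in> fst (C ! i) then ?b s else 0)"
      by (simp add: sum.inter_restrict[symmetric] Int_absorb1)
  qed
  also have "\<dots> = (\<Sum>s\<in>{1..K}. \<Sum>i\<in>P. if s \<in> fst (C ! i) then ?b s else 0)"
    by (rule sum.swap)
  also have "\<dots> = (\<Sum>s\<in>{1..K}. p s * ?b s)"
    by (simp add: p_def sum.inter_filter[OF finP, symmetric])
  finally have "energy K (waiting_types (config_start u C)) + 2 * (\<Sum>i\<in>waiting_jobs C. if new_servers u C i \<noteq> {} then weight (waiting_types C) (fst (C ! i)) else 0)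
     = (\<Sum>s\<in>{1..K}. (?b' s)\<^sup>2 + 2 * (p s * ?b s))"
    by (simp add: energy_def sum.distrib sum_distrib_left)
  also have "\<dots> \<le> (\<Sum>s\<in>{1..K}. (?b s)\<^sup>2 + K\<^sup>2)"
  proof (rule sum_mono)
    fix s
    have "(?b' s)\<^sup>2 + 2 * (p s * ?b s) = (?b s)\<^sup>2 + (p s)\<^sup>2"
      by (simp add: b power2_eq_square algebra_simps)
    also have "(p s)\<^sup>2 \<le> K\<^sup>2" using p by (rule power_mono) simp
    finally show "(?b' s)\<^sup>2 + 2 * (p s * ?b s) \<le> (?b s)\<^sup>2 + K\<^sup>2" by simp
  qed
  also have "\<dots> = energy K (waiting_types C) + K ^ 3"
    by (simp add: energy_def sum.distrib power3_eq_cube power2_eq_square)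
  finally show ?thesis .
qed

text \<open>
An arrival adds at most one waiting job at the servers in its type, and picks can only lower the backlog.
\<close>

lemma energy_arrival:
  assumes c: "c \<subseteq> {1..K}"
  shows "energy K (waiting_types (config_start u (C @ [(c, {})])))
     \<le> energy K (waiting_types C) + 2 * weight (waiting_types C) c + card c"
proof -
  let ?b = "backlog (waiting_types C)"
  let ?C = "C @ [(c, {})]"
  have le: "backlog (waiting_types (config_start u ?C)) s \<le> ?b s + (if s \<in> c then 1 else 0)" for s
  proof -
    have "backlog (waiting_types (config_start u ?C)) s \<le> backlog (waiting_types ?C) s"
      unfolding backlog_waiting by (rule card_mono) (auto simp: waiting_jobs_config_start nth_config_start waiting_jobs_def)
    also have "\<dots> = ?b s + (if s \<in> c then 1 else 0)" by (simp add: backlog_def waiting_types_def)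
    finally show ?thesis .
  qed
  have "energy K (waiting_types (config_start u ?C)) \<le> (\<Sum>s\<in>{1..K}. (?b s + (if s \<in> c then 1 else 0))\<^sup>2)"
    unfolding energy_def by (intro sum_mono power_mono le) simp
  also have "\<dots> = (\<Sum>s\<in>{1..K}. (?b s)\<^sup>2 + (if s \<in> c then 2 * ?b s + 1 else 0))"
    by (rule sum.cong) (auto simp: power2_eq_square algebra_simps)
  also have "\<dots> = energy K (waiting_types C) + (\<Sum>s\<in>c. 2 * ?b s + 1)"
    using c by (simp add: energy_def sum.distrib sum.inter_restrict[symmetric] Int_absorb1)
  also have "(\<Sum>s\<in>c. 2 * ?b s + 1) = 2 * weight (waiting_types C) c + card c"
    unfolding weight_def by (simp add: sum_Suc sum_distrib_left)
  finally show ?thesis by simp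
qed

section \<open>Random choices of the servers\<close>

definition choice_law :: "nat \<Rightarrow> (nat \<Rightarrow> real) measure" where
  "choice_law K = (\<Pi>\<^sub>M s\<in>{1..K}. uniform_measure lborel {0..<1})"

lemma sets_choice_law [measurable_cong, simp]: "sets (choice_law K) = sets (clocks {1..K})"
  unfolding choice_law_def by (rule sets_PiM_cong) auto

lemma space_choice_law [simp]: "space (choice_law K) = space (clocks {1..K})"
  by (rule sets_eq_imp_space_eq) simp

lemma prob_space_unif: "prob_space (uniform_measure lborel {0..<1::real})"
  by (rule prob_space_uniform_measure) auto

lemma prob_space_choice_law: "prob_space (choice_law K)"
  unfolding choice_law_def by (intro prob_space_PiM prob_space_unif)

lemma AE_choices_ok: "AE u in choice_law K. choices_ok K u"
  unfolding choices_ok_def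
proof (rule AE_ball_countable[THEN iffD2], safe)
  fix s assume "s \<in> {1..K}"
  have "AE x in uniform_measure lborel {0..<1}. 0 \<le> x \<and> x < (1::real)"
    by (rule AE_uniform_measureI) auto
  with \<open>s \<in> {1..K}\<close> show "AE u in choice_law K. 0 \<le> u s \<and> u s < 1"
    unfolding choice_law_def by (intro AE_PiM_component prob_space_unif)
qed auto

text \<open>
The choices enter only through finitely many integer positions, which take values in a discrete product space.
\<close>

lemma measurable_config_start [measurable]:
  assumes "consistent K d C"
  shows "(\<lambda>u. config_start u C) \<in> measurable (clocks {1..K}) (count_space UNIV)"
proof -
  define D where "D u = (\<lambda>s\<in>{1..K}. nat \<lfloor>u s * real (length (config_queue C s))\<rfloor>)" for u :: "nat \<Rightarrow> real"
  define \<Psi> where "\<Psi> p = map (\<lambda>i. (fst (C ! i), snd (C ! i) \<union>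
      {s. config_idle C s \<and> s \<in> fst (C ! i) \<and> config_queue C s ! p s = i})) [0..<length C]" for p
  have "D \<in> measurable (clocks {1..K}) (PiM {1..K} (\<lambda>_. count_space UNIV))"
    unfolding D_def by measurable
  also have "PiM {1..K} (\<lambda>_. count_space UNIV) = count_space (PiE {1..K} (\<lambda>_. UNIV :: nat set))"
    by (rule count_space_PiM_finite) auto
  finally have "(\<lambda>u. \<Psi> (D u)) \<in> measurable (clocks {1..K}) (count_space UNIV)"
    by (rule measurable_compose) simp
  moreover have "\<Psi> (D u) = config_start u C" for u
  proof -
    have "s \<in> {1..K}" if "s \<in> fst (C ! i)" "i < length C" for s i
      using consistent_nthD(2)[OF assms that(2)] that(1) by blast
    then show ?thesis unfolding \<Psi>_def config_start_def new_servers_def config_pick_def D_def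
      by (intro map_cong) auto
  qed
  ultimately show ?thesis by simp
qed

text \<open>
Used as the bound \<open>1 - (\<Prod>s\<in>S. 1 - x s) \<ge> sum x S / (1 + sum x S)\<close> on the probability that
at least one of several independent events occurs. Unlike the Bonferroni inequality, it does not become trivial when
\<open>sum x S\<close> is large.
\<close>

lemma one_minus_prod_ge:
  fixes x :: "'a \<Rightarrow> real"
  assumes "finite S" "\<And>s. s \<in> S \<Longrightarrow> 0 \<le> x s \<and> x s \<le> 1"
  shows "(1 + sum x S) * (\<Prod>s\<in>S. 1 - x s) \<le> 1"
  using assms
proof (induction S rule: finite_induct)
  case (insert a S)
  let ?X = "sum x S" and ?P = "\<Prod>s\<in>S. 1 - x s"
  have P: "0 \<le> ?P" and X: "0 \<le> ?X" using insert by (auto intro!: prod_nonneg sum_nonneg)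
  have a: "0 \<le> x a" using insert.prems by simp
  have "(1 + (x a + ?X)) * (1 - x a) = 1 + ?X - x a * (?X + x a)" by (simp add: algebra_simps)
  also have "\<dots> \<le> 1 + ?X" using a X by simp
  finally have "(1 + (x a + ?X)) * (1 - x a) * ?P \<le> (1 + ?X) * ?P" using P by (rule mult_right_mono)
  also have "\<dots> \<le> 1" using insert by simp
  finally show ?case using insert.hyps by (simp add: mult.assoc)
qed simp

text \<open>
The idle servers in \<open>S\<close> pick position \<open>i\<close> independently, each with probability one over
the length of its queue, because \<open>s\<close> picks \<open>i\<close> when its uniform variable falls into a
subinterval of that length.
\<close>

lemma prob_started_ge:
  assumes C: "consistent K d C" and i: "i < length C"
    and S: "S \<subseteq> fst (C ! i)" "\<And>s. s \<in> S \<Longrightarrow> config_idle C s"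
  defines "X \<equiv> \<Sum>s\<in>S. 1 / real (length (config_queue C s))"
  shows "ennreal (X / (1 + X)) \<le> (\<integral>\<^sup>+u. indicator {u. new_servers u C i \<noteq> {}} u \<partial>choice_law K)"
proof -
  interpret U: prob_space "choice_law K" by (rule prob_space_choice_law)
  let ?q = "\<lambda>s. length (config_queue C s)"
  have SK: "S \<subseteq> {1..K}" using S(1) consistent_nthD(2)[OF C i] by blast
  have finS: "finite S" using SK by (rule finite_subset) simp
  have "\<exists>k<?q s. config_queue C s ! k = i" if "s \<in> S" for s
    using S(1) that i by (subst in_set_conv_nth[symmetric]) (auto simp: set_config_queue)
  then obtain k where k: "\<And>s. s \<in> S \<Longrightarrow> k s < ?q s" "\<And>s. s \<in> S \<Longrightarrow> config_queue C s ! k s = i" by metis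
  \<comment> \<open>The choices \<open>u s\<close> for which server \<open>s\<close> picks position \<open>i\<close>, which is entry \<open>k s\<close> of its queue.\<close>
  define I where "I s = {real (k s) / real (?q s) ..< (real (k s) + 1) / real (?q s)}" for s
  have pick: "config_pick u C s = i" if "s \<in> S" "u s \<in> I s" for u s
  proof -
    have "0 < ?q s" using k(1)[OF that(1)] by linarith
    then have "real (k s) \<le> u s * ?q s" "u s * ?q s < real (k s) + 1"
      using that(2) by (auto simp: I_def field_simps)
    then have "nat \<lfloor>u s * ?q s\<rfloor> = k s" by linarith
    then show ?thesis using k(2)[OF that(1)] by (simp add: config_pick_def)
  qed
  define B where "B = (\<Pi>\<^sub>E s\<in>{1..K}. if s \<in> S then - I s else UNIV)"
  have unif: "emeasure (uniform_measure lborel {0..<1}) (- I s) = ennreal (1 - 1 / ?q s)" if s: "s \<in> S" for s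
  proof -
    interpret u: prob_space "uniform_measure lborel {0..<1::real}" by (rule prob_space_unif)
    have q: "0 < ?q s" using k(1)[OF s] by linarith
    have sub: "{0..<1} \<inter> I s = I s"
    proof -
      have "(real (k s) + 1) / real (?q s) \<le> 1" using k(1)[OF s] by (simp add: divide_simps)
      then show ?thesis by (auto simp: I_def)
    qed
    have "emeasure (uniform_measure lborel {0..<1}) (I s) = emeasure lborel (I s)"
      using sub by (simp add: emeasure_uniform_measure I_def divide_ennreal_def)
    also have "\<dots> = ennreal (1 / ?q s)"
      using q by (simp add: I_def divide_simps)
    finally have "u.prob (I s) = 1 / ?q s" by (simp add: measure_def)
    then show ?thesis using u.prob_compl[of "I s"]
      by (simp add: u.emeasure_eq_measure I_def Compl_eq_Diff_UNIV)
  qed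
  interpret P: product_sigma_finite "\<lambda>_::nat. uniform_measure lborel {0..<1::real}"
    by (intro product_sigma_finite.intro prob_space_imp_sigma_finite prob_space_unif)
  have Bm: "B \<in> sets (choice_law K)"
    unfolding B_def sets_choice_law by (rule sets_PiM_I_finite) (auto simp: I_def)
  have q1: "s \<in> S \<Longrightarrow> 1 / real (?q s) \<le> 1" for s using k(1)[of s] by (simp add: divide_simps)
  have "emeasure (choice_law K) B = (\<Prod>s\<in>{1..K}. emeasure (uniform_measure lborel {0..<1}) (if s \<in> S then - I s else UNIV))"
    unfolding B_def choice_law_def by (rule P.emeasure_PiM) (auto simp: I_def)
  also have "\<dots> = (\<Prod>s\<in>S. ennreal (1 - 1 / ?q s))"
    using SK prob_space.emeasure_space_1[OF prob_space_unif]
    by (subst prod.mono_neutral_right[of "{1..K}" S]) (auto simp: unif intro!: prod.cong)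
  also have "\<dots> = ennreal (\<Prod>s\<in>S. 1 - 1 / ?q s)"
    using q1 by (intro prod_ennreal) auto
  finally have PB: "U.prob B = (\<Prod>s\<in>S. 1 - 1 / ?q s)"
    using q1 by (simp add: measure_def prod_nonneg)
  have X0: "0 \<le> X" unfolding X_def by (intro sum_nonneg) auto
  have "(1 + X) * U.prob B \<le> 1"
    unfolding PB X_def using q1 by (intro one_minus_prod_ge finS) auto
  then have "X / (1 + X) \<le> 1 - U.prob B" using X0 by (simp add: field_simps)
  also have "\<dots> = U.prob (space (choice_law K) - B)" using U.prob_compl[OF Bm] by simp
  finally have "ennreal (X / (1 + X)) \<le> emeasure (choice_law K) (space (choice_law K) - B)"
    by (simp add: U.emeasure_eq_measure ennreal_leI)
  also have "\<dots> = (\<integral>\<^sup>+u. indicator (space (choice_law K) - B) u \<partial>choice_law K)"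
    using Bm by (subst nn_integral_indicator) auto
  also have "\<dots> \<le> (\<integral>\<^sup>+u. indicator {u. new_servers u C i \<noteq> {}} u \<partial>choice_law K)"
  proof (rule nn_integral_mono)
    fix u assume u: "u \<in> space (choice_law K)"
    show "indicator (space (choice_law K) - B) u \<le> (indicator {u. new_servers u C i \<noteq> {}} u :: ennreal)"
    proof (cases "u \<in> B")
      case False
      with u obtain s where "s \<in> S" "u s \<in> I s"
        unfolding B_def by (auto simp: space_PiM PiE_iff extensional_def split: if_splits)
      then have "s \<in> new_servers u C i" using S pick by (auto simp: new_servers_def)
      then show ?thesis by (auto simp: indicator_def)
    qed simp
  qed
  finally show ?thesis .
qed

section \<open>Drift of the waiting backlog\<close>

text \<open>
The inequality behind stability: a job whose servers have unequal queues is picked often enough at the short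
ones.
\<close>

lemma sum_sum_quotient_ge:
  fixes y :: "'a \<Rightarrow> real"
  assumes "\<And>s. s \<in> c \<Longrightarrow> 0 < y s"
  shows "(real (card c))\<^sup>2 \<le> (\<Sum>s\<in>c. y s) * (\<Sum>s\<in>c. 1 / y s)"
proof -
  have "(\<Sum>s\<in>c. sqrt (y s) * sqrt (1 / y s))\<^sup>2 \<le> (\<Sum>s\<in>c. (sqrt (y s))\<^sup>2) * (\<Sum>s\<in>c. (sqrt (1 / y s))\<^sup>2)"
    by (rule Cauchy_Schwarz_ineq_sum)
  moreover have "(\<Sum>s\<in>c. sqrt (y s) * sqrt (1 / y s)) = real (card c)"
    using assms by (simp add: real_sqrt_mult[symmetric] less_imp_neq[symmetric])
  moreover have "(\<Sum>s\<in>c. (sqrt (y s))\<^sup>2) = (\<Sum>s\<in>c. y s)"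
    using assms by (intro sum.cong) (auto simp: less_imp_le)
  moreover have "(\<Sum>s\<in>c. (sqrt (1 / y s))\<^sup>2) = (\<Sum>s\<in>c. 1 / y s)"
    using assms by (intro sum.cong) (auto simp: less_imp_le)
  ultimately show ?thesis by simp
qed

text \<open>
A lower bound for the expected number of servers in \<open>c\<close> that would pick a given job, if all of them
chose anew; \<open>K\<close> accounts for the jobs in service.
\<close>

definition inv_load :: "nat \<Rightarrow> nat set list \<Rightarrow> nat set \<Rightarrow> real" where
  "inv_load K W c = (\<Sum>s\<in>c. 1 / (real (backlog W s) + real K))"

lemma inv_load_nonneg: "0 \<le> inv_load K W c"
  unfolding inv_load_def by (intro sum_nonneg) auto

text \<open>
The main term \<open>d ^ 2\<close> comes from Cauchy-Schwarz. The correction is linear in the inverse load, whose sum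
over all waiting jobs is at most \<open>K\<close> by \<open>sum_inv_load_le\<close>; so the correction amounts
to a constant, however the jobs are distributed.
\<close>

lemma weight_fraction_ge:
  fixes W :: "nat set list" and c :: "nat set" and K d :: nat
  assumes K: "0 < K" and c: "card c = d"
  defines "X \<equiv> inv_load K W c"
  shows "(real d)\<^sup>2 - ((real d)\<^sup>2 + real K * real d) * X \<le> real (weight W c) * (X / (1 + X))"
proof -
  let ?y = "\<lambda>s. real (backlog W s) + real K"
  let ?D = "(real d)\<^sup>2" and ?E = "real K * real d"
  have X: "0 \<le> X" unfolding X_def by (rule inv_load_nonneg)
  have "?D \<le> (\<Sum>s\<in>c. ?y s) * X"
    unfolding X_def inv_load_def c[symmetric] using K by (intro sum_sum_quotient_ge) auto
  also have "(\<Sum>s\<in>c. ?y s) = real (weight W c) + ?E"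
    by (simp add: weight_def sum.distrib c)
  finally have "?D - ?E * X \<le> real (weight W c) * X" by (simp add: algebra_simps)
  then have "(?D - ?E * X) / (1 + X) \<le> real (weight W c) * X / (1 + X)"
    using X by (intro divide_right_mono) auto
  moreover have "?D - (?D + ?E) * X \<le> (?D - ?E * X) / (1 + X)"
  proof -
    have "(?D - (?D + ?E) * X) * (1 + X) = (?D - ?E * X) - (?D + ?E) * X * X"
      by (simp add: algebra_simps)
    also have "\<dots> \<le> ?D - ?E * X" using X by simp
    finally show ?thesis using X by (simp add: pos_le_divide_eq)
  qed
  ultimately show ?thesis by simp
qed

text \<open>
Summed over servers instead of jobs, each server contributes \<open>Q / (Q + K) \<le> 1\<close>.
\<close>

lemma sum_inv_load_le:
  assumes C: "consistent K d C"
  shows "(\<Sum>i\<in>waiting_jobs C. inv_load K (waiting_types C) (fst (C ! i))) \<le> real K"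
proof -
  let ?b = "\<lambda>s. real (backlog (waiting_types C) s)"
  have "(\<Sum>i\<in>waiting_jobs C. inv_load K (waiting_types C) (fst (C ! i)))
     = (\<Sum>i\<in>waiting_jobs C. \<Sum>s\<in>{1..K}. if s \<in> fst (C ! i) then 1 / (?b s + real K) else 0)"
  proof (rule sum.cong[OF refl])
    fix i assume "i \<in> waiting_jobs C"
    then have "fst (C ! i) \<subseteq> {1..K}" using consistent_nthD(2)[OF C] by (auto simp: waiting_jobs_def)
    then show "inv_load K (waiting_types C) (fst (C ! i)) = (\<Sum>s\<in>{1..K}. if s \<in> fst (C ! i) then 1 / (?b s + real K) else 0)"
      by (simp add: inv_load_def sum.inter_restrict[symmetric] Int_absorb1)
  qed
  also have "\<dots> = (\<Sum>s\<in>{1..K}. \<Sum>i\<in>waiting_jobs C. if s \<in> fst (C ! i) then 1 / (?b s + real K) else 0)"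
    by (rule sum.swap)
  also have "\<dots> = (\<Sum>s\<in>{1..K}. ?b s / (?b s + real K))"
    by (simp add: backlog_waiting sum.inter_filter[OF finite_waiting_jobs, symmetric])
  also have "\<dots> \<le> (\<Sum>s\<in>{1..K}. 1)"
    by (intro sum_mono) (simp add: divide_simps)
  finally show ?thesis by simp
qed

lemma sum_weight:
  assumes C: "consistent K d C"
  shows "(\<Sum>s\<in>{1..K}. backlog (waiting_types C) s) = d * card (waiting_jobs C)"
proof -
  have "(\<Sum>s\<in>{1..K}. backlog (waiting_types C) s) = (\<Sum>s\<in>{1..K}. \<Sum>i\<in>waiting_jobs C. if s \<in> fst (C ! i) then 1 else 0)"
    by (simp add: backlog_waiting sum.inter_filter[OF finite_waiting_jobs, symmetric])
  also have "\<dots> = (\<Sum>i\<in>waiting_jobs C. \<Sum>s\<in>{1..K}. if s \<in> fst (C ! i) then 1 else 0)"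
    by (rule sum.swap)
  also have "\<dots> = (\<Sum>i\<in>waiting_jobs C. d)"
  proof (rule sum.cong[OF refl])
    fix i assume "i \<in> waiting_jobs C"
    then have "fst (C ! i) \<subseteq> {1..K}" "card (fst (C ! i)) = d"
      using consistent_nthD[OF C] by (auto simp: waiting_jobs_def)
    then show "(\<Sum>s\<in>{1..K}. if s \<in> fst (C ! i) then 1 else 0) = d"
      by (simp add: sum.inter_restrict[symmetric] Int_absorb1)
  qed
  finally show ?thesis by simp
qed

text \<open>
Double counting of the incidences between servers and types: by symmetry each server lies in a fraction
\<open>d / K\<close> of the types.
\<close>

lemma card_types_containing:
  assumes "1 \<le> d" "d \<le> K" "s \<in> {1..K}"
  shows "K * card {c \<in> job_types K d. s \<in> c} = d * card (job_types K d)"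
proof -
  have "bij_betw (insert s) {c. c \<subseteq> {1..K} - {s} \<and> card c = d - 1} {c \<in> job_types K d. s \<in> c}"
  proof (rule bij_betw_byWitness[where f' = "\<lambda>c. c - {s}"])
    show "insert s ` {c. c \<subseteq> {1..K} - {s} \<and> card c = d - 1} \<subseteq> {c \<in> job_types K d. s \<in> c}"
      using assms by (auto simp: job_types_def card_insert_if finite_subset[of _ "{1..K} - {s}"] subset_iff)
    show "(\<lambda>c. c - {s}) ` {c \<in> job_types K d. s \<in> c} \<subseteq> {c. c \<subseteq> {1..K} - {s} \<and> card c = d - 1}"
      by (auto simp: job_types_def)
  qed (auto simp: insert_absorb)
  then have "card {c \<in> job_types K d. s \<in> c} = card {c. c \<subseteq> {1..K} - {s} \<and> card c = d - 1}"
    by (simp add: bij_betw_same_card)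
  also have "\<dots> = (K - 1) choose (d - 1)"
    using assms by (subst n_subsets) auto
  finally have 1: "card {c \<in> job_types K d. s \<in> c} = (K - 1) choose (d - 1)" .
  have 2: "card (job_types K d) = K choose d"
    unfolding job_types_def by (subst n_subsets) auto
  show ?thesis unfolding 1 2 using assms times_binomial_minus1_eq[of d K] by simp
qed

lemma sum_weight_types:
  assumes "1 \<le> d" "d \<le> K" and C: "consistent K d C"
  shows "real K * (\<Sum>c\<in>job_types K d. real (weight (waiting_types C) c))
    = (real d)\<^sup>2 * real (card (job_types K d)) * real (card (waiting_jobs C))"
proof -
  let ?b = "backlog (waiting_types C)"
  have "(\<Sum>c\<in>job_types K d. weight (waiting_types C) c) = (\<Sum>c\<in>job_types K d. \<Sum>s\<in>{1..K}. if s \<in> c then ?b s else 0)"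
  proof (rule sum.cong[OF refl])
    fix c assume "c \<in> job_types K d"
    then have "c \<subseteq> {1..K}" by (simp add: job_types_def)
    then show "weight (waiting_types C) c = (\<Sum>s\<in>{1..K}. if s \<in> c then ?b s else 0)"
      by (simp add: weight_def sum.inter_restrict[symmetric] Int_absorb1)
  qed
  also have "\<dots> = (\<Sum>s\<in>{1..K}. \<Sum>c\<in>job_types K d. if s \<in> c then ?b s else 0)" by (rule sum.swap)
  also have "\<dots> = (\<Sum>s\<in>{1..K}. card {c \<in> job_types K d. s \<in> c} * ?b s)"
    by (simp add: sum.inter_filter[OF finite_job_types, symmetric])
  finally have "K * (\<Sum>c\<in>job_types K d. weight (waiting_types C) c) = (\<Sum>s\<in>{1..K}. (K * card {c \<in> job_types K d. s \<in> c}) * ?b s)"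
    by (simp add: sum_distrib_left mult.assoc)
  also have "\<dots> = (\<Sum>s\<in>{1..K}. (d * card (job_types K d)) * ?b s)"
    by (intro sum.cong refl, subst card_types_containing[OF assms(1,2)]) auto
  also have "\<dots> = d * card (job_types K d) * (d * card (waiting_jobs C))"
    by (simp only: sum_distrib_left[symmetric] sum_weight[OF C])
  finally have "real (K * (\<Sum>c\<in>job_types K d. weight (waiting_types C) c)) = real (d * card (job_types K d) * (d * card (waiting_jobs C)))"
    by (simp only:)
  then show ?thesis by (simp add: power2_eq_square ac_simps)
qed

text \<open>
The departing job \<open>j\<close> was in service, so its removal alone leaves the waiting jobs unchanged; the
energy falls through the picks of the servers \<open>snd (C ! j)\<close> that it frees. The second statement
ensures that the bound in the first is not truncated at \<open>0\<close>.
\<close>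

lemma departure_energy:
  assumes C: "consistent K d C" and j: "j \<in> busy_jobs C" and K: "0 < K"
  defines "W \<equiv> waiting_types C"
  defines "X \<equiv> \<lambda>c. inv_load K W (c \<inter> snd (C ! j))"
  shows "(\<integral>\<^sup>+u. ennreal (energy K (waiting_types (config_start u (drop_nth j C)))) \<partial>choice_law K)
     \<le> ennreal (energy K W + real K ^ 3 - 2 * (\<Sum>i\<in>waiting_jobs C. weight W (fst (C ! i)) * (X (fst (C ! i)) / (1 + X (fst (C ! i))))))"
    (is "?I \<le> ennreal (_ - 2 * ?S)")
    and "2 * (\<Sum>i\<in>waiting_jobs C. weight W (fst (C ! i)) * (X (fst (C ! i)) / (1 + X (fst (C ! i))))) \<le> energy K W + real K ^ 3"
proof -
  interpret U: prob_space "choice_law K" by (rule prob_space_choice_law)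
  have jl: "j < length C" using j by (simp add: busy_jobs_def)
  let ?D = "drop_nth j C"
  have D: "consistent K d ?D" by (rule consistent_drop_nth[OF C jl])
  have W: "waiting_types ?D = W" unfolding W_def by (rule waiting_types_drop_nth[OF j])
  have idle: "config_idle ?D s" if "s \<in> snd (C ! j)" for s
    unfolding config_idle_iff
  proof (intro allI impI notI)
    fix i assume "i < length ?D" "s \<in> snd (?D ! i)"
    then have i: "i < length C - 1" "s \<in> snd (C ! skip j i)" using jl by (auto simp: nth_drop_nth)
    have "skip j i = j" by (rule consistent_unique[OF C skip_less[OF jl i(1)] jl i(2) that])
    then show False using skip_neq by blast
  qed
  let ?\<psi> = "\<lambda>c. X c / (1 + X c)"
  have X0: "0 \<le> X c" for c unfolding X_def by (rule inv_load_nonneg)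
  have S: "?S = (\<Sum>i\<in>waiting_jobs ?D. weight W (fst (?D ! i)) * ?\<psi> (fst (?D ! i)))"
    unfolding sum_list_waiting_types[symmetric, of "\<lambda>c. real (weight W c) * ?\<psi> c"] W
    by (simp add: W_def)
  have S0: "0 \<le> ?S" using X0 by (intro sum_nonneg) auto
  have started: "ennreal (?\<psi> (fst (?D ! i))) \<le> (\<integral>\<^sup>+u. indicator {u. new_servers u ?D i \<noteq> {}} u \<partial>choice_law K)"
    if "i \<in> waiting_jobs ?D" for i
  proof -
    have il: "i < length ?D" using that by (simp add: waiting_jobs_def)
    let ?T = "fst (?D ! i) \<inter> snd (C ! j)"
    define Y where "Y = (\<Sum>s\<in>?T. 1 / real (length (config_queue ?D s)))"
    have Y: "ennreal (Y / (1 + Y)) \<le> (\<integral>\<^sup>+u. indicator {u. new_servers u ?D i \<noteq> {}} u \<partial>choice_law K)"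
      unfolding Y_def by (rule prob_started_ge[OF D il]) (auto simp: idle)
    have "X (fst (?D ! i)) \<le> Y"
      unfolding X_def Y_def inv_load_def
    proof (rule sum_mono)
      fix s assume s: "s \<in> ?T"
      then have "i \<in> set (config_queue ?D s)" using il by (simp add: set_config_queue)
      then have "0 < length (config_queue ?D s)" by (rule length_pos_if_in_set)
      moreover have "length (config_queue ?D s) \<le> backlog W s + K"
        using length_config_queue_le[OF D, of s] by (simp add: W)
      ultimately have "0 < real (length (config_queue ?D s))" "real (length (config_queue ?D s)) \<le> real (backlog W s) + real K"
        by linarith+
      then show "1 / (real (backlog W s) + real K) \<le> 1 / real (length (config_queue ?D s))"
        by (intro frac_le) auto
    qed
    then have "?\<psi> (fst (?D ! i)) \<le> Y / (1 + Y)"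
      using X0[of "fst (?D ! i)"] by (simp add: divide_simps) (simp add: algebra_simps)
    then show ?thesis using Y by (meson ennreal_leI order.trans)
  qed
  have fm: "(\<lambda>u. f (config_start u ?D)) \<in> borel_measurable (choice_law K)" for f :: "config \<Rightarrow> ennreal"
    by (subst measurable_cong_sets[OF sets_choice_law refl])
      (rule measurable_compose[OF measurable_config_start[OF D]], simp)
  have ind: "indicator {u. new_servers u ?D i \<noteq> {}} u = (if i \<notin> waiting_jobs (config_start u ?D) then 1 else 0 :: ennreal)"
    if "i \<in> waiting_jobs ?D" for u i
    using that by (simp add: waiting_jobs_config_start indicator_def)
  have indm: "(\<lambda>u. indicator {u. new_servers u ?D i \<noteq> {}} u :: ennreal) \<in> borel_measurable (choice_law K)"
    if "i \<in> waiting_jobs ?D" for i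
    unfolding ind[OF that] by (rule fm[of "\<lambda>C'. if i \<notin> waiting_jobs C' then 1 else 0"])
  let ?w = "\<lambda>i. weight W (fst (?D ! i))"
  have "?I + ennreal (2 * ?S) \<le> ?I + (\<Sum>i\<in>waiting_jobs ?D. ennreal (2 * ?w i) * (\<integral>\<^sup>+u. indicator {u. new_servers u ?D i \<noteq> {}} u \<partial>choice_law K))"
  proof (rule add_left_mono)
    have "ennreal (2 * ?S) = (\<Sum>i\<in>waiting_jobs ?D. ennreal (2 * ?w i) * ennreal (?\<psi> (fst (?D ! i))))"
      unfolding S sum_distrib_left using X0
      by (subst sum_ennreal[symmetric]) (auto simp: ennreal_mult[symmetric] mult.assoc intro!: sum.cong)
    also have "\<dots> \<le> (\<Sum>i\<in>waiting_jobs ?D. ennreal (2 * ?w i) * (\<integral>\<^sup>+u. indicator {u. new_servers u ?D i \<noteq> {}} u \<partial>choice_law K))"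
      by (intro sum_mono mult_left_mono started) auto
    finally show "ennreal (2 * ?S) \<le> \<dots>" .
  qed
  also have "\<dots> = (\<integral>\<^sup>+u. ennreal (energy K (waiting_types (config_start u ?D)))
      + (\<Sum>i\<in>waiting_jobs ?D. ennreal (2 * ?w i) * indicator {u. new_servers u ?D i \<noteq> {}} u) \<partial>choice_law K)"
  proof -
    define h :: "nat \<Rightarrow> (nat \<Rightarrow> real) \<Rightarrow> ennreal" where "h i u = indicator {u. new_servers u ?D i \<noteq> {}} u" for i u
    define w where "w i = ennreal (2 * ?w i)" for i
    define g where "g u = ennreal (energy K (waiting_types (config_start u ?D)))" for u
    have [measurable]: "h i \<in> borel_measurable (choice_law K)" if "i \<in> waiting_jobs ?D" for i
      unfolding h_def by (rule indm[OF that])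
    have [measurable]: "g \<in> borel_measurable (choice_law K)"
      unfolding g_def by (rule fm)
    have "(\<integral>\<^sup>+u. g u \<partial>choice_law K) + (\<Sum>i\<in>waiting_jobs ?D. w i * (\<integral>\<^sup>+u. h i u \<partial>choice_law K))
       = (\<integral>\<^sup>+u. g u + (\<Sum>i\<in>waiting_jobs ?D. w i * h i u) \<partial>choice_law K)"
      by (subst nn_integral_add, measurable, subst nn_integral_sum, measurable) (simp add: nn_integral_cmult)
    then show ?thesis by (simp only: g_def h_def w_def)
  qed
  also have "\<dots> \<le> (\<integral>\<^sup>+u. ennreal (energy K W + real K ^ 3) \<partial>choice_law K)"
  proof (rule nn_integral_mono)
    fix u
    let ?N = "\<Sum>i\<in>waiting_jobs ?D. if new_servers u ?D i \<noteq> {} then ?w i else 0"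
    have "(\<Sum>i\<in>waiting_jobs ?D. ennreal (2 * ?w i) * indicator {u. new_servers u ?D i \<noteq> {}} u) = ennreal (real (2 * ?N))"
    proof -
      have "(\<Sum>i\<in>waiting_jobs ?D. ennreal (2 * ?w i) * indicator {u. new_servers u ?D i \<noteq> {}} u)
         = (\<Sum>i\<in>waiting_jobs ?D. ennreal (real (2 * (if new_servers u ?D i \<noteq> {} then ?w i else 0))))"
        by (intro sum.cong refl) (auto simp: indicator_def)
      also have "\<dots> = ennreal (\<Sum>i\<in>waiting_jobs ?D. real (2 * (if new_servers u ?D i \<noteq> {} then ?w i else 0)))"
        by (rule sum_ennreal) auto
      finally show ?thesis by (simp only: sum_distrib_left of_nat_sum)
    qed
    then have "ennreal (energy K (waiting_types (config_start u ?D))) + (\<Sum>i\<in>waiting_jobs ?D. ennreal (2 * ?w i) * indicator {u. new_servers u ?D i \<noteq> {}} u)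
      = ennreal (real (energy K (waiting_types (config_start u ?D)))) + ennreal (real (2 * ?N))"
      by (simp only:)
    also have "\<dots> = ennreal (real (energy K (waiting_types (config_start u ?D)) + 2 * ?N))"
      by (simp only: ennreal_plus[OF of_nat_0_le_iff of_nat_0_le_iff] of_nat_add)
    also have "\<dots> \<le> ennreal (real (energy K W + K ^ 3))"
      using energy_config_start[OF D, of u] unfolding W by (intro ennreal_leI of_nat_mono) simp
    finally show "ennreal (energy K (waiting_types (config_start u ?D))) + (\<Sum>i\<in>waiting_jobs ?D. ennreal (2 * ?w i) * indicator {u. new_servers u ?D i \<noteq> {}} u)
       \<le> ennreal (energy K W + real K ^ 3)" by simp
  qed
  also have "\<dots> = ennreal (energy K W + real K ^ 3)" using U.emeasure_space_1 by simp
  finally have *: "?I + ennreal (2 * ?S) \<le> ennreal (energy K W + real K ^ 3)" .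
  then have "?I + ennreal (2 * ?S) - ennreal (2 * ?S) \<le> ennreal (energy K W + real K ^ 3) - ennreal (2 * ?S)"
    by (rule ennreal_minus_mono) simp
  also have "ennreal (energy K W + real K ^ 3) - ennreal (2 * ?S) = ennreal (energy K W + real K ^ 3 - 2 * ?S)"
    by (rule ennreal_minus) (rule mult_nonneg_nonneg[OF _ S0], simp)
  also have "?I + ennreal (2 * ?S) - ennreal (2 * ?S) = ?I"
    by (rule ennreal_add_diff_cancel_right) simp
  finally show "?I \<le> ennreal (energy K W + real K ^ 3 - 2 * ?S)" .
  have "ennreal (2 * ?S) \<le> ennreal (energy K W + real K ^ 3)"
    using * by (rule order.trans[rotated]) simp
  then show "2 * ?S \<le> energy K W + real K ^ 3" by (subst (asm) ennreal_le_iff) simp_all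
qed

locale redundancy_system =
  fixes K d :: nat and lam \<mu> :: real
  assumes d_pos: "1 \<le> d" and d_le: "d \<le> K" and lam_pos: "0 < lam" and \<mu>_pos: "0 < \<mu>"
begin

abbreviation U :: "(nat \<Rightarrow> real) measure" where "U \<equiv> choice_law K"

definition total_rate :: "config \<Rightarrow> real" where
  "total_rate C = lam + real (card (busy_jobs C)) * \<mu>"

definition ntypes :: real where "ntypes = real (card (job_types K d))"

text \<open>
The jump chain: the next event is an arrival, with a uniform type, with probability
\<open>lam / total_rate C\<close>, and the departure of each job in service with probability
\<open>\<mu> / total_rate C\<close>; thereafter the idle servers choose.
\<close>

definition T :: "(config \<Rightarrow> ennreal) \<Rightarrow> config \<Rightarrow> ennreal" where
  "T f C =
     ennreal (lam / total_rate C) * (ennreal (1 / ntypes) *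
       (\<Sum>c\<in>job_types K d. \<integral>\<^sup>+u. f (config_start u (C @ [(c, {})])) \<partial>U)) +
     ennreal (\<mu> / total_rate C) *
       (\<Sum>j\<in>busy_jobs C. \<integral>\<^sup>+u. f (config_start u (drop_nth j C)) \<partial>U)"

lemma K_pos: "0 < K" using d_pos d_le by simp

lemma ntypes_pos: "0 < ntypes"
proof -
  have "card (job_types K d) = K choose d"
    unfolding job_types_def by (subst n_subsets) auto
  then show ?thesis using d_le by (simp add: ntypes_def zero_less_binomial)
qed

lemma total_rate_pos: "0 < total_rate C"
  using lam_pos \<mu>_pos by (simp add: total_rate_def add_pos_nonneg)

lemma total_rate_ge: "lam \<le> total_rate C"
  using \<mu>_pos by (simp add: total_rate_def)

definition max_rate :: real where "max_rate = lam + real K * \<mu>"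

lemma total_rate_le: "valid K d C \<Longrightarrow> total_rate C \<le> max_rate"
  using card_busy_jobs_le[of K d C] \<mu>_pos by (simp add: total_rate_def max_rate_def valid_def)

lemma integrand_measurable:
  fixes f :: "config \<Rightarrow> ennreal"
  assumes "consistent K d C"
  shows "(\<lambda>u. f (config_start u C)) \<in> borel_measurable (U)"
  by (subst measurable_cong_sets[OF sets_choice_law refl])
    (rule measurable_compose[OF measurable_config_start[OF assms]], simp)

lemma valid_successors:
  assumes "valid K d C"
  shows "c \<in> job_types K d \<Longrightarrow> consistent K d (C @ [(c, {})])"
    and "j \<in> busy_jobs C \<Longrightarrow> consistent K d (drop_nth j C)"
  using assms by (auto simp: valid_def busy_jobs_def intro: consistent_arrival consistent_drop_nth)

lemma AE_valid_config_start: "consistent K d C \<Longrightarrow> AE u in U. valid K d (config_start u C)"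
  using AE_choices_ok[of K] by eventually_elim (rule valid_config_start)

lemma choice_integral_one [simp]: "(\<integral>\<^sup>+u. 1 \<partial>U) = 1"
  using prob_space.emeasure_space_1[OF prob_space_choice_law[of K]] by simp

lemma rates_add: "ennreal (lam / total_rate C) + ennreal (\<mu> / total_rate C) * of_nat (card (busy_jobs C)) = 1"
proof -
  have "ennreal (lam / total_rate C) + ennreal (\<mu> / total_rate C) * ennreal (real (card (busy_jobs C)))
     = ennreal (lam / total_rate C + \<mu> / total_rate C * real (card (busy_jobs C)))"
  proof -
    have "ennreal (\<mu> / total_rate C) * ennreal (real (card (busy_jobs C))) = ennreal (\<mu> / total_rate C * real (card (busy_jobs C)))"
      using \<mu>_pos total_rate_pos[of C] by (intro ennreal_mult[symmetric]) auto
    then show ?thesis using lam_pos \<mu>_pos total_rate_pos[of C]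
      by (simp only:, intro ennreal_plus[symmetric]) auto
  qed
  also have "lam / total_rate C + \<mu> / total_rate C * real (card (busy_jobs C)) = 1"
    using total_rate_pos[of C] by (simp add: add_divide_distrib[symmetric] total_rate_def mult.commute)
  finally show ?thesis by (simp add: ennreal_of_nat_eq_real_of_nat)
qed

lemma ntypes_cancel: "ennreal (1 / ntypes) * of_nat (card (job_types K d)) = 1"
  using ntypes_pos by (simp add: ennreal_of_nat_eq_real_of_nat ntypes_def[symmetric] ennreal_mult[symmetric])

sublocale markov_operator "{C. valid K d C}" T
proof
  fix f g :: "config \<Rightarrow> ennreal" and C a assume "C \<in> {C. valid K d C}"
  then have C: "valid K d C" by simp
  note m = integrand_measurable[OF valid_successors(1)[OF C]] integrand_measurable[OF valid_successors(2)[OF C]]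
  show "T (\<lambda>y. f y + g y) C = T f C + T g C"
    unfolding T_def by (simp add: nn_integral_add m sum.distrib distrib_left add_ac cong: sum.cong)
  show "T (\<lambda>y. a * f y) C = a * T f C"
    unfolding T_def by (simp add: nn_integral_cmult m sum_distrib_left distrib_left mult_ac cong: sum.cong)
  show "T (\<lambda>_. 1) C = 1"
    unfolding T_def choice_integral_one by (simp add: ntypes_cancel rates_add)
  show "T f C \<le> T g C" if "\<And>y. y \<in> {C. valid K d C} \<Longrightarrow> f y \<le> g y"
  proof -
    have "(\<integral>\<^sup>+u. f (config_start u D) \<partial>U) \<le> (\<integral>\<^sup>+u. g (config_start u D) \<partial>U)" if "consistent K d D" for D
      using AE_valid_config_start[OF that] by (intro nn_integral_mono_AE, eventually_elim) (simp add: \<open>\<And>y. y \<in> {C. valid K d C} \<Longrightarrow> f y \<le> g y\<close>)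
    then show ?thesis unfolding T_def
      by (intro add_mono mult_left_mono sum_mono) (auto intro: valid_successors[OF C])
  qed
qed

text \<open>
The servers of a waiting job are all busy, each with exactly one job, so the sets \<open>c \<inter> snd (C ! j)\<close>
partition its type \<open>c\<close> as \<open>j\<close> ranges over the jobs in service. Since
\<open>x / (1 + x)\<close> is subadditive, the parts together are at least as good as the whole type, to which
\<open>weight_fraction_ge\<close> applies.
\<close>

lemma sum_departure_gain_ge:
  assumes C: "valid K d C"
  defines "W \<equiv> waiting_types C"
  defines "X \<equiv> \<lambda>j c. inv_load K W (c \<inter> snd (C ! j))"
  shows "(real d)\<^sup>2 * real (card (waiting_jobs C)) - ((real d)\<^sup>2 + real K * real d) * real K
    \<le> (\<Sum>j\<in>busy_jobs C. \<Sum>i\<in>waiting_jobs C. real (weight W (fst (C ! i))) * (X j (fst (C ! i)) / (1 + X j (fst (C ! i)))))"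
proof -
  have con: "consistent K d C" using C by (simp add: valid_def)
  let ?c = "\<lambda>i. fst (C ! i)"
  let ?X = "\<lambda>c. inv_load K W c"
  let ?w = "\<lambda>i. real (weight W (?c i))"
  have X0: "0 \<le> X j c" for j c unfolding X_def by (rule inv_load_nonneg)
  have i: "(real d)\<^sup>2 - ((real d)\<^sup>2 + real K * real d) * ?X (?c i)
      \<le> (\<Sum>j\<in>busy_jobs C. ?w i * (X j (?c i) / (1 + X j (?c i))))" if "i \<in> waiting_jobs C" for i
  proof -
    have il: "i < length C" using that by (simp add: waiting_jobs_def)
    have fin: "finite (?c i)" by (rule consistent_nthD(4)[OF con il])
    have cover: "?c i = (\<Union>j\<in>busy_jobs C. ?c i \<inter> snd (C ! j))"
    proof (intro equalityI subsetI)
      fix s assume s: "s \<in> ?c i"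
      then have "\<not> config_idle C s" using C il by (auto simp: valid_def work_conserving_def)
      then obtain j where "j < length C" "s \<in> snd (C ! j)" by (auto simp: config_idle_iff)
      with s show "s \<in> (\<Union>j\<in>busy_jobs C. ?c i \<inter> snd (C ! j))" by (auto simp: busy_jobs_def)
    qed auto
    have sumX: "(\<Sum>j\<in>busy_jobs C. X j (?c i)) = ?X (?c i)"
    proof -
      have "?X (?c i) = ?X (\<Union>j\<in>busy_jobs C. ?c i \<inter> snd (C ! j))" using cover by simp
      also have "\<dots> = (\<Sum>j\<in>busy_jobs C. ?X (?c i \<inter> snd (C ! j)))"
        unfolding inv_load_def
        using fin consistent_unique[OF con] by (intro sum.UNION_disjoint) (auto simp: busy_jobs_def)
      finally show ?thesis by (simp add: X_def)
    qed
    have le: "X j (?c i) \<le> ?X (?c i)" if "j \<in> busy_jobs C" for j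
      unfolding sumX[symmetric] using that X0 by (intro member_le_sum) auto
    have "(real d)\<^sup>2 - ((real d)\<^sup>2 + real K * real d) * ?X (?c i) \<le> ?w i * (?X (?c i) / (1 + ?X (?c i)))"
      by (rule weight_fraction_ge[OF K_pos consistent_nthD(5)[OF con il]])
    also have "?X (?c i) / (1 + ?X (?c i)) = (\<Sum>j\<in>busy_jobs C. X j (?c i) / (1 + ?X (?c i)))"
      by (simp add: sum_divide_distrib[symmetric] sumX)
    also have "?w i * \<dots> \<le> ?w i * (\<Sum>j\<in>busy_jobs C. X j (?c i) / (1 + X j (?c i)))"
      using X0 le by (intro mult_left_mono sum_mono divide_left_mono) (auto intro!: mult_pos_pos add_pos_nonneg inv_load_nonneg)
    finally show ?thesis by (simp add: sum_distrib_left)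
  qed
  have "(real d)\<^sup>2 * real (card (waiting_jobs C)) - ((real d)\<^sup>2 + real K * real d) * real K
     \<le> (\<Sum>i\<in>waiting_jobs C. (real d)\<^sup>2 - ((real d)\<^sup>2 + real K * real d) * ?X (?c i))"
  proof -
    have "(\<Sum>i\<in>waiting_jobs C. (real d)\<^sup>2 - ((real d)\<^sup>2 + real K * real d) * ?X (?c i))
      = (real d)\<^sup>2 * real (card (waiting_jobs C)) - ((real d)\<^sup>2 + real K * real d) * (\<Sum>i\<in>waiting_jobs C. ?X (?c i))"
      unfolding sum_subtractf sum_distrib_left by simp
    moreover have "((real d)\<^sup>2 + real K * real d) * (\<Sum>i\<in>waiting_jobs C. ?X (?c i))
      \<le> ((real d)\<^sup>2 + real K * real d) * real K"
      unfolding W_def by (rule mult_left_mono[OF sum_inv_load_le[OF con]]) simp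
    ultimately show ?thesis by linarith
  qed
  also have "\<dots> \<le> (\<Sum>i\<in>waiting_jobs C. \<Sum>j\<in>busy_jobs C. ?w i * (X j (?c i) / (1 + X j (?c i))))"
    by (rule sum_mono[OF i])
  also have "\<dots> = (\<Sum>j\<in>busy_jobs C. \<Sum>i\<in>waiting_jobs C. ?w i * (X j (?c i) / (1 + X j (?c i))))"
    by (rule sum.swap)
  finally show ?thesis .
qed

lemma T_le_ennreal:
  assumes a: "\<And>c. c \<in> job_types K d \<Longrightarrow> (\<integral>\<^sup>+u. f (config_start u (C @ [(c, {})])) \<partial>U) \<le> ennreal (a c) \<and> 0 \<le> a c"
    and b: "\<And>j. j \<in> busy_jobs C \<Longrightarrow> (\<integral>\<^sup>+u. f (config_start u (drop_nth j C)) \<partial>U) \<le> ennreal (b j) \<and> 0 \<le> b j"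
  shows "T f C \<le> ennreal (lam / total_rate C * (1 / ntypes * (\<Sum>c\<in>job_types K d. a c))
      + \<mu> / total_rate C * (\<Sum>j\<in>busy_jobs C. b j))"
proof -
  have q: "0 < total_rate C" by (rule total_rate_pos)
  have "T f C \<le> ennreal (lam / total_rate C) * (ennreal (1 / ntypes) * (\<Sum>c\<in>job_types K d. ennreal (a c)))
     + ennreal (\<mu> / total_rate C) * (\<Sum>j\<in>busy_jobs C. ennreal (b j))"
    unfolding T_def by (intro add_mono mult_left_mono sum_mono) (use a b in auto)
  also have "\<dots> = ennreal (lam / total_rate C * (1 / ntypes * (\<Sum>c\<in>job_types K d. a c))
      + \<mu> / total_rate C * (\<Sum>j\<in>busy_jobs C. b j))"
    using lam_pos \<mu>_pos q ntypes_pos a b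
    by (simp add: sum_ennreal sum_nonneg ennreal_mult' ennreal_plus[symmetric] ennreal_mult[symmetric] del: ennreal_plus)
  finally show ?thesis .
qed

definition potential :: "config \<Rightarrow> ennreal" where
  "potential C = ennreal (energy K (waiting_types C))"

text \<open>
The one-step drift. The energy itself cancels because the event probabilities add up to one; the terms linear in
\<open>n\<close> combine to \<open>- 2 * d ^ 2 * (\<mu> - lam / K) * n\<close>.
\<close>

lemma potential_step:
  assumes C: "valid K d C"
  defines "n \<equiv> real (card (waiting_jobs C))"
  shows "T potential C \<le> ennreal (energy K (waiting_types C) +
     (lam * real d + real K ^ 4 * \<mu> + 2 * \<mu> * ((real d)\<^sup>2 + real K * real d) * real K
       - 2 * (real d)\<^sup>2 * (\<mu> - lam / real K) * n) / total_rate C)"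
proof -
  have con: "consistent K d C" using C by (simp add: valid_def)
  let ?E = "real (energy K (waiting_types C))" and ?w = "\<lambda>c. real (weight (waiting_types C) c)"
  let ?q = "total_rate C" and ?m = "real (card (busy_jobs C))"
  define S where "S j = (\<Sum>i\<in>waiting_jobs C. real (weight (waiting_types C) (fst (C ! i))) *
     (inv_load K (waiting_types C) (fst (C ! i) \<inter> snd (C ! j)) / (1 + inv_load K (waiting_types C) (fst (C ! i) \<inter> snd (C ! j)))))" for j
  have dep: "(\<integral>\<^sup>+u. potential (config_start u (drop_nth j C)) \<partial>U) \<le> ennreal (?E + real K ^ 3 - 2 * S j)"
    and dep0: "0 \<le> ?E + real K ^ 3 - 2 * S j" if "j \<in> busy_jobs C" for j
    using departure_energy[OF con that K_pos] by (simp_all add: potential_def S_def)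
  have arr: "(\<integral>\<^sup>+u. potential (config_start u (C @ [(c, {})])) \<partial>U) \<le> ennreal (?E + 2 * ?w c + real d)"
    if "c \<in> job_types K d" for c
  proof -
    have "(\<integral>\<^sup>+u. potential (config_start u (C @ [(c, {})])) \<partial>U) \<le> (\<integral>\<^sup>+u. ennreal (?E + 2 * ?w c + real d) * 1 \<partial>U)"
    proof (rule nn_integral_mono)
      fix u
      have "energy K (waiting_types (config_start u (C @ [(c, {})]))) \<le> energy K (waiting_types C) + 2 * weight (waiting_types C) c + d"
        using energy_arrival[of c K u C] job_typesD[OF that] by simp
      then have "real (energy K (waiting_types (config_start u (C @ [(c, {})])))) \<le> ?E + 2 * ?w c + real d" by linarith
      then show "potential (config_start u (C @ [(c, {})])) \<le> ennreal (?E + 2 * ?w c + real d) * 1"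
        unfolding potential_def mult_1_right by (rule ennreal_leI)
    qed
    also have "\<dots> = ennreal (?E + 2 * ?w c + real d)"
      by (subst nn_integral_cmult) (simp, simp only: choice_integral_one mult_1_right)
    finally show ?thesis .
  qed
  have mK: "?m \<le> real K" using card_busy_jobs_le[OF con] by simp
  have q: "0 < ?q" by (rule total_rate_pos)
  have "T potential C \<le> ennreal (lam / ?q * (1 / ntypes * (\<Sum>c\<in>job_types K d. ?E + 2 * ?w c + real d))
      + \<mu> / ?q * (\<Sum>j\<in>busy_jobs C. ?E + real K ^ 3 - 2 * S j))"
    using arr dep dep0 by (intro T_le_ennreal) auto
  also have "\<dots> \<le> ennreal (?E + (lam * real d + real K ^ 4 * \<mu> + 2 * \<mu> * ((real d)\<^sup>2 + real K * real d) * real K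
       - 2 * (real d)\<^sup>2 * (\<mu> - lam / real K) * n) / ?q)"
  proof (rule ennreal_leI)
    have "(\<Sum>c\<in>job_types K d. ?E + 2 * ?w c + real d) = ntypes * ?E + 2 * (\<Sum>c\<in>job_types K d. ?w c) + ntypes * real d"
      by (simp add: sum.distrib sum_distrib_left ntypes_def)
    also have "(\<Sum>c\<in>job_types K d. ?w c) = (real d)\<^sup>2 * ntypes * n / real K"
      using sum_weight_types[OF d_pos d_le con] K_pos by (simp add: ntypes_def n_def field_simps)
    finally have A: "1 / ntypes * (\<Sum>c\<in>job_types K d. ?E + 2 * ?w c + real d) = ?E + 2 * (real d)\<^sup>2 * n / real K + real d"
      using ntypes_pos by (simp add: field_simps)
    have "(\<Sum>j\<in>busy_jobs C. ?E + real K ^ 3 - 2 * S j) = ?m * ?E + ?m * real K ^ 3 - 2 * (\<Sum>j\<in>busy_jobs C. S j)"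
      by (simp add: sum.distrib sum_subtractf sum_distrib_left distrib_left)
    also have "\<dots> \<le> ?m * ?E + real K * real K ^ 3 - 2 * ((real d)\<^sup>2 * n - ((real d)\<^sup>2 + real K * real d) * real K)"
      using sum_departure_gain_ge[OF C] mult_right_mono[OF mK, of "real K ^ 3"] unfolding S_def n_def by simp
    finally have B: "\<mu> * (\<Sum>j\<in>busy_jobs C. ?E + real K ^ 3 - 2 * S j)
       \<le> \<mu> * (?m * ?E + real K * real K ^ 3 - 2 * ((real d)\<^sup>2 * n - ((real d)\<^sup>2 + real K * real d) * real K))"
      using \<mu>_pos by (intro mult_left_mono) auto
    have "lam * (?E + 2 * (real d)\<^sup>2 * n / real K + real d)
       + \<mu> * (?m * ?E + real K * real K ^ 3 - 2 * ((real d)\<^sup>2 * n - ((real d)\<^sup>2 + real K * real d) * real K))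
      = ?q * ?E + (lam * real d + real K ^ 4 * \<mu> + 2 * \<mu> * ((real d)\<^sup>2 + real K * real d) * real K
       - 2 * (real d)\<^sup>2 * (\<mu> - lam / real K) * n)"
      by (simp add: total_rate_def algebra_simps power4_eq_xxxx power3_eq_cube)
    with B have "lam * (?E + 2 * (real d)\<^sup>2 * n / real K + real d) + \<mu> * (\<Sum>j\<in>busy_jobs C. ?E + real K ^ 3 - 2 * S j)
      \<le> ?q * ?E + (lam * real d + real K ^ 4 * \<mu> + 2 * \<mu> * ((real d)\<^sup>2 + real K * real d) * real K
       - 2 * (real d)\<^sup>2 * (\<mu> - lam / real K) * n)" by linarith
    then have "(lam * (?E + 2 * (real d)\<^sup>2 * n / real K + real d) + \<mu> * (\<Sum>j\<in>busy_jobs C. ?E + real K ^ 3 - 2 * S j)) / ?q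
      \<le> (?q * ?E + (lam * real d + real K ^ 4 * \<mu> + 2 * \<mu> * ((real d)\<^sup>2 + real K * real d) * real K
       - 2 * (real d)\<^sup>2 * (\<mu> - lam / real K) * n)) / ?q" using q by (intro divide_right_mono) auto
    then show "lam / ?q * (1 / ntypes * (\<Sum>c\<in>job_types K d. ?E + 2 * ?w c + real d))
      + \<mu> / ?q * (\<Sum>j\<in>busy_jobs C. ?E + real K ^ 3 - 2 * S j)
      \<le> ?E + (lam * real d + real K ^ 4 * \<mu> + 2 * \<mu> * ((real d)\<^sup>2 + real K * real d) * real K
       - 2 * (real d)\<^sup>2 * (\<mu> - lam / real K) * n) / ?q"
      unfolding A using q by (simp add: add_divide_distrib)
  qed
  finally show ?thesis .
qed

lemma energy_ge_waiting:
  assumes "consistent K d C"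
  shows "card (waiting_jobs C) \<le> energy K (waiting_types C)"
proof -
  have "card (waiting_jobs C) \<le> d * card (waiting_jobs C)" using d_pos by simp
  also have "\<dots> = (\<Sum>s\<in>{1..K}. backlog (waiting_types C) s)" by (rule sum_weight[OF assms, symmetric])
  also have "\<dots> \<le> energy K (waiting_types C)"
    unfolding energy_def by (intro sum_mono) (simp add: power2_eq_square)
  finally show ?thesis .
qed

lemma potential_drift:
  assumes stable: "lam < \<mu> * real K"
  obtains n b where "b < \<infinity>"
    "\<And>C. valid K d C \<Longrightarrow> T potential C + 1 \<le> potential C + b * indicator {C. card (waiting_jobs C) < n} C"
proof -
  define \<gamma> where "\<gamma> = 2 * (real d)\<^sup>2 * (\<mu> - lam / real K)"
  define \<kappa> where "\<kappa> = lam * real d + real K ^ 4 * \<mu> + 2 * \<mu> * ((real d)\<^sup>2 + real K * real d) * real K"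
  have \<gamma>: "0 < \<gamma>" using stable K_pos d_pos by (simp add: \<gamma>_def field_simps)
  have \<kappa>: "0 \<le> \<kappa>" using lam_pos \<mu>_pos by (simp add: \<kappa>_def)
  \<comment> \<open>With this many waiting jobs the numerator of the drift is at most minus the largest total rate,
    so the drift per event is at most \<open>- 1\<close>.\<close>
  obtain n :: nat where n: "(\<kappa> + max_rate) / \<gamma> < real n" using reals_Archimedean2 by blast
  have step: "T potential C \<le> ennreal (energy K (waiting_types C) + (\<kappa> - \<gamma> * card (waiting_jobs C)) / total_rate C)"
    if "valid K d C" for C
    using potential_step[OF that] by (simp add: \<gamma>_def \<kappa>_def)
  show thesis
  proof (rule that)
    show "ennreal (\<kappa> / lam + 1) < \<infinity>" by simp
    fix C assume C: "valid K d C"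
    let ?E = "real (energy K (waiting_types C))" and ?n = "real (card (waiting_jobs C))"
    have q: "0 < total_rate C" by (rule total_rate_pos)
    show "T potential C + 1 \<le> potential C + ennreal (\<kappa> / lam + 1) * indicator {C. card (waiting_jobs C) < n} C"
    proof (cases "card (waiting_jobs C) < n")
      case True
      have "(\<kappa> - \<gamma> * ?n) / total_rate C \<le> \<kappa> / total_rate C"
        using \<gamma> q by (intro divide_right_mono) auto
      also have "\<dots> \<le> \<kappa> / lam" using \<kappa> lam_pos total_rate_ge[of C] by (intro divide_left_mono) (auto intro: mult_pos_pos q)
      finally have "T potential C \<le> ennreal (?E + \<kappa> / lam)"
        using step[OF C] by (meson add_left_mono ennreal_leI order.trans)
      then have "T potential C + 1 \<le> ennreal (?E + \<kappa> / lam) + ennreal 1" by (simp add: add_right_mono)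
      also have "\<dots> = potential C + ennreal (\<kappa> / lam + 1)"
        using \<kappa> lam_pos by (simp add: potential_def ennreal_plus add.assoc)
      finally show ?thesis using True by simp
    next
      case False
      then have "(\<kappa> + max_rate) / \<gamma> < ?n" using n by linarith
      then have "\<kappa> + max_rate < \<gamma> * ?n" using \<gamma> by (simp add: pos_divide_less_eq mult.commute)
      then have "\<kappa> - \<gamma> * ?n \<le> - total_rate C" using total_rate_le[OF C] by linarith
      then have "(\<kappa> - \<gamma> * ?n) / total_rate C \<le> -1" using q by (simp add: pos_divide_le_eq)
      then have T: "T potential C \<le> ennreal (?E - 1)"
        using step[OF C] by (smt (verit) ennreal_leI order.trans)
      have "0 < (\<kappa> + max_rate) / \<gamma>" using \<gamma> \<kappa> lam_pos \<mu>_pos by (simp add: max_rate_def add_nonneg_pos add_pos_nonneg)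
      then have "1 \<le> card (waiting_jobs C)" using n False by linarith
      then have "1 \<le> ?E" using energy_ge_waiting[of C] C by (simp add: valid_def)
      then have "ennreal (?E - 1) + ennreal 1 = potential C"
        unfolding potential_def by (subst ennreal_plus[symmetric]) auto
      then have "T potential C + 1 \<le> potential C" using T by (metis add_right_mono ennreal_1)
      then show ?thesis using False by simp
    qed
  qed
qed

end

section \<open>Reaching a prescribed vector of numbers of jobs\<close>

context redundancy_system
begin

definition has_counts :: "(nat set \<Rightarrow> nat) \<Rightarrow> config set" where
  "has_counts v = {C. \<forall>c. count_list (map fst C) c = v c}"

text \<open>
A uniform lower bound for the probability of a prescribed departure and of the arrival of a prescribed type.
\<close>

definition likely_rate :: real where
  "likely_rate = min (\<mu> / max_rate) (lam / (max_rate * ntypes))"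

lemma max_rate_pos: "0 < max_rate"
  using lam_pos \<mu>_pos by (simp add: max_rate_def add_pos_nonneg)

lemma likely_rate_pos: "0 < likely_rate"
  using lam_pos \<mu>_pos max_rate_pos ntypes_pos by (simp add: likely_rate_def)

lemma likely_rate_le_1: "likely_rate \<le> 1"
proof -
  have "1 * \<mu> \<le> real K * \<mu>" using K_pos \<mu>_pos by (intro mult_right_mono) auto
  then have "\<mu> \<le> max_rate" using lam_pos by (simp add: max_rate_def)
  then have "\<mu> / max_rate \<le> 1" using max_rate_pos by simp
  then show ?thesis by (simp add: likely_rate_def)
qed

text \<open>
From \<open>C\<close>, the vector \<open>v\<close> is hit within \<open>m\<close> events with probability at
least \<open>likely_rate ^ m\<close>. The bound is put as an upper bound on survival because survival is an integral
in the extended nonnegative reals.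
\<close>

definition reaches :: "(nat set \<Rightarrow> nat) \<Rightarrow> nat \<Rightarrow> config \<Rightarrow> bool" where
  "reaches v m C \<longleftrightarrow> survival (has_counts v) m C \<le> ennreal (1 - likely_rate ^ m)"

lemma reaches_mono:
  assumes "valid K d C" "reaches v m C" "m \<le> n"
  shows "reaches v n C"
proof -
  have "survival (has_counts v) n C \<le> survival (has_counts v) m C"
    by (rule survival_antimono) (use assms in auto)
  also have "\<dots> \<le> ennreal (1 - likely_rate ^ m)" using assms by (simp add: reaches_def)
  also have "\<dots> \<le> ennreal (1 - likely_rate ^ n)"
    using power_decreasing[OF assms(3), of likely_rate] likely_rate_pos likely_rate_le_1
    by (intro ennreal_leI) auto
  finally show ?thesis by (simp add: reaches_def)
qed

lemma rate_eq_1: "lam / total_rate C + \<mu> / total_rate C * real (card (busy_jobs C)) = 1"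
  using total_rate_pos[of C] by (simp add: add_divide_distrib[symmetric] total_rate_def mult.commute)

lemma expected_after_choice_le:
  assumes C: "consistent K d C"
    and f: "\<And>u. choices_ok K u \<Longrightarrow> f (config_start u C) \<le> ennreal a"
  shows "(\<integral>\<^sup>+u. f (config_start u C) \<partial>U) \<le> ennreal a"
proof -
  have "(\<integral>\<^sup>+u. f (config_start u C) \<partial>U) \<le> (\<integral>\<^sup>+u. ennreal a * 1 \<partial>U)"
    using AE_choices_ok[of K] by (intro nn_integral_mono_AE, eventually_elim) (use f in auto)
  also have "\<dots> = ennreal a"
    by (subst nn_integral_cmult) (simp, simp only: choice_integral_one mult_1_right)
  finally show ?thesis .
qed

lemma reaches_step_aux:
  fixes v :: "nat set \<Rightarrow> nat" and m :: nat
  assumes C: "valid K d C" and p: "p = likely_rate ^ m"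
  defines "f \<equiv> \<lambda>C'. if C' \<in> has_counts v then 0 else survival (has_counts v) m C'"
  shows "\<lbrakk>consistent K d D; \<And>u. choices_ok K u \<Longrightarrow> config_start u D \<in> has_counts v \<or> reaches v m (config_start u D)\<rbrakk>
      \<Longrightarrow> (\<integral>\<^sup>+u. f (config_start u D) \<partial>U) \<le> ennreal (1 - p)"
    and "consistent K d D \<Longrightarrow> (\<integral>\<^sup>+u. f (config_start u D) \<partial>U) \<le> ennreal 1"
    and "survival (has_counts v) (Suc m) C = T f C"
proof -
  assume D: "consistent K d D" and r: "\<And>u. choices_ok K u \<Longrightarrow> config_start u D \<in> has_counts v \<or> reaches v m (config_start u D)"
  show "(\<integral>\<^sup>+u. f (config_start u D) \<partial>U) \<le> ennreal (1 - p)"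
  proof (rule expected_after_choice_le[OF D])
    fix u assume "choices_ok K u"
    then show "f (config_start u D) \<le> ennreal (1 - p)" using r[of u] by (auto simp: f_def reaches_def p)
  qed
next
  assume D: "consistent K d D"
  show "(\<integral>\<^sup>+u. f (config_start u D) \<partial>U) \<le> ennreal 1"
  proof (rule expected_after_choice_le[OF D])
    fix u assume "choices_ok K u"
    then show "f (config_start u D) \<le> ennreal 1"
      using survival_le_1[of "config_start u D" "has_counts v" m] valid_config_start[OF D] by (auto simp: f_def)
  qed
next
  show "survival (has_counts v) (Suc m) C = T f C"
    by (simp add: survival_Suc taboo_def f_def)
qed

lemma reaches_departure:
  assumes C: "valid K d C" and j: "j \<in> busy_jobs C"
    and r: "\<And>u. choices_ok K u \<Longrightarrow>
      config_start u (drop_nth j C) \<in> has_counts v \<or> reaches v m (config_start u (drop_nth j C))"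
  shows "reaches v (Suc m) C"
proof -
  define p where "p = likely_rate ^ m"
  have p: "0 \<le> p" "p \<le> 1" using likely_rate_pos likely_rate_le_1 by (auto simp: p_def power_le_one)
  let ?f = "\<lambda>C'. if C' \<in> has_counts v then 0 else survival (has_counts v) m C'"
  let ?q = "total_rate C" and ?n = "real (card (busy_jobs C))"
  have "T ?f C \<le> ennreal (lam / ?q * (1 / ntypes * (\<Sum>c\<in>job_types K d. 1))
      + \<mu> / ?q * (\<Sum>i\<in>busy_jobs C. if i = j then 1 - p else 1))"
    using reaches_step_aux(1)[OF C p_def, of "drop_nth j C" v] reaches_step_aux(2)[OF C p_def, of _ v]
       r j p valid_successors[OF C]
    by (intro T_le_ennreal) auto
  also have "\<dots> \<le> ennreal (1 - likely_rate ^ Suc m)"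
  proof (rule ennreal_leI)
    have "(\<Sum>i\<in>busy_jobs C. if i = j then 1 - p else 1) = (\<Sum>i\<in>busy_jobs C. 1 - (if i = j then p else 0))"
      by (rule sum.cong) auto
    also have "\<dots> = ?n - p" using j by (simp add: sum_subtractf)
    finally have "lam / ?q * (1 / ntypes * (\<Sum>c\<in>job_types K d. 1)) + \<mu> / ?q * (\<Sum>i\<in>busy_jobs C. if i = j then 1 - p else 1)
      = 1 - \<mu> / ?q * p"
      using ntypes_pos rate_eq_1[of C] by (simp add: ntypes_def[symmetric] right_diff_distrib)
    moreover have "likely_rate * p \<le> \<mu> / ?q * p"
    proof (rule mult_right_mono)
      have "likely_rate \<le> \<mu> / max_rate" by (simp add: likely_rate_def)
      also have "\<dots> \<le> \<mu> / ?q" using \<mu>_pos total_rate_le[OF C] total_rate_pos[of C] max_rate_pos by (intro divide_left_mono) auto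
      finally show "likely_rate \<le> \<mu> / ?q" .
    qed (rule p)
    ultimately show "lam / ?q * (1 / ntypes * (\<Sum>c\<in>job_types K d. 1)) + \<mu> / ?q * (\<Sum>i\<in>busy_jobs C. if i = j then 1 - p else 1)
      \<le> 1 - likely_rate ^ Suc m" by (simp add: p_def)
  qed
  finally show ?thesis unfolding reaches_def reaches_step_aux(3)[OF C p_def] .
qed

lemma reaches_arrival:
  assumes C: "valid K d C" and c: "c \<in> job_types K d"
    and r: "\<And>u. choices_ok K u \<Longrightarrow>
      config_start u (C @ [(c, {})]) \<in> has_counts v \<or> reaches v m (config_start u (C @ [(c, {})]))"
  shows "reaches v (Suc m) C"
proof -
  define p where "p = likely_rate ^ m"
  have p: "0 \<le> p" "p \<le> 1" using likely_rate_pos likely_rate_le_1 by (auto simp: p_def power_le_one)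
  let ?f = "\<lambda>C'. if C' \<in> has_counts v then 0 else survival (has_counts v) m C'"
  let ?q = "total_rate C" and ?n = "real (card (busy_jobs C))"
  have "T ?f C \<le> ennreal (lam / ?q * (1 / ntypes * (\<Sum>c'\<in>job_types K d. if c' = c then 1 - p else 1))
      + \<mu> / ?q * (\<Sum>i\<in>busy_jobs C. 1))"
    using reaches_step_aux(1)[OF C p_def, of "C @ [(c, {})]" v] reaches_step_aux(2)[OF C p_def, of _ v]
       r c p valid_successors[OF C]
    by (intro T_le_ennreal) auto
  also have "\<dots> \<le> ennreal (1 - likely_rate ^ Suc m)"
  proof (rule ennreal_leI)
    have "(\<Sum>c'\<in>job_types K d. if c' = c then 1 - p else 1) = (\<Sum>c'\<in>job_types K d. 1 - (if c' = c then p else 0))"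
      by (rule sum.cong) auto
    also have "\<dots> = ntypes - p" using c by (simp add: sum_subtractf ntypes_def)
    finally have "1 / ntypes * (\<Sum>c'\<in>job_types K d. if c' = c then 1 - p else 1) = 1 - p / ntypes"
      using ntypes_pos by (simp add: diff_divide_distrib)
    then have "lam / ?q * (1 / ntypes * (\<Sum>c'\<in>job_types K d. if c' = c then 1 - p else 1)) + \<mu> / ?q * (\<Sum>i\<in>busy_jobs C. 1)
      = 1 - lam / (?q * ntypes) * p"
      using rate_eq_1[of C] by (simp add: right_diff_distrib)
    moreover have "likely_rate * p \<le> lam / (?q * ntypes) * p"
    proof (rule mult_right_mono)
      have "likely_rate \<le> lam / (max_rate * ntypes)" by (simp add: likely_rate_def)
      also have "\<dots> \<le> lam / (?q * ntypes)"
        using lam_pos total_rate_le[OF C] total_rate_pos[of C] max_rate_pos ntypes_pos by (intro divide_left_mono) auto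
      finally show "likely_rate \<le> lam / (?q * ntypes)" .
    qed (rule p)
    ultimately show "lam / ?q * (1 / ntypes * (\<Sum>c'\<in>job_types K d. if c' = c then 1 - p else 1)) + \<mu> / ?q * (\<Sum>i\<in>busy_jobs C. 1)
      \<le> 1 - likely_rate ^ Suc m" by (simp add: p_def)
  qed
  finally show ?thesis unfolding reaches_def reaches_step_aux(3)[OF C p_def] .
qed

lemma valid_after_arrival:
  "\<lbrakk>valid K d C; c \<in> job_types K d; choices_ok K u\<rbrakk> \<Longrightarrow> valid K d (config_start u (C @ [(c, {})]))"
  by (intro valid_config_start valid_successors)

lemma valid_after_departure:
  "\<lbrakk>valid K d C; j \<in> busy_jobs C; choices_ok K u\<rbrakk> \<Longrightarrow> valid K d (config_start u (drop_nth j C))"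
  by (intro valid_config_start valid_successors(2))

lemma counts_outside_types: "valid K d C \<Longrightarrow> c \<notin> job_types K d \<Longrightarrow> count_list (map fst C) c = 0"
  by (auto simp: valid_def consistent_def count_list_0_iff)

lemma positive_summand:
  fixes f :: "'b \<Rightarrow> nat"
  assumes "sum f A = Suc k" shows "\<exists>a\<in>A. 0 < f a"
proof (rule ccontr)
  assume "\<not> (\<exists>a\<in>A. 0 < f a)"
  then have "sum f A = 0" by (intro sum.neutral) auto
  with assms show False by simp
qed

text \<open>
As long as no type is over-represented, the missing jobs can arrive one after the other.
\<close>

lemma reaches_by_arrivals:
  assumes v: "\<And>c. c \<notin> job_types K d \<Longrightarrow> v c = 0"
  shows "\<lbrakk>valid K d C; \<And>c. count_list (map fst C) c \<le> v c;
     (\<Sum>c\<in>job_types K d. v c - count_list (map fst C) c) = k\<rbrakk> \<Longrightarrow> C \<in> has_counts v \<or> 0 < k \<and> reaches v k C"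
proof (induction k arbitrary: C)
  case (0 C)
  have "count_list (map fst C) c = v c" for c
    using 0 v[of c] counts_outside_types[OF 0(1), of c] by (cases "c \<in> job_types K d") (auto simp: le_antisym)
  then show ?case by (simp add: has_counts_def)
next
  case (Suc k C)
  obtain c where c: "c \<in> job_types K d" "0 < v c - count_list (map fst C) c"
    using positive_summand[OF Suc.prems(3)] by blast
  have "reaches v (Suc k) C"
  proof (rule reaches_arrival[OF Suc.prems(1) c(1)])
    fix u assume u: "choices_ok K u"
    let ?C = "config_start u (C @ [(c, {})])"
    have "(\<Sum>a\<in>job_types K d. v a - count_list (map fst C) a) = (v c - count_list (map fst C) c) + (\<Sum>a\<in>job_types K d - {c}. v a - count_list (map fst C) a)"
      using c by (simp add: sum.remove)
    moreover have "(\<Sum>a\<in>job_types K d. v a - count_list (map fst ?C) a) = (v c - count_list (map fst ?C) c) + (\<Sum>a\<in>job_types K d - {c}. v a - count_list (map fst ?C) a)"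
      using c by (simp add: sum.remove)
    moreover have "(\<Sum>a\<in>job_types K d - {c}. v a - count_list (map fst ?C) a) = (\<Sum>a\<in>job_types K d - {c}. v a - count_list (map fst C) a)"
      by (rule sum.cong) auto
    ultimately have "(\<Sum>a\<in>job_types K d. v a - count_list (map fst ?C) a) = k"
      using Suc.prems(3) c(2) by simp
    moreover have "count_list (map fst ?C) a \<le> v a" for a using Suc.prems(2)[of a] c by auto
    ultimately show "?C \<in> has_counts v \<or> reaches v k ?C"
      using Suc.IH[OF valid_after_arrival[OF Suc.prems(1) c(1) u]] by blast
  qed
  then show ?case by simp
qed

lemma busy_job_exists:
  assumes "valid K d C" "C \<noteq> []"
  obtains j where "j \<in> busy_jobs C"
proof -
  have l: "0 < length C" using assms(2) by simp
  have con: "consistent K d C" using assms(1) by (simp add: valid_def)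
  have "card (fst (C ! 0)) \<noteq> 0" using consistent_nthD(5)[OF con l] d_pos by simp
  then obtain s where "s \<in> fst (C ! 0)" by (metis all_not_in_conv card.empty)
  then have "\<not> config_idle C s" using assms(1) l by (auto simp: valid_def work_conserving_def)
  then show ?thesis using that by (auto simp: config_idle_iff busy_jobs_def)
qed

text \<open>
For \<open>v = 0\<close> the empty configuration is already at \<open>v\<close>, but only later hits count. One job is
let in and out again.
\<close>

lemma reaches_from_empty:
  assumes v: "\<And>c. c \<notin> job_types K d \<Longrightarrow> v c = 0"
  shows "reaches v ((\<Sum>c\<in>job_types K d. v c) + 2) []"
proof -
  have val: "valid K d []" by (simp add: valid_def consistent_def work_conserving_def)
  show ?thesis
  proof (cases "\<Sum>c\<in>job_types K d. v c")
    case (Suc k)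
    then obtain c where "v c \<noteq> 0" using positive_summand by fastforce
    then have "[] \<notin> has_counts v" by (auto simp: has_counts_def)
    then have "reaches v (Suc k) []" using reaches_by_arrivals[where v=v and k="Suc k", OF v val] Suc by simp
    then show ?thesis using reaches_mono[OF val] Suc by simp
  next
    case 0
    then have v0: "v c = 0" for c using v by (cases "c \<in> job_types K d") auto
    obtain c where c: "c \<in> job_types K d"
      using ntypes_pos by (fastforce simp: ntypes_def card_gt_0_iff)
    have "reaches v (Suc (Suc 0)) []"
    proof (rule reaches_arrival[OF val c], rule disjI2)
      fix u assume u: "choices_ok K u"
      let ?C = "config_start u ([] @ [(c, {})])"
      have vC: "valid K d ?C" by (rule valid_after_arrival[OF val c u])
      have len: "length ?C = 1" by simp
      then have "?C \<noteq> []" by (metis length_0_conv zero_neq_one)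
      then obtain j where j: "j \<in> busy_jobs ?C" using busy_job_exists[OF vC] by blast
      show "reaches v (Suc 0) ?C"
      proof (rule reaches_departure[OF vC j], rule disjI1)
        fix u'
        have "length (config_start u' (drop_nth j ?C)) = 0" using j len by (simp add: busy_jobs_def)
        then have "config_start u' (drop_nth j ?C) = []" by (rule length_0_conv[THEN iffD1])
        then show "config_start u' (drop_nth j ?C) \<in> has_counts v" by (simp only: has_counts_def) (simp add: v0)
      qed
    qed
    then show ?thesis using 0 by simp
  qed
qed

lemma reaches_always:
  assumes v: "\<And>c. c \<notin> job_types K d \<Longrightarrow> v c = 0"
  shows "valid K d C \<Longrightarrow> reaches v ((\<Sum>c\<in>job_types K d. v c) + 2 + length C) C"
proof (induction "length C" arbitrary: C)
  case 0
  then show ?case using reaches_from_empty[OF v] by simp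
next
  case (Suc n C)
  then have "C \<noteq> []" by auto
  then obtain j where j: "j \<in> busy_jobs C" using busy_job_exists[OF Suc.prems] by blast
  have "reaches v (Suc ((\<Sum>c\<in>job_types K d. v c) + 2 + n)) C"
  proof (rule reaches_departure[OF Suc.prems j], rule disjI2)
    fix u assume u: "choices_ok K u"
    have "n = length (config_start u (drop_nth j C))" using j Suc.hyps(2) by (simp add: busy_jobs_def)
    then show "reaches v ((\<Sum>c\<in>job_types K d. v c) + 2 + n) (config_start u (drop_nth j C))"
      using Suc.hyps(1)[of "config_start u (drop_nth j C)"] valid_after_departure[OF Suc.prems j u] by simp
  qed
  then show ?case by (simp add: Suc.hyps(2)[symmetric])
qed

lemma length_le_waiting:
  assumes "consistent K d C" shows "length C \<le> card (waiting_jobs C) + K"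
proof -
  have "length C = card (waiting_jobs C \<union> busy_jobs C)"
    by (subst card_lessThan[of "length C", symmetric], rule arg_cong[where f=card])
      (auto simp: waiting_jobs_def busy_jobs_def)
  also have "\<dots> \<le> card (waiting_jobs C) + card (busy_jobs C)" by (rule card_Un_le)
  finally show ?thesis using card_busy_jobs_le[OF assms] by simp
qed

text \<open>
Few waiting jobs means few jobs, since at most \<open>K\<close> jobs are in service. Hence the set outside which the
drift is negative is one from which \<open>v\<close> is reached with a uniform probability.
\<close>

theorem finite_expected_hitting:
  assumes stable: "lam < \<mu> * real K" and v: "\<And>c. c \<notin> job_types K d \<Longrightarrow> v c = 0" and C: "valid K d C"
  obtains R where "R < \<infinity>" "\<And>n. (\<Sum>k<n. survival (has_counts v) k C) \<le> R"
proof -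
  obtain n0 b where b: "b < \<infinity>"
    and drift: "\<And>C. valid K d C \<Longrightarrow> T potential C + 1 \<le> potential C + b * indicator {C. card (waiting_jobs C) < n0} C"
    using potential_drift[OF stable] by blast
  define m where "m = (\<Sum>c\<in>job_types K d. v c) + 2 + (n0 + K)"
  define p where "p = likely_rate ^ m"
  have p: "0 < p" "p \<le> 1" using likely_rate_pos likely_rate_le_1 by (auto simp: p_def power_le_one)
  have reach: "survival (has_counts v) m C' + ennreal p \<le> 1"
    if C': "valid K d C'" "card (waiting_jobs C') < n0" for C'
  proof -
    have "length C' \<le> n0 + K" using length_le_waiting[of C'] C' by (simp add: valid_def)
    then have "reaches v m C'" unfolding m_def
      by (intro reaches_mono[OF C'(1) reaches_always[OF v C'(1)]]) auto
    then have "survival (has_counts v) m C' + ennreal p \<le> ennreal (1 - p) + ennreal p"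
      by (intro add_right_mono) (simp add: reaches_def p_def)
    also have "\<dots> = 1" using p by (subst ennreal_plus[symmetric]) auto
    finally show ?thesis .
  qed
  show thesis
  proof (rule that)
    have "of_nat m / ennreal p = ennreal (real m / p)"
      using p by (simp only: ennreal_of_nat_eq_real_of_nat) (rule divide_ennreal, auto)
    then show "potential C + b * (of_nat m / ennreal p) < \<infinity>"
      using b by (simp add: potential_def ennreal_mult_less_top)
    fix n
    have "1 * (\<Sum>k<n. survival (has_counts v) k C) \<le> potential C + b * (of_nat m / ennreal p)"
    proof (rule expected_hitting_time_bound)
      show "T potential C' + 1 \<le> potential C' + b * indicator {C. card (waiting_jobs C) < n0} C'"
        if "C' \<in> {C. valid K d C}" for C' by (rule drift) (use that in simp)
      show "survival (has_counts v) m C' + ennreal p \<le> 1"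
        if "C' \<in> {C. valid K d C}" "C' \<in> {C. card (waiting_jobs C) < n0}" for C'
        by (rule reach) (use that in auto)
    qed (use p C in auto)
    then show "(\<Sum>k<n. survival (has_counts v) k C) \<le> potential C + b * (of_nat m / ennreal p)"
      by simp
  qed
qed

end

section \<open>Running cost up to the hitting time\<close>

definition arrival_first :: "config \<Rightarrow> real \<Rightarrow> (nat \<Rightarrow> real) \<Rightarrow> bool" where
  "arrival_first C t r \<longleftrightarrow> (\<forall>i\<in>busy_jobs C. t < r i)"

definition departure_first :: "config \<Rightarrow> nat \<Rightarrow> real \<Rightarrow> (nat \<Rightarrow> real) \<Rightarrow> bool" where
  "departure_first C j t r \<longleftrightarrow> r j < t \<and> (\<forall>i\<in>busy_jobs C - {j}. r j < r i)"

text \<open>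
At most one of these alternatives holds, and almost surely one of them does. The cost below is infinite otherwise, so
that sample paths with ties need not be analysed.
\<close>

definition no_tie :: "config \<Rightarrow> real \<Rightarrow> (nat \<Rightarrow> real) \<Rightarrow> bool" where
  "no_tie C t r \<longleftrightarrow> arrival_first C t r \<or> (\<exists>j\<in>busy_jobs C. departure_first C j t r)"

text \<open>
The residual requirements after an event, as functions of those before. Clocks of waiting jobs are not running; an
arriving job is appended with requirement \<open>b\<close>.
\<close>

definition arrival_clocks :: "config \<Rightarrow> real \<Rightarrow> (nat \<Rightarrow> real) \<Rightarrow> real \<Rightarrow> nat \<Rightarrow> real" where
  "arrival_clocks C t r b = (run_down {..<length C} (busy_jobs C) t r)(length C := b)"

definition departure_clocks :: "config \<Rightarrow> nat \<Rightarrow> (nat \<Rightarrow> real) \<Rightarrow> nat \<Rightarrow> real" where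
  "departure_clocks C j r =
     (\<lambda>i\<in>{..<length C - 1}. run_down ({..<length C} - {j}) (busy_jobs C) (r j) r (skip j i))"

abbreviation next_arrival :: "innovation \<Rightarrow> real" where "next_arrival s \<equiv> fst s"
abbreviation new_type :: "innovation \<Rightarrow> nat set" where "new_type s \<equiv> fst (snd s)"
abbreviation new_req :: "innovation \<Rightarrow> real" where "new_req s \<equiv> fst (snd (snd s))"
abbreviation choices :: "innovation \<Rightarrow> nat \<Rightarrow> real" where "choices s \<equiv> snd (snd (snd s))"

text \<open>
A quantity computed from a configuration, the time to the next arrival, the residual requirements by position, and
the future innovations.
\<close>

type_synonym functional = "config \<Rightarrow> real \<Rightarrow> (nat \<Rightarrow> real) \<Rightarrow> innovation stream \<Rightarrow> ennreal"

definition after_arrival ::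
    "functional \<Rightarrow> config \<Rightarrow> nat set \<Rightarrow> real \<Rightarrow> (nat \<Rightarrow> real) \<Rightarrow> innovation \<Rightarrow> innovation stream \<Rightarrow> ennreal" where
  "after_arrival g C c t r s z = (if new_type s = c \<and> arrival_first C t r
     then g (config_start (choices s) (C @ [(c, {})])) (next_arrival s) (arrival_clocks C t r (new_req s)) z else 0)"

definition after_departure ::
    "functional \<Rightarrow> config \<Rightarrow> nat \<Rightarrow> real \<Rightarrow> (nat \<Rightarrow> real) \<Rightarrow> innovation \<Rightarrow> innovation stream \<Rightarrow> ennreal" where
  "after_departure g C j t r s z = (if departure_first C j t r
     then g (config_start (choices s) (drop_nth j C)) (t - r j) (departure_clocks C j r) z else 0)"

context redundancy_system
begin

definition good_innovation :: "innovation \<Rightarrow> bool" where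
  "good_innovation s \<longleftrightarrow> 0 < next_arrival s \<and> new_type s \<in> job_types K d \<and>
     0 < new_req s \<and> choices_ok K (choices s)"

text \<open>
The cost of the present event plus \<open>g\<close> evaluated at the state just after it. The time to the next
event is bounded by the time \<open>t\<close> to the next arrival. The additional \<open>1\<close> makes the cost
infinite on paths that never hit, so that finite mean cost includes the statement that hitting is almost sure.
The sums have at most one nonzero term. They run over finite index sets so that each term concerns
configurations of one known length, whose clocks live on one product space.
\<close>

definition one_step :: "functional \<Rightarrow> functional" where
  "one_step g C t r z =
     ennreal (t + 1)
     + (if no_tie C t r then 0 else \<infinity>)
     + (if good_innovation (shd z) then 0 else \<infinity>)
     + (\<Sum>c\<in>job_types K d. after_arrival g C c t r (shd z) (stl z))
     + (\<Sum>j\<in>busy_jobs C. after_departure g C j t r (shd z) (stl z))"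

definition stopped :: "(nat set \<Rightarrow> nat) \<Rightarrow> functional \<Rightarrow> functional" where
  "stopped v g C t r z = (if C \<in> has_counts v then 0 else g C t r z)"

primrec cost :: "(nat set \<Rightarrow> nat) \<Rightarrow> nat \<Rightarrow> functional" where
  "cost v 0 = (\<lambda>_ _ _ _. 0)"
| "cost v (Suc k) = one_step (stopped v (cost v k))"

abbreviation P :: "nat set measure" where "P \<equiv> measure_pmf (pmf_of_set (job_types K d))"
abbreviation Inn :: "innovation measure" where "Inn \<equiv> innovation_law K d lam \<mu>"
abbreviation Z :: "innovation stream measure" where "Z \<equiv> stream_space Inn"

lemma Inn_eq: "Inn = exp_law lam \<Otimes>\<^sub>M P \<Otimes>\<^sub>M exp_law \<mu> \<Otimes>\<^sub>M U"
  by (simp add: innovation_law_def choice_law_def)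

sublocale L: prob_space "exp_law lam" by (rule prob_space_exp_law[OF lam_pos])
sublocale M: prob_space "exp_law \<mu>" by (rule prob_space_exp_law[OF \<mu>_pos])
sublocale U: prob_space U by (rule prob_space_choice_law)
sublocale PM: product_sigma_finite "\<lambda>_::nat. exp_law \<mu>" by (rule product_sigma_finite_exp_law[OF \<mu>_pos])

sublocale Inn: prob_space Inn
proof -
  interpret p1: pair_prob_space "exp_law \<mu>" U ..
  interpret p2: pair_prob_space P "exp_law \<mu> \<Otimes>\<^sub>M U" ..
  interpret p3: pair_prob_space "exp_law lam" "P \<Otimes>\<^sub>M exp_law \<mu> \<Otimes>\<^sub>M U" ..
  show "prob_space Inn" unfolding Inn_eq by (rule p3.prob_space_axioms)
qed

sublocale Z: prob_space Z by (rule Inn.prob_space_stream_space)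

section \<open>Measurability of the cost\<close>

lemma measurable_innovation:
  assumes s: "s \<in> measurable N Inn"
  shows "(\<lambda>w. next_arrival (s w)) \<in> borel_measurable N"
    and "(\<lambda>w. new_type (s w)) \<in> measurable N (count_space UNIV)"
    and "(\<lambda>w. new_req (s w)) \<in> borel_measurable N"
    and "(\<lambda>w. choices (s w)) \<in> measurable N (clocks {1..K})"
proof -
  note s = s[unfolded Inn_eq]
  note 1 = measurable_compose[OF s measurable_snd]
  note 2 = measurable_compose[OF 1 measurable_snd]
  show "(\<lambda>w. next_arrival (s w)) \<in> borel_measurable N"
    using measurable_compose[OF s measurable_fst] by (simp add: measurable_cong_sets[OF refl sets_exp_law])
  show "(\<lambda>w. new_type (s w)) \<in> measurable N (count_space UNIV)"
    using measurable_compose[OF 1 measurable_fst] by (simp add: measurable_cong_sets[OF refl sets_measure_pmf_count_space])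
  show "(\<lambda>w. new_req (s w)) \<in> borel_measurable N"
    using measurable_compose[OF 2 measurable_fst] by (simp add: measurable_cong_sets[OF refl sets_exp_law])
  show "(\<lambda>w. choices (s w)) \<in> measurable N (clocks {1..K})"
    using measurable_compose[OF 2 measurable_snd] by (simp add: measurable_cong_sets[OF refl sets_choice_law])
qed

lemma measurable_new_type_eq:
  assumes "s \<in> measurable N Inn"
  shows "Measurable.pred N (\<lambda>w. new_type (s w) = c)"
  using measurable_compose[OF measurable_innovation(2)[OF assms], of "\<lambda>c'. c' = c" "count_space UNIV"] by simp

lemma measurable_clock:
  assumes "r \<in> measurable N (clocks A)" "i \<in> A"
  shows "(\<lambda>w. r w i) \<in> borel_measurable N"
  using measurable_compose[OF assms(1) measurable_component_singleton[OF assms(2)]] by simp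

lemma measurable_good_innovation:
  assumes s: "s \<in> measurable N Inn"
  shows "Measurable.pred N (\<lambda>w. good_innovation (s w))"
proof -
  note m[measurable] = measurable_innovation[OF s]
  have [measurable]: "Measurable.pred N (\<lambda>w. choices_ok K (choices (s w)))"
    unfolding choices_ok_def
  proof (rule pred_intros_finite)
    fix i assume i: "i \<in> {1..K}"
    note [measurable] = measurable_clock[OF m(4) i]
    show "Measurable.pred N (\<lambda>w. 0 \<le> choices (s w) i \<and> choices (s w) i < 1)" by measurable
  qed simp
  have [measurable]: "Measurable.pred N (\<lambda>w. new_type (s w) \<in> job_types K d)"
    using measurable_compose[OF m(2), of "\<lambda>c. c \<in> job_types K d" "count_space UNIV"] by simp
  show ?thesis unfolding good_innovation_def by measurable
qed

lemma busy_jobs_subset: "busy_jobs C \<subseteq> {..<length C}"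
  by (auto simp: busy_jobs_def)

lemma measurable_arrival_first:
  assumes "t \<in> borel_measurable N" "r \<in> measurable N (clocks {..<length C})"
  shows "Measurable.pred N (\<lambda>w. arrival_first C (t w) (r w))"
  unfolding arrival_first_def
  using busy_jobs_subset by (intro measurable_all_less assms measurable_clock[OF assms(2)]) auto

lemma measurable_departure_first:
  assumes t: "t \<in> borel_measurable N" and r: "r \<in> measurable N (clocks {..<length C})" and j: "j \<in> busy_jobs C"
  shows "Measurable.pred N (\<lambda>w. departure_first C j (t w) (r w))"
proof -
  note [measurable] = t
  have jm[measurable]: "(\<lambda>w. r w j) \<in> borel_measurable N"
    using busy_jobs_subset j by (intro measurable_clock[OF r]) auto
  have [measurable]: "Measurable.pred N (\<lambda>w. \<forall>i\<in>busy_jobs C - {j}. r w j < r w i)"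
    using busy_jobs_subset by (intro measurable_all_less jm measurable_clock[OF r]) auto
  show ?thesis unfolding departure_first_def by measurable
qed

lemma measurable_no_tie:
  assumes t: "t \<in> borel_measurable N" and r: "r \<in> measurable N (clocks {..<length C})"
  shows "Measurable.pred N (\<lambda>w. no_tie C (t w) (r w))"
proof -
  have [measurable]: "Measurable.pred N (\<lambda>w. \<exists>j\<in>busy_jobs C. departure_first C j (t w) (r w))"
    by (rule pred_intros_finite(4)) (auto intro: measurable_departure_first t r)
  note [measurable] = measurable_arrival_first[OF t r]
  show ?thesis unfolding no_tie_def by measurable
qed

lemma measurable_arrival_clocks:
  assumes t: "t \<in> borel_measurable N" and r: "r \<in> measurable N (clocks {..<length C})" and b: "b \<in> borel_measurable N"
  shows "(\<lambda>w. arrival_clocks C (t w) (r w) (b w)) \<in> measurable N (clocks {..<length (C @ [p])})"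
proof -
  have eq: "{..<length (C @ [p])} = insert (length C) {..<length C}" by auto
  show ?thesis unfolding arrival_clocks_def eq
    by (rule measurable_fun_upd[where J="{..<length C}"]) (auto intro!: measurable_run_down t b measurable_clock[OF r])
qed

lemma measurable_departure_clocks:
  assumes r: "r \<in> measurable N (clocks {..<length C})" and j: "j \<in> busy_jobs C"
  shows "(\<lambda>w. departure_clocks C j (r w)) \<in> measurable N (clocks {..<length (drop_nth j C)})"
proof -
  have jl: "j < length C" using j by (simp add: busy_jobs_def)
  have rd: "(\<lambda>w. run_down ({..<length C} - {j}) (busy_jobs C) (r w j) (r w)) \<in> measurable N (clocks ({..<length C} - {j}))"
    using jl by (intro measurable_run_down measurable_clock[OF r]) auto
  have "(\<lambda>w. departure_clocks C j (r w)) \<in> measurable N (clocks {..<length C - 1})"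
    unfolding departure_clocks_def
    using jl skip_neq skip_less by (intro measurable_restrict measurable_clock[OF rd]) auto
  then show ?thesis using jl by simp
qed

text \<open>
The type of configurations is uncountable, since types are arbitrary sets of numbers; measurability in the
configuration needs a countable range.
\<close>

definition configs_of_length :: "nat \<Rightarrow> config set" where
  "configs_of_length n = {C. consistent K d C \<and> length C = n}"

lemma countable_configs_of_length: "countable (configs_of_length n)"
proof -
  have "configs_of_length n \<subseteq> {xs. set xs \<subseteq> Pow {1..K} \<times> Pow {1..K} \<and> length xs = n}"
    by (fastforce simp: configs_of_length_def consistent_def job_types_def)
  then have "finite (configs_of_length n)" by (rule finite_subset) (auto intro: finite_lists_length_eq)
  then show ?thesis by (rule countable_finite)
qed

definition measurable_functional :: "functional \<Rightarrow> bool" where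
  "measurable_functional g \<longleftrightarrow> (\<forall>C. consistent K d C \<longrightarrow>
     (\<lambda>(t, r, z). g C t r z) \<in> borel_measurable (borel \<Otimes>\<^sub>M clocks {..<length C} \<Otimes>\<^sub>M Z))"

lemma measurable_functionalD:
  assumes g: "measurable_functional g" and C: "consistent K d C"
    and t: "t \<in> borel_measurable N" and r: "r \<in> measurable N (clocks {..<length C})" and z: "z \<in> measurable N Z"
  shows "(\<lambda>w. g C (t w) (r w) (z w)) \<in> borel_measurable N"
proof -
  have "(\<lambda>(t, r, z). g C t r z) \<in> borel_measurable (borel \<Otimes>\<^sub>M clocks {..<length C} \<Otimes>\<^sub>M Z)"
    using g C by (simp add: measurable_functional_def)
  from measurable_compose[OF measurable_Pair[OF t measurable_Pair[OF r z]] this] show ?thesis by simp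
qed

lemma measurable_functional_config_start:
  assumes g: "measurable_functional g" and D: "consistent K d D" and u: "u \<in> measurable N (clocks {1..K})"
    and t: "t \<in> borel_measurable N" and r: "r \<in> measurable N (clocks {..<length D})" and z: "z \<in> measurable N Z"
  shows "(\<lambda>w. g (config_start (u w) D) (t w) (r w) (z w)) \<in> borel_measurable N"
proof (rule measurable_compose_countable'[OF _ _ countable_configs_of_length[of "length D"]])
  have "(\<lambda>w. config_start (u w) D) \<in> measurable N (count_space UNIV)"
    by (rule measurable_compose[OF u measurable_config_start[OF D]])
  then show "(\<lambda>w. config_start (u w) D) \<in> measurable N (count_space (configs_of_length (length D)))"
    using consistent_config_start[OF D] by (auto simp: measurable_def configs_of_length_def)
  fix D' assume "D' \<in> configs_of_length (length D)"
  then have "consistent K d D'" "length D' = length D" by (auto simp: configs_of_length_def)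
  then show "(\<lambda>w. g D' (t w) (r w) (z w)) \<in> borel_measurable N"
    using measurable_functionalD[OF g, of D' t N r z] t r z by simp
qed

lemma measurable_after_arrival:
  assumes g: "measurable_functional g" and C: "consistent K d C" and c: "c \<in> job_types K d"
    and t: "t \<in> borel_measurable N" and r: "r \<in> measurable N (clocks {..<length C})"
    and s: "s \<in> measurable N Inn" and z: "z \<in> measurable N Z"
  shows "(\<lambda>w. after_arrival g C c (t w) (r w) (s w) (z w)) \<in> borel_measurable N"
proof -
  note sm = measurable_innovation[OF s]
  note [measurable] = measurable_arrival_first[OF t r] measurable_new_type_eq[OF s]
    measurable_functional_config_start[OF g consistent_arrival[OF C c] sm(4) sm(1) measurable_arrival_clocks[OF t r sm(3)] z]
  show ?thesis unfolding after_arrival_def by measurable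
qed

lemma measurable_after_departure:
  assumes g: "measurable_functional g" and C: "consistent K d C" and j: "j \<in> busy_jobs C"
    and t: "t \<in> borel_measurable N" and r: "r \<in> measurable N (clocks {..<length C})"
    and s: "s \<in> measurable N Inn" and z: "z \<in> measurable N Z"
  shows "(\<lambda>w. after_departure g C j (t w) (r w) (s w) (z w)) \<in> borel_measurable N"
proof -
  have jl: "j < length C" using j by (simp add: busy_jobs_def)
  have rj: "(\<lambda>w. r w j) \<in> borel_measurable N" using jl by (intro measurable_clock[OF r]) auto
  note [measurable] = measurable_departure_first[OF t r j]
    measurable_functional_config_start[OF g consistent_drop_nth[OF C jl] measurable_innovation(4)[OF s]
      borel_measurable_diff[OF t rj] measurable_departure_clocks[OF r j] z]
  show ?thesis unfolding after_departure_def by measurable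
qed

lemma measurable_one_step:
  assumes g: "measurable_functional g" shows "measurable_functional (one_step g)"
  unfolding measurable_functional_def
proof (intro allI impI)
  fix C assume C: "consistent K d C"
  let ?N = "borel \<Otimes>\<^sub>M clocks {..<length C} \<Otimes>\<^sub>M Z"
  have t[measurable]: "fst \<in> borel_measurable ?N" and r: "(\<lambda>w. fst (snd w)) \<in> measurable ?N (clocks {..<length C})"
    and s: "(\<lambda>w. shd (snd (snd w))) \<in> measurable ?N Inn" and z: "(\<lambda>w. stl (snd (snd w))) \<in> measurable ?N Z"
    by measurable
  note [measurable] = measurable_no_tie[OF t r] measurable_good_innovation[OF s]
  have [measurable]: "(\<lambda>w. \<Sum>c\<in>job_types K d. after_arrival g C c (fst w) (fst (snd w)) (shd (snd (snd w))) (stl (snd (snd w)))) \<in> borel_measurable ?N"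
    by (intro borel_measurable_sum measurable_after_arrival g C t r s z)
  have [measurable]: "(\<lambda>w. \<Sum>j\<in>busy_jobs C. after_departure g C j (fst w) (fst (snd w)) (shd (snd (snd w))) (stl (snd (snd w)))) \<in> borel_measurable ?N"
    by (intro borel_measurable_sum measurable_after_departure g C t r s z)
  show "(\<lambda>(t, r, z). one_step g C t r z) \<in> borel_measurable ?N"
    unfolding case_prod_beta' one_step_def by measurable
qed

lemma measurable_stopped:
  assumes "measurable_functional g" shows "measurable_functional (stopped v g)"
  unfolding measurable_functional_def
proof (intro allI impI)
  fix C assume "consistent K d C"
  then show "(\<lambda>(t, r, z). stopped v g C t r z) \<in> borel_measurable (borel \<Otimes>\<^sub>M clocks {..<length C} \<Otimes>\<^sub>M Z)"
    using assms by (cases "C \<in> has_counts v") (simp_all add: measurable_functional_def stopped_def)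
qed

lemma measurable_cost: "measurable_functional (cost v k)"
  by (induction k) (auto simp: measurable_functional_def[of "\<lambda>_ _ _ _. 0"] intro: measurable_one_step measurable_stopped)

section \<open>Regeneration at events\<close>

definition clock_law :: "nat \<Rightarrow> (nat \<Rightarrow> real) measure" where
  "clock_law n = PiM {..<n} (\<lambda>_. exp_law \<mu>)"

lemma sets_clock_law [simp, measurable_cong]: "sets (clock_law n) = sets (clocks {..<n})"
  by (simp add: clock_law_def)

lemma space_clock_law [simp]: "space (clock_law n) = space (clocks {..<n})"
  by (simp add: clock_law_def)

sublocale R: prob_space "clock_law n" for n
  unfolding clock_law_def by (rule prob_space_PiM_exp_law[OF \<mu>_pos])

text \<open>
Fresh clocks: the state of the system given its configuration.
\<close>

definition outcome_law :: "nat \<Rightarrow> (real \<times> (nat \<Rightarrow> real) \<times> innovation stream) measure" where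
  "outcome_law n = exp_law lam \<Otimes>\<^sub>M clock_law n \<Otimes>\<^sub>M Z"

definition mean :: "functional \<Rightarrow> config \<Rightarrow> ennreal" where
  "mean g C = (\<integral>\<^sup>+\<omega>. g C (fst \<omega>) (fst (snd \<omega>)) (snd (snd \<omega>)) \<partial>outcome_law (length C))"

lemma nn_integral_outcome_law:
  assumes "f \<in> borel_measurable (outcome_law n)"
  shows "(\<integral>\<^sup>+\<omega>. f \<omega> \<partial>outcome_law n) = (\<integral>\<^sup>+t. \<integral>\<^sup>+r. \<integral>\<^sup>+z. f (t, r, z) \<partial>Z \<partial>clock_law n \<partial>exp_law lam)"
proof -
  interpret RZ: pair_prob_space "clock_law n" Z ..
  note [measurable] = assms[unfolded outcome_law_def]
  have "(\<integral>\<^sup>+\<omega>. f \<omega> \<partial>outcome_law n) = (\<integral>\<^sup>+t. \<integral>\<^sup>+y. f (t, y) \<partial>(clock_law n \<Otimes>\<^sub>M Z) \<partial>exp_law lam)"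
    unfolding outcome_law_def by (subst RZ.nn_integral_fst) simp_all
  also have "\<dots> = (\<integral>\<^sup>+t. \<integral>\<^sup>+r. \<integral>\<^sup>+z. f (t, r, z) \<partial>Z \<partial>clock_law n \<partial>exp_law lam)"
    by (intro nn_integral_cong Z.nn_integral_fst[symmetric]) measurable
  finally show ?thesis .
qed

lemma nn_integral_outcome_law_Stream:
  assumes f[measurable]: "f \<in> borel_measurable (outcome_law n)"
  shows "(\<integral>\<^sup>+\<omega>. f \<omega> \<partial>outcome_law n) = (\<integral>\<^sup>+t. \<integral>\<^sup>+r. \<integral>\<^sup>+s. \<integral>\<^sup>+z. f (t, r, s ## z) \<partial>Z \<partial>Inn \<partial>clock_law n \<partial>exp_law lam)"
  unfolding nn_integral_outcome_law[OF f]
proof (intro nn_integral_cong)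
  fix t r assume "t \<in> space (exp_law lam)" "r \<in> space (clock_law n)"
  note [measurable] = this f[unfolded outcome_law_def]
  show "(\<integral>\<^sup>+z. f (t, r, z) \<partial>Z) = (\<integral>\<^sup>+s. \<integral>\<^sup>+z. f (t, r, s ## z) \<partial>Z \<partial>Inn)"
    by (rule Inn.nn_integral_stream_space) measurable
qed

lemma nn_integral_Inn:
  assumes f: "f \<in> borel_measurable Inn"
  shows "(\<integral>\<^sup>+s. f s \<partial>Inn) = (\<integral>\<^sup>+t. \<integral>\<^sup>+c. \<integral>\<^sup>+b. \<integral>\<^sup>+u. f (t, c, b, u) \<partial>U \<partial>exp_law \<mu> \<partial>P \<partial>exp_law lam)"
proof -
  interpret p1: pair_prob_space "exp_law \<mu>" U ..
  interpret p2: pair_prob_space P "exp_law \<mu> \<Otimes>\<^sub>M U" ..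
  note [measurable] = f[unfolded Inn_eq]
  have "(\<integral>\<^sup>+s. f s \<partial>Inn) = (\<integral>\<^sup>+t. \<integral>\<^sup>+y. f (t, y) \<partial>(P \<Otimes>\<^sub>M exp_law \<mu> \<Otimes>\<^sub>M U) \<partial>exp_law lam)"
    unfolding Inn_eq by (rule p2.nn_integral_fst[symmetric]) measurable
  also have "\<dots> = (\<integral>\<^sup>+t. \<integral>\<^sup>+c. \<integral>\<^sup>+y. f (t, c, y) \<partial>(exp_law \<mu> \<Otimes>\<^sub>M U) \<partial>P \<partial>exp_law lam)"
    by (intro nn_integral_cong p1.nn_integral_fst[symmetric]) measurable
  also have "\<dots> = (\<integral>\<^sup>+t. \<integral>\<^sup>+c. \<integral>\<^sup>+b. \<integral>\<^sup>+u. f (t, c, b, u) \<partial>U \<partial>exp_law \<mu> \<partial>P \<partial>exp_law lam)"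
    by (intro nn_integral_cong U.nn_integral_fst[symmetric]) measurable
  finally show ?thesis .
qed

lemma measurable_outcome_law:
  "fst \<in> borel_measurable (outcome_law n)"
  "(\<lambda>\<omega>. fst (snd \<omega>)) \<in> measurable (outcome_law n) (clocks {..<n})"
  "(\<lambda>\<omega>. snd (snd \<omega>)) \<in> measurable (outcome_law n) Z"
  unfolding outcome_law_def by measurable

lemmas measurable_next = measurable_outcome_law(1,2)
  measurable_compose[OF measurable_outcome_law(3) measurable_shd]
  measurable_compose[OF measurable_outcome_law(3) measurable_stl]

lemma mean_eq:
  assumes g: "measurable_functional g" and C: "consistent K d C"
  shows "mean g C = (\<integral>\<^sup>+t. \<integral>\<^sup>+r. \<integral>\<^sup>+z. g C t r z \<partial>Z \<partial>clock_law (length C) \<partial>exp_law lam)"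
  unfolding mean_def
  by (subst nn_integral_outcome_law) (simp_all add: measurable_functionalD[OF g C measurable_outcome_law])

lemma measurable_mean_over_stream:
  assumes g: "measurable_functional g" and D: "consistent K d D" and u: "u \<in> measurable N (clocks {1..K})"
    and t: "t \<in> borel_measurable N" and r: "r \<in> measurable N (clocks {..<length D})"
  shows "(\<lambda>w. \<integral>\<^sup>+z. g (config_start (u w) D) (t w) (r w) z \<partial>Z) \<in> borel_measurable N"
proof -
  have "(\<lambda>p. g (config_start (u (fst p)) D) (t (fst p)) (r (fst p)) (snd p)) \<in> borel_measurable (N \<Otimes>\<^sub>M Z)"
    by (intro measurable_functional_config_start[OF g D] measurable_compose[OF measurable_fst u]
        measurable_compose[OF measurable_fst t] measurable_compose[OF measurable_fst r] measurable_snd)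
  then show ?thesis by (intro Z.borel_measurable_nn_integral) (simp add: case_prod_beta')
qed

text \<open>
Given that an arrival comes first, the old clocks are fresh by \<open>clock_race_arrival\<close>, the next
interarrival time and the requirement of the new job come from the innovation, and so the clocks of the new
configuration have the law of fresh clocks. Averaging over the type gives the factor \<open>1 / ntypes\<close>.
\<close>

lemma regeneration_arrival:
  assumes g: "measurable_functional g" and con: "consistent K d C" and c: "c \<in> job_types K d"
  defines "n \<equiv> length C" and "D \<equiv> C @ [(c, {})]"
  shows "(\<integral>\<^sup>+\<omega>. after_arrival g C c (fst \<omega>) (fst (snd \<omega>)) (shd (snd (snd \<omega>))) (stl (snd (snd \<omega>))) \<partial>outcome_law n)
    = ennreal (lam / total_rate C) * (ennreal (1 / ntypes) * (\<integral>\<^sup>+u. mean g (config_start u D) \<partial>U))"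
proof -
  have D: "consistent K d D" unfolding D_def by (rule consistent_arrival[OF con c])
  have lD: "length D = Suc n" by (simp add: D_def n_def)
  define \<Gamma> where "\<Gamma> t y u = (\<integral>\<^sup>+z. g (config_start u D) t y z \<partial>Z)" for t y u
  have \<Gamma>: "(\<lambda>w. \<Gamma> (t w) (y w) (u w)) \<in> borel_measurable N"
    if "u \<in> measurable N (clocks {1..K})" "t \<in> borel_measurable N" "y \<in> measurable N (clocks {..<Suc n})"
    for u t y and N :: "'w measure"
    unfolding \<Gamma>_def by (rule measurable_mean_over_stream[OF g D that(1,2)]) (simp add: lD that)
  have upd: "(\<lambda>w. (y w)(n := b w)) \<in> measurable N (clocks {..<Suc n})"
    if "y \<in> measurable N (clocks {..<n})" "b \<in> borel_measurable N" for y b and N :: "'w measure"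
    using that by (intro measurable_fun_upd[where J="{..<n}"]) auto
  \<comment> \<open>The value of an arrival that leaves the residuals \<open>y\<close> of the old jobs, averaged over the innovation.\<close>
  define J where "J y = (\<integral>\<^sup>+s. (if new_type s = c then \<Gamma> (next_arrival s) (y(n := new_req s)) (choices s) else 0) \<partial>Inn)" for y
  have Jf: "(\<lambda>p. if new_type (snd p) = c then \<Gamma> (next_arrival (snd p)) ((fst p)(n := new_req (snd p))) (choices (snd p)) else 0)
      \<in> borel_measurable (clocks {..<n} \<Otimes>\<^sub>M Inn)"
  proof -
    have s: "snd \<in> measurable (clocks {..<n} \<Otimes>\<^sub>M Inn) Inn" by measurable
    note m[measurable] = measurable_innovation[OF s]
    note [measurable] = \<Gamma>[OF m(4) m(1) upd[OF measurable_fst m(3)]] measurable_new_type_eq[OF s]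
    show ?thesis by measurable
  qed
  have J[measurable]: "J \<in> borel_measurable (clocks {..<n})"
    unfolding J_def by (rule Inn.borel_measurable_nn_integral) (use Jf in \<open>simp add: case_prod_beta'\<close>)
  have "(\<integral>\<^sup>+\<omega>. after_arrival g C c (fst \<omega>) (fst (snd \<omega>)) (shd (snd (snd \<omega>))) (stl (snd (snd \<omega>))) \<partial>outcome_law n)
     = (\<integral>\<^sup>+t. \<integral>\<^sup>+r. \<integral>\<^sup>+s. \<integral>\<^sup>+z. after_arrival g C c t r s z \<partial>Z \<partial>Inn \<partial>clock_law n \<partial>exp_law lam)"
    by (subst nn_integral_outcome_law_Stream)
      (use measurable_after_arrival[OF g con c measurable_next] in \<open>simp_all add: n_def\<close>)
  also have "\<dots> = (\<integral>\<^sup>+t. \<integral>\<^sup>+r. (if \<forall>i\<in>busy_jobs C. t < r i then J (run_down {..<n} (busy_jobs C) t r) else 0) \<partial>clock_law n \<partial>exp_law lam)"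
  proof (intro nn_integral_cong)
    fix t r
    show "(\<integral>\<^sup>+s. \<integral>\<^sup>+z. after_arrival g C c t r s z \<partial>Z \<partial>Inn)
      = (if \<forall>i\<in>busy_jobs C. t < r i then J (run_down {..<n} (busy_jobs C) t r) else 0)"
      unfolding after_arrival_def arrival_first_def[symmetric] J_def \<Gamma>_def arrival_clocks_def n_def[symmetric] D_def[symmetric]
      by (cases "arrival_first C t r") (auto intro!: nn_integral_cong)
  qed
  also have "\<dots> = ennreal (lam / total_rate C) * (\<integral>\<^sup>+y. J y \<partial>clock_law n)"
    unfolding clock_law_def total_rate_def
    by (rule clock_race_arrival[OF _ _ lam_pos \<mu>_pos J]) (auto simp: n_def busy_jobs_def)
  also have "(\<integral>\<^sup>+y. J y \<partial>clock_law n) = (\<integral>\<^sup>+y. \<integral>\<^sup>+t. ennreal (1 / ntypes) * (\<integral>\<^sup>+b. \<integral>\<^sup>+u. \<Gamma> t (y(n := b)) u \<partial>U \<partial>exp_law \<mu>) \<partial>exp_law lam \<partial>clock_law n)"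
  proof (rule nn_integral_cong)
    fix y assume "y \<in> space (clock_law n)"
    then have y: "y \<in> space (clocks {..<n})" by simp
    have m: "(\<lambda>s. if new_type s = c then \<Gamma> (next_arrival s) (y(n := new_req s)) (choices s) else 0) \<in> borel_measurable Inn"
      using measurable_compose[OF measurable_Pair1'[OF y] Jf] by (simp only: fst_conv snd_conv)
    have "J y = (\<integral>\<^sup>+t. \<integral>\<^sup>+c'. \<integral>\<^sup>+b. \<integral>\<^sup>+u. (if c' = c then \<Gamma> t (y(n := b)) u else 0) \<partial>U \<partial>exp_law \<mu> \<partial>P \<partial>exp_law lam)"
      unfolding J_def nn_integral_Inn[OF m] fst_conv snd_conv ..
    also have "\<dots> = (\<integral>\<^sup>+t. ennreal (1 / ntypes) * (\<integral>\<^sup>+b. \<integral>\<^sup>+u. \<Gamma> t (y(n := b)) u \<partial>U \<partial>exp_law \<mu>) \<partial>exp_law lam)"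
    proof (rule nn_integral_cong)
      fix t
      let ?X = "\<integral>\<^sup>+b. \<integral>\<^sup>+u. \<Gamma> t (y(n := b)) u \<partial>U \<partial>exp_law \<mu>"
      have "(\<integral>\<^sup>+c'. \<integral>\<^sup>+b. \<integral>\<^sup>+u. (if c' = c then \<Gamma> t (y(n := b)) u else 0) \<partial>U \<partial>exp_law \<mu> \<partial>P) = (\<integral>\<^sup>+c'. ?X * indicator {c} c' \<partial>P)"
        by (intro nn_integral_cong) (auto simp: indicator_def)
      also have "\<dots> = ?X * emeasure P {c}" by (rule nn_integral_cmult_indicator) simp
      also have "emeasure P {c} = ennreal (1 / ntypes)"
      proof -
        have "job_types K d \<noteq> {}" using c by auto
        then show ?thesis using c by (simp add: emeasure_pmf_single ntypes_def pmf_of_set)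
      qed
      also have "?X * ennreal (1 / ntypes) = ennreal (1 / ntypes) * ?X" by (rule mult.commute)
      finally show "(\<integral>\<^sup>+c'. \<integral>\<^sup>+b. \<integral>\<^sup>+u. (if c' = c then \<Gamma> t (y(n := b)) u else 0) \<partial>U \<partial>exp_law \<mu> \<partial>P) = ennreal (1 / ntypes) * ?X" .
    qed
    finally show "J y = \<dots>" .
  qed
  also have "\<dots> = ennreal (1 / ntypes) * (\<integral>\<^sup>+y. \<integral>\<^sup>+t. \<integral>\<^sup>+b. \<integral>\<^sup>+u. \<Gamma> t (y(n := b)) u \<partial>U \<partial>exp_law \<mu> \<partial>exp_law lam \<partial>clock_law n)"
  proof -
    have m1: "(\<lambda>p. \<Gamma> (snd (fst (fst p))) ((fst (fst (fst p)))(n := snd (fst p))) (snd p)) \<in> borel_measurable (((clock_law n \<Otimes>\<^sub>M exp_law lam) \<Otimes>\<^sub>M exp_law \<mu>) \<Otimes>\<^sub>M U)"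
      by (intro \<Gamma> upd) measurable
    have m2: "(\<lambda>p. \<integral>\<^sup>+b. \<integral>\<^sup>+u. \<Gamma> (snd p) ((fst p)(n := b)) u \<partial>U \<partial>exp_law \<mu>) \<in> borel_measurable (clock_law n \<Otimes>\<^sub>M exp_law lam)"
      using m1 by (intro M.borel_measurable_nn_integral U.borel_measurable_nn_integral) (simp add: case_prod_beta')
    then have m3: "(\<lambda>y. \<integral>\<^sup>+t. \<integral>\<^sup>+b. \<integral>\<^sup>+u. \<Gamma> t (y(n := b)) u \<partial>U \<partial>exp_law \<mu> \<partial>exp_law lam) \<in> borel_measurable (clock_law n)"
      by (intro L.borel_measurable_nn_integral) (simp add: case_prod_beta')
    have m4: "(\<lambda>t. \<integral>\<^sup>+b. \<integral>\<^sup>+u. \<Gamma> t (y(n := b)) u \<partial>U \<partial>exp_law \<mu>) \<in> borel_measurable (exp_law lam)"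
      if "y \<in> space (clock_law n)" for y
      using measurable_compose[OF measurable_Pair1'[OF that] m2] by simp
    show ?thesis
      by (subst nn_integral_cmult[OF m3, symmetric]) (intro nn_integral_cong nn_integral_cmult m4)
  qed
  also have "(\<integral>\<^sup>+y. \<integral>\<^sup>+t. \<integral>\<^sup>+b. \<integral>\<^sup>+u. \<Gamma> t (y(n := b)) u \<partial>U \<partial>exp_law \<mu> \<partial>exp_law lam \<partial>clock_law n)
    = (\<integral>\<^sup>+u. \<integral>\<^sup>+t. \<integral>\<^sup>+y. \<integral>\<^sup>+b. \<Gamma> t (y(n := b)) u \<partial>exp_law \<mu> \<partial>clock_law n \<partial>exp_law lam \<partial>U)"
  proof (rule nn_integral_rotate)
    show "(\<lambda>(y, t, b, u). \<Gamma> t (y(n := b)) u) \<in> borel_measurable (clock_law n \<Otimes>\<^sub>M exp_law lam \<Otimes>\<^sub>M exp_law \<mu> \<Otimes>\<^sub>M U)"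
      unfolding case_prod_beta' by (intro \<Gamma> upd) measurable
  qed unfold_locales
  also have "\<dots> = (\<integral>\<^sup>+u. mean g (config_start u D) \<partial>U)"
  proof (rule nn_integral_cong)
    fix u assume "u \<in> space U"
    then have u: "u \<in> space (clocks {1..K})" by simp
    have "(\<integral>\<^sup>+y. \<integral>\<^sup>+b. \<Gamma> t (y(n := b)) u \<partial>exp_law \<mu> \<partial>clock_law n) = (\<integral>\<^sup>+r. \<Gamma> t r u \<partial>clock_law (Suc n))" for t
      unfolding clock_law_def lessThan_Suc
    proof (rule PM.product_nn_integral_insert[symmetric])
      show "(\<lambda>r. \<Gamma> t r u) \<in> borel_measurable (PiM (insert n {..<n}) (\<lambda>_. exp_law \<mu>))"
        by (intro \<Gamma> measurable_const u) (simp_all add: lessThan_Suc measurable_ident_sets)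
    qed auto
    then show "(\<integral>\<^sup>+t. \<integral>\<^sup>+y. \<integral>\<^sup>+b. \<Gamma> t (y(n := b)) u \<partial>exp_law \<mu> \<partial>clock_law n \<partial>exp_law lam) = mean g (config_start u D)"
      using mean_eq[OF g consistent_config_start[OF D], of u] by (simp add: \<Gamma>_def lD)
  qed
  finally show ?thesis .
qed

text \<open>
The same for a departure, by \<open>clock_race_departure\<close>: the clocks of the new configuration are the old ones
without that of the departed job, renumbered.
\<close>

lemma regeneration_departure:
  assumes g: "measurable_functional g" and con: "consistent K d C" and j: "j \<in> busy_jobs C"
  defines "n \<equiv> length C" and "D \<equiv> drop_nth j C"
  shows "(\<integral>\<^sup>+\<omega>. after_departure g C j (fst \<omega>) (fst (snd \<omega>)) (shd (snd (snd \<omega>))) (stl (snd (snd \<omega>))) \<partial>outcome_law n)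
    = ennreal (\<mu> / total_rate C) * (\<integral>\<^sup>+u. mean g (config_start u D) \<partial>U)"
proof -
  have jl: "j < n" using j by (simp add: busy_jobs_def n_def)
  have D: "consistent K d D" unfolding D_def using consistent_drop_nth[OF con] jl by (simp add: n_def)
  obtain m where n: "n = Suc m" using jl by (cases n) auto
  have lD: "length D = m" using jl n by (simp add: D_def n_def)
  let ?B = "{..<n} - {j}"
  let ?del = "\<lambda>y. \<lambda>i\<in>{..<m}. y (skip j i)"
  interpret Y: prob_space "PiM ?B (\<lambda>_. exp_law \<mu>)" by (rule prob_space_PiM_exp_law[OF \<mu>_pos])
  define \<Gamma> where "\<Gamma> t y u = (\<integral>\<^sup>+z. g (config_start u D) t y z \<partial>Z)" for t y u
  have \<Gamma>: "(\<lambda>w. \<Gamma> (t w) (y w) (u w)) \<in> borel_measurable N"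
    if "u \<in> measurable N (clocks {1..K})" "t \<in> borel_measurable N" "y \<in> measurable N (clocks {..<m})"
    for u t y and N :: "'w measure"
    unfolding \<Gamma>_def by (rule measurable_mean_over_stream[OF g D that(1,2)]) (simp add: lD that)
  have del: "(\<lambda>w. ?del (y w)) \<in> measurable N (clocks {..<m})"
    if "y \<in> measurable N (clocks ?B)" for y and N :: "'w measure"
    using jl n skip_neq skip_less[of j n] by (intro measurable_restrict measurable_clock[OF that]) auto
  \<comment> \<open>The value of a departure that leaves the residuals \<open>y\<close> of the other jobs, still indexed by their old positions.\<close>
  define J where "J t y = (\<integral>\<^sup>+s. \<Gamma> t (?del y) (choices s) \<partial>Inn)" for t y
  have J_eq: "J t y = (\<integral>\<^sup>+u. \<Gamma> t (?del y) u \<partial>U)" if y: "y \<in> space (clocks ?B)" for t y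
  proof -
    have m: "(\<lambda>s. \<Gamma> t (?del y) (choices s)) \<in> borel_measurable Inn"
      by (intro \<Gamma> measurable_innovation(4) del) (use y in auto)
    show ?thesis
      unfolding J_def nn_integral_Inn[OF m] fst_conv snd_conv
      by (simp only: prob_space_nn_integral_const[OF L.prob_space_axioms]
          prob_space_nn_integral_const[OF M.prob_space_axioms] prob_space_nn_integral_const[OF prob_space_measure_pmf])
  qed
  have J: "(\<lambda>(t, y). J t y) \<in> borel_measurable (borel \<Otimes>\<^sub>M clocks ?B)"
  proof -
    have "(\<lambda>p. \<Gamma> (fst (fst p)) (?del (snd (fst p))) (choices (snd p))) \<in> borel_measurable ((borel \<Otimes>\<^sub>M clocks ?B) \<Otimes>\<^sub>M Inn)"
      by (intro \<Gamma> measurable_innovation(4) del) measurable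
    then show ?thesis unfolding J_def case_prod_beta'
      by (intro Inn.borel_measurable_nn_integral) (simp add: case_prod_beta')
  qed
  have "(\<integral>\<^sup>+\<omega>. after_departure g C j (fst \<omega>) (fst (snd \<omega>)) (shd (snd (snd \<omega>))) (stl (snd (snd \<omega>))) \<partial>outcome_law n)
     = (\<integral>\<^sup>+t. \<integral>\<^sup>+r. \<integral>\<^sup>+s. \<integral>\<^sup>+z. after_departure g C j t r s z \<partial>Z \<partial>Inn \<partial>clock_law n \<partial>exp_law lam)"
    by (subst nn_integral_outcome_law_Stream)
      (use measurable_after_departure[OF g con j measurable_next] in \<open>simp_all add: n_def\<close>)
  also have "\<dots> = (\<integral>\<^sup>+t. \<integral>\<^sup>+r. (if r j < t \<and> (\<forall>i\<in>busy_jobs C - {j}. r j < r i)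
          then J (t - r j) (run_down ?B (busy_jobs C) (r j) r) else 0) \<partial>clock_law n \<partial>exp_law lam)"
  proof (intro nn_integral_cong)
    fix t r
    show "(\<integral>\<^sup>+s. \<integral>\<^sup>+z. after_departure g C j t r s z \<partial>Z \<partial>Inn) = (if r j < t \<and> (\<forall>i\<in>busy_jobs C - {j}. r j < r i)
          then J (t - r j) (run_down ?B (busy_jobs C) (r j) r) else 0)"
      unfolding J_def \<Gamma>_def after_departure_def departure_first_def[symmetric] departure_clocks_def
        n_def[symmetric] D_def[symmetric] n
      by (cases "departure_first C j t r") simp_all
  qed
  also have "\<dots> = ennreal (\<mu> / total_rate C) * (\<integral>\<^sup>+t. \<integral>\<^sup>+y. J t y \<partial>PiM ?B (\<lambda>_. exp_law \<mu>) \<partial>exp_law lam)"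
    unfolding clock_law_def total_rate_def
    by (rule clock_race_departure[OF _ _ j lam_pos \<mu>_pos J]) (auto simp: n_def busy_jobs_def)
  also have "(\<integral>\<^sup>+t. \<integral>\<^sup>+y. J t y \<partial>PiM ?B (\<lambda>_. exp_law \<mu>) \<partial>exp_law lam)
     = (\<integral>\<^sup>+t. \<integral>\<^sup>+y. \<integral>\<^sup>+u. \<Gamma> t (?del y) u \<partial>U \<partial>PiM ?B (\<lambda>_. exp_law \<mu>) \<partial>exp_law lam)"
    by (intro nn_integral_cong J_eq) simp
  also have "\<dots> = (\<integral>\<^sup>+u. \<integral>\<^sup>+t. \<integral>\<^sup>+y. \<Gamma> t (?del y) u \<partial>PiM ?B (\<lambda>_. exp_law \<mu>) \<partial>exp_law lam \<partial>U)"
  proof (rule nn_integral_move_last)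
    show "(\<lambda>(t, y, u). \<Gamma> t (?del y) u) \<in> borel_measurable (exp_law lam \<Otimes>\<^sub>M PiM ?B (\<lambda>_. exp_law \<mu>) \<Otimes>\<^sub>M U)"
      unfolding case_prod_beta' by (intro \<Gamma> del) measurable
  qed unfold_locales
  also have "\<dots> = (\<integral>\<^sup>+u. mean g (config_start u D) \<partial>U)"
  proof (rule nn_integral_cong)
    fix u assume "u \<in> space U"
    then have u: "u \<in> space (clocks {1..K})" by simp
    have "(\<integral>\<^sup>+y. \<Gamma> t (?del y) u \<partial>PiM ?B (\<lambda>_. exp_law \<mu>)) = (\<integral>\<^sup>+r. \<Gamma> t r u \<partial>clock_law m)" for t
      unfolding clock_law_def n
    proof (rule nn_integral_delete_clock[OF \<mu>_pos])
      show "j < Suc m" using jl n by simp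
      show "(\<lambda>y. \<Gamma> t y u) \<in> borel_measurable (clocks {..<m})"
        by (intro \<Gamma> measurable_const u) (simp_all add: measurable_ident_sets)
    qed
    then show "(\<integral>\<^sup>+t. \<integral>\<^sup>+y. \<Gamma> t (?del y) u \<partial>PiM ?B (\<lambda>_. exp_law \<mu>) \<partial>exp_law lam) = mean g (config_start u D)"
      using mean_eq[OF g consistent_config_start[OF D], of u] by (simp add: \<Gamma>_def lD)
  qed
  finally show ?thesis .
qed

lemma prob_space_outcome_law: "prob_space (outcome_law n)"
proof -
  interpret RZ: pair_prob_space "clock_law n" Z ..
  interpret LRZ: pair_prob_space "exp_law lam" "clock_law n \<Otimes>\<^sub>M Z" ..
  show ?thesis unfolding outcome_law_def by (rule LRZ.prob_space_axioms)
qed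

text \<open>
The event probabilities given by the two regeneration lemmas for the functional \<open>1\<close> add up to one, so
nothing is left for ties.
\<close>

lemma AE_no_tie:
  assumes C: "valid K d C"
  shows "AE \<omega> in outcome_law (length C). no_tie C (fst \<omega>) (fst (snd \<omega>))"
proof -
  let ?N = "outcome_law (length C)"
  interpret N: prob_space ?N by (rule prob_space_outcome_law)
  have con: "consistent K d C" using C by (simp add: valid_def)
  define g :: functional where "g = (\<lambda>_ _ _ _. 1)"
  have g: "measurable_functional g" by (simp add: measurable_functional_def g_def)
  have mean: "mean g D = 1" for D
    by (simp only: mean_def g_def prob_space_nn_integral_const[OF prob_space_outcome_law])
  note ma = measurable_after_arrival[OF g con _ measurable_next] and md = measurable_after_departure[OF g con _ measurable_next]
  let ?E = "\<lambda>c \<omega>. after_arrival g C c (fst \<omega>) (fst (snd \<omega>)) (shd (snd (snd \<omega>))) (stl (snd (snd \<omega>)))"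
  let ?F = "\<lambda>j \<omega>. after_departure g C j (fst \<omega>) (fst (snd \<omega>)) (shd (snd (snd \<omega>))) (stl (snd (snd \<omega>)))"
  let ?S = "{\<omega> \<in> space ?N. no_tie C (fst \<omega>) (fst (snd \<omega>))}"
  have le: "(\<Sum>c\<in>job_types K d. after_arrival g C c t r s z) + (\<Sum>j\<in>busy_jobs C. after_departure g C j t r s z)
     \<le> (if no_tie C t r then 1 else 0)" for t r s z
  proof (cases "\<exists>j\<in>busy_jobs C. departure_first C j t r")
    case True
    then obtain j where j: "j \<in> busy_jobs C" "departure_first C j t r" by blast
    have "departure_first C i t r \<longleftrightarrow> i = j" if "i \<in> busy_jobs C" for i
      using j that unfolding departure_first_def by (metis DiffI less_asym singletonD)
    then have "(\<Sum>i\<in>busy_jobs C. after_departure g C i t r s z) = (\<Sum>i\<in>busy_jobs C. if i = j then 1 else 0)"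
      by (intro sum.cong) (auto simp: after_departure_def g_def)
    moreover have "\<not> arrival_first C t r"
      using j by (auto simp: arrival_first_def departure_first_def dest: less_asym)
    ultimately show ?thesis using j by (auto simp: no_tie_def after_arrival_def)
  next
    case False
    then have "(\<Sum>i\<in>busy_jobs C. after_departure g C i t r s z) = 0"
      by (intro sum.neutral) (auto simp: after_departure_def)
    moreover have "(\<Sum>c\<in>job_types K d. after_arrival g C c t r s z) \<le> (\<Sum>c\<in>job_types K d. if new_type s = c then (if arrival_first C t r then 1 else 0) else 0)"
      by (intro sum_mono) (auto simp: after_arrival_def g_def)
    ultimately show ?thesis using False
      by (cases "new_type s \<in> job_types K d") (auto simp: no_tie_def split: if_splits)
  qed
  have "1 = T (mean g) C" using T_one[of C] C by (simp add: mean[abs_def])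
  also have "\<dots> = (\<Sum>c\<in>job_types K d. \<integral>\<^sup>+\<omega>. ?E c \<omega> \<partial>?N) + (\<Sum>j\<in>busy_jobs C. \<integral>\<^sup>+\<omega>. ?F j \<omega> \<partial>?N)"
    unfolding T_def by (simp add: regeneration_arrival[OF g con] regeneration_departure[OF g con] sum_distrib_left)
  also have "\<dots> = (\<integral>\<^sup>+\<omega>. (\<Sum>c\<in>job_types K d. ?E c \<omega>) + (\<Sum>j\<in>busy_jobs C. ?F j \<omega>) \<partial>?N)"
    by (subst nn_integral_add) (auto intro!: borel_measurable_sum ma md simp: nn_integral_sum ma md)
  also have "\<dots> \<le> (\<integral>\<^sup>+\<omega>. indicator ?S \<omega> \<partial>?N)"
  proof (rule nn_integral_mono)
    fix \<omega> assume "\<omega> \<in> space ?N"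
    then have "indicator ?S \<omega> = (if no_tie C (fst \<omega>) (fst (snd \<omega>)) then 1 else 0 :: ennreal)"
      by (simp add: indicator_def)
    then show "(\<Sum>c\<in>job_types K d. ?E c \<omega>) + (\<Sum>j\<in>busy_jobs C. ?F j \<omega>) \<le> indicator ?S \<omega>"
      by (simp only: le)
  qed
  also have "\<dots> = emeasure ?N ?S"
    using measurable_no_tie[OF measurable_outcome_law(1,2)] by (intro nn_integral_indicator) (simp add: pred_def)
  finally have "N.prob ?S = 1"
    using N.prob_le_1[of ?S] by (simp add: N.emeasure_eq_measure)
  then have "AE \<omega> in ?N. \<omega> \<in> ?S" by (rule N.AE_prob_1)
  then show ?thesis by eventually_elim simp
qed

lemma AE_good_innovation: "(\<integral>\<^sup>+s. (if good_innovation s then 0 else \<infinity>) \<partial>Inn) = 0"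
proof -
  let ?f = "\<lambda>t c b u. if good_innovation (t, c, b, u) then 0 else \<infinity> :: ennreal"
  have id: "(\<lambda>s. s) \<in> measurable Inn Inn" by simp
  note [measurable] = measurable_good_innovation[OF id]
  have "job_types K d \<noteq> {}" using ntypes_pos by (auto simp: ntypes_def)
  then have c: "AE c in P. c \<in> job_types K d" by (simp add: AE_measure_pmf_iff)
  have u: "(\<integral>\<^sup>+u. ?f t c b u \<partial>U) = 0" if "0 < t" "c \<in> job_types K d" "0 < b" for t c b
  proof -
    have "(\<integral>\<^sup>+u. ?f t c b u \<partial>U) = (\<integral>\<^sup>+u. 0 \<partial>U)"
      by (rule nn_integral_cong_AE, use AE_choices_ok[of K] in eventually_elim) (simp add: good_innovation_def that)
    then show ?thesis by simp
  qed
  have b: "(\<integral>\<^sup>+b. \<integral>\<^sup>+u. ?f t c b u \<partial>U \<partial>exp_law \<mu>) = 0" if "0 < t" "c \<in> job_types K d" for t c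
  proof -
    have "(\<integral>\<^sup>+b. \<integral>\<^sup>+u. ?f t c b u \<partial>U \<partial>exp_law \<mu>) = (\<integral>\<^sup>+b. 0 \<partial>exp_law \<mu>)"
      by (rule nn_integral_cong_AE, use AE_exp_law_pos[of \<mu>] in eventually_elim) (rule u[OF that])
    then show ?thesis by simp
  qed
  have c: "(\<integral>\<^sup>+c. \<integral>\<^sup>+b. \<integral>\<^sup>+u. ?f t c b u \<partial>U \<partial>exp_law \<mu> \<partial>P) = 0" if "0 < t" for t
  proof -
    have "(\<integral>\<^sup>+c. \<integral>\<^sup>+b. \<integral>\<^sup>+u. ?f t c b u \<partial>U \<partial>exp_law \<mu> \<partial>P) = (\<integral>\<^sup>+c. 0 \<partial>P)"
      by (rule nn_integral_cong_AE, use c in eventually_elim) (rule b[OF that])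
    then show ?thesis by simp
  qed
  have "(\<integral>\<^sup>+s. (if good_innovation s then 0 else \<infinity>) \<partial>Inn) = (\<integral>\<^sup>+t. \<integral>\<^sup>+c. \<integral>\<^sup>+b. \<integral>\<^sup>+u. ?f t c b u \<partial>U \<partial>exp_law \<mu> \<partial>P \<partial>exp_law lam)"
    by (rule nn_integral_Inn) measurable
  also have "\<dots> = (\<integral>\<^sup>+t. 0 \<partial>exp_law lam)"
    by (rule nn_integral_cong_AE, use AE_exp_law_pos[of lam] in eventually_elim) (rule c)
  finally show ?thesis by simp
qed

text \<open>
Regeneration: one event of the system with fresh clocks acts on means as one step of the jump chain.
\<close>

theorem mean_one_step:
  assumes g: "measurable_functional g" and C: "valid K d C"
  shows "mean (one_step g) C = ennreal (1 / lam + 1) + T (mean g) C"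
proof -
  have con: "consistent K d C" using C by (simp add: valid_def)
  let ?n = "length C"
  let ?N = "outcome_law ?n"
  note const = prob_space_nn_integral_const[OF L.prob_space_axioms] prob_space_nn_integral_const[OF R.prob_space_axioms]
    prob_space_nn_integral_const[OF Inn.prob_space_axioms] prob_space_nn_integral_const[OF Z.prob_space_axioms]
  let ?t = "fst :: real \<times> (nat \<Rightarrow> real) \<times> innovation stream \<Rightarrow> real"
  let ?r = "\<lambda>\<omega>. fst (snd \<omega>)" and ?s = "\<lambda>\<omega>. shd (snd (snd \<omega>))" and ?z = "\<lambda>\<omega>. stl (snd (snd \<omega>))"
  note t[measurable] = measurable_outcome_law(1)[of ?n] and r = measurable_outcome_law(2)[of ?n]
  note s = measurable_compose[OF measurable_outcome_law(3)[of ?n] measurable_shd]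
    and z = measurable_compose[OF measurable_outcome_law(3)[of ?n] measurable_stl]
  define A where "A \<omega> = ennreal (?t \<omega> + 1)" for \<omega> :: "real \<times> (nat \<Rightarrow> real) \<times> innovation stream"
  define B1 :: "_ \<Rightarrow> ennreal" where "B1 \<omega> = (if no_tie C (?t \<omega>) (?r \<omega>) then 0 else \<infinity>)"
    for \<omega> :: "real \<times> (nat \<Rightarrow> real) \<times> innovation stream"
  define B2 :: "_ \<Rightarrow> ennreal" where "B2 \<omega> = (if good_innovation (?s \<omega>) then 0 else \<infinity>)"
    for \<omega> :: "real \<times> (nat \<Rightarrow> real) \<times> innovation stream"
  define E where "E c \<omega> = after_arrival g C c (?t \<omega>) (?r \<omega>) (?s \<omega>) (?z \<omega>)" for c \<omega>
  define F where "F j \<omega> = after_departure g C j (?t \<omega>) (?r \<omega>) (?s \<omega>) (?z \<omega>)" for j \<omega>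
  note [measurable] = measurable_no_tie[OF t r] measurable_good_innovation[OF s]
  have mA[measurable]: "A \<in> borel_measurable ?N" unfolding A_def by measurable
  have mB1[measurable]: "B1 \<in> borel_measurable ?N" unfolding B1_def by measurable
  have mB2[measurable]: "B2 \<in> borel_measurable ?N" unfolding B2_def by measurable
  have mE[measurable]: "E c \<in> borel_measurable ?N" if "c \<in> job_types K d" for c
    unfolding E_def by (rule measurable_after_arrival[OF g con that t r s z])
  have mF[measurable]: "F j \<in> borel_measurable ?N" if "j \<in> busy_jobs C" for j
    unfolding F_def by (rule measurable_after_departure[OF g con that t r s z])
  have "mean (one_step g) C = (\<integral>\<^sup>+\<omega>. A \<omega> + B1 \<omega> + B2 \<omega> + (\<Sum>c\<in>job_types K d. E c \<omega>) + (\<Sum>j\<in>busy_jobs C. F j \<omega>) \<partial>?N)"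
    unfolding mean_def one_step_def A_def B1_def B2_def E_def F_def ..
  also have "\<dots> = (\<integral>\<^sup>+\<omega>. A \<omega> \<partial>?N) + (\<integral>\<^sup>+\<omega>. B1 \<omega> \<partial>?N) + (\<integral>\<^sup>+\<omega>. B2 \<omega> \<partial>?N) + (\<Sum>c\<in>job_types K d. \<integral>\<^sup>+\<omega>. E c \<omega> \<partial>?N) + (\<Sum>j\<in>busy_jobs C. \<integral>\<^sup>+\<omega>. F j \<omega> \<partial>?N)"
    by (simp add: nn_integral_add nn_integral_sum)
  also have "(\<integral>\<^sup>+\<omega>. A \<omega> \<partial>?N) = ennreal (1 / lam + 1)"
  proof -
    have "(\<integral>\<^sup>+\<omega>. A \<omega> \<partial>?N) = (\<integral>\<^sup>+t. ennreal (t + 1) \<partial>exp_law lam)"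
      unfolding nn_integral_outcome_law[OF mA] by (simp only: A_def fst_conv const)
    also have "\<dots> = (\<integral>\<^sup>+t. ennreal t + 1 \<partial>exp_law lam)"
      by (rule nn_integral_cong_AE, use AE_exp_law_pos[of lam] in eventually_elim) (simp add: ennreal_plus)
    also have "\<dots> = (\<integral>\<^sup>+t. ennreal t \<partial>exp_law lam) + (\<integral>\<^sup>+t. 1 \<partial>exp_law lam)"
      by (rule nn_integral_add) simp_all
    also have "\<dots> = ennreal (1 / lam + 1)"
      unfolding exp_law_mean[OF lam_pos] const using lam_pos by (simp add: ennreal_plus)
    finally show ?thesis .
  qed
  also have "(\<integral>\<^sup>+\<omega>. B1 \<omega> \<partial>?N) = 0"
  proof -
    have "(\<integral>\<^sup>+\<omega>. B1 \<omega> \<partial>?N) = (\<integral>\<^sup>+\<omega>. 0 \<partial>?N)"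
      by (rule nn_integral_cong_AE, use AE_no_tie[OF C] in eventually_elim) (simp add: B1_def)
    then show ?thesis by simp
  qed
  also have "(\<integral>\<^sup>+\<omega>. B2 \<omega> \<partial>?N) = 0"
    unfolding nn_integral_outcome_law_Stream[OF mB2] using AE_good_innovation
    by (simp only: B2_def fst_conv snd_conv stream.sel const)
  finally show ?thesis
    unfolding T_def E_def F_def
    by (simp add: regeneration_arrival[OF g con] regeneration_departure[OF g con] sum_distrib_left add.assoc)
qed

lemma mean_stopped: "mean (stopped v g) C = (if C \<in> has_counts v then 0 else mean g C)"
  by (simp add: mean_def stopped_def)

text \<open>
The cost of \<open>k\<close> events stopped at the hitting time is on average the expected number of events until then,
times the mean charge for one event.
\<close>

lemma mean_cost:
  "valid K d C \<Longrightarrow> mean (cost v k) C = ennreal (1 / lam + 1) * (\<Sum>i<k. survival (has_counts v) i C)"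
proof (induction k arbitrary: C)
  case 0
  then show ?case by (simp add: mean_def)
next
  case (Suc k)
  let ?a = "ennreal (1 / lam + 1)"
  have sum: "taboo (has_counts v) (\<lambda>C. \<Sum>i<m. survival (has_counts v) i C) C = (\<Sum>i<m. survival (has_counts v) (Suc i) C)" for m
  proof (induction m)
    case 0
    show ?case using taboo_cmult[of C "has_counts v" 0 "\<lambda>_. 0"] Suc.prems by simp
  next
    case (Suc m)
    then show ?case using \<open>valid K d C\<close> by (simp add: taboo_add survival_Suc)
  qed
  have "mean (cost v (Suc k)) C = ?a + taboo (has_counts v) (mean (cost v k)) C"
    using mean_one_step[OF measurable_stopped[OF measurable_cost] Suc.prems, of v v k]
    by (simp add: taboo_def mean_stopped[abs_def])
  also have "\<dots> = ?a + taboo (has_counts v) (\<lambda>C. ?a * (\<Sum>i<k. survival (has_counts v) i C)) C"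
    using Suc.prems by (intro arg_cong2[where f="(+)"] refl taboo_cong) (auto simp: Suc.IH)
  also have "\<dots> = ?a * (1 + (\<Sum>i<k. survival (has_counts v) (Suc i) C))"
    using Suc.prems by (simp add: taboo_cmult sum distrib_left)
  also have "1 + (\<Sum>i<k. survival (has_counts v) (Suc i) C) = (\<Sum>i<Suc k. survival (has_counts v) i C)"
    by (subst sum.lessThan_Suc_shift) simp
  finally show ?case .
qed

end

section \<open>Reduction of states to configurations\<close>

definition job_config :: "job \<Rightarrow> nat set \<times> nat set" where
  "job_config j = (job_type j, dom (job_att j))"

text \<open>
The requirement left to the copy that is furthest ahead, which is the one to complete first; for a waiting job, the
whole requirement.
\<close>

definition residual :: "job \<Rightarrow> real" where
  "residual j = job_req j - max_attained (job_type j, job_att j)"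

definition residuals :: "job list \<Rightarrow> nat \<Rightarrow> real" where
  "residuals js = (\<lambda>i\<in>{..<length js}. residual (js ! i))"

text \<open>
Finiteness and nonnegativity make the maximum in \<open>max_attained\<close>, which is taken together with
\<open>0\<close>, the maximum over the copies in service.
\<close>

definition proper_job :: "job \<Rightarrow> bool" where
  "proper_job j \<longleftrightarrow> finite (ran (job_att j)) \<and> (\<forall>a\<in>ran (job_att j). 0 \<le> a)"

lemma serve_simps [simp]:
  "job_type (serve h j) = job_type j" "job_req (serve h j) = job_req j"
  "dom (job_att (serve h j)) = dom (job_att j)" "job_config (serve h j) = job_config j"
  by (auto simp: serve_def job_config_def dom_def)

lemma ran_serve: "ran (job_att (serve h j)) = (\<lambda>a. a + h) ` ran (job_att j)"
  by (auto simp: serve_def ran_def image_def)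

lemma ran_empty_iff: "ran f = {} \<longleftrightarrow> dom f = {}"
  by (auto simp: ran_def dom_def) (metis not_None_eq)

lemma max_attained_in_service:
  assumes "proper_job j" "dom (job_att j) \<noteq> {}"
  shows "max_attained (job_type j, job_att j) = Max (ran (job_att j))"
    "max_attained (job_type j, job_att j) \<in> ran (job_att j)"
proof -
  have f: "finite (ran (job_att j))" "ran (job_att j) \<noteq> {}" "\<forall>a\<in>ran (job_att j). 0 \<le> a"
    using assms by (auto simp: proper_job_def ran_empty_iff)
  then have "0 \<le> Max (ran (job_att j))" using Max_in by blast
  then show 1: "max_attained (job_type j, job_att j) = Max (ran (job_att j))"
    using f by (simp add: max_attained_def Max_insert)
  show "max_attained (job_type j, job_att j) \<in> ran (job_att j)" unfolding 1 using f by simp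
qed

lemma proper_job_serve: "proper_job j \<Longrightarrow> 0 \<le> h \<Longrightarrow> proper_job (serve h j)"
  by (auto simp: proper_job_def ran_serve)

lemma residual_serve:
  assumes j: "proper_job j" and h: "0 \<le> h"
  shows "residual (serve h j) = (if dom (job_att j) \<noteq> {} then residual j - h else residual j)"
proof (cases "dom (job_att j) = {}")
  case True
  then have "ran (job_att j) = {}" by (simp only: ran_empty_iff)
  then show ?thesis using True by (simp add: residual_def max_attained_def ran_serve)
next
  case False
  have "Max (ran (job_att (serve h j))) = Max (ran (job_att j)) + h"
    unfolding ran_serve using Max_add_commute[of "ran (job_att j)" "\<lambda>a. a" h] j False
    by (simp add: proper_job_def ran_empty_iff)
  then show ?thesis
    using False max_attained_in_service(1)[OF j False] max_attained_in_service(1)[OF proper_job_serve[OF j h]]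
    by (simp add: residual_def)
qed

lemma residual_le: "proper_job j \<Longrightarrow> a \<in> ran (job_att j) \<Longrightarrow> residual j \<le> job_req j - a"
  by (auto simp: residual_def max_attained_def proper_job_def intro!: Max_ge)

lemma completed_serve_iff:
  assumes j: "proper_job j" and h: "0 \<le> h"
  shows "completed (serve h j) \<longleftrightarrow> dom (job_att j) \<noteq> {} \<and> residual j \<le> h"
proof
  assume "completed (serve h j)"
  then obtain a where a: "a \<in> ran (job_att j)" "job_req j \<le> a + h"
    by (auto simp: completed_def ran_serve)
  then have "dom (job_att j) \<noteq> {}" using ran_empty_iff[of "job_att j"] by auto
  moreover have "residual j \<le> h" using residual_le[OF j a(1)] a(2) by linarith
  ultimately show "dom (job_att j) \<noteq> {} \<and> residual j \<le> h" ..
next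
  assume r: "dom (job_att j) \<noteq> {} \<and> residual j \<le> h"
  then have "max_attained (job_type j, job_att j) \<in> ran (job_att j)"
    using max_attained_in_service(2)[OF j] by simp
  then show "completed (serve h j)"
    using r unfolding completed_def ran_serve residual_def by force
qed

lemma idle_iff: "idle js s \<longleftrightarrow> config_idle (map job_config js) s"
  by (auto simp: idle_def config_idle_def job_config_def dom_def)

lemma queue_eq: "queue js s = config_queue (map job_config js) s"
  unfolding queue_def config_queue_def by (rule filter_cong) (auto simp: job_config_def)

lemma ros_pick_eq: "ros_pick u js s = config_pick u (map job_config js) s"
  by (simp add: ros_pick_def config_pick_def queue_eq)

lemma length_start_service [simp]: "length (start_service u js) = length js"
  by (simp add: start_service_def)

lemma nth_start_service:
  "i < length js \<Longrightarrow> start_service u js ! i = Job (job_type (js ! i)) (job_req (js ! i))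
     (\<lambda>s. if s \<in> new_servers u (map job_config js) i then Some 0 else job_att (js ! i) s)"
  by (auto simp: start_service_def new_servers_def idle_iff[symmetric] ros_pick_eq[symmetric] job_config_def fun_eq_iff)

lemma job_config_start_service: "map job_config (start_service u js) = config_start u (map job_config js)"
  by (rule nth_equalityI) (auto simp: nth_start_service nth_config_start job_config_def dom_def)

lemma ran_start_service:
  assumes "i < length js"
  shows "insert 0 (ran (job_att (start_service u js ! i))) = insert 0 (ran (job_att (js ! i)))"
proof -
  have "job_att (js ! i) s = None" if "s \<in> new_servers u (map job_config js) i" for s
    using that assms by (auto simp: new_servers_def idle_iff[symmetric] idle_def)
  then show ?thesis using assms by (auto simp: nth_start_service ran_def split: if_splits) (metis option.distinct(1))
qed

text \<open>
A newly started copy has attained service \<open>0\<close>, which \<open>max_attained\<close> includes anyway.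
\<close>

lemma residual_start_service:
  assumes "i < length js"
  shows "residual (start_service u js ! i) = residual (js ! i)"
  using ran_start_service[OF assms, of u] assms
  by (simp add: residual_def max_attained_def nth_start_service)

lemma residuals_start_service: "residuals (start_service u js) = residuals js"
  by (auto simp: residuals_def residual_start_service fun_eq_iff)

lemma proper_start_service:
  assumes "\<forall>j\<in>set js. proper_job j"
  shows "\<forall>j\<in>set (start_service u js). proper_job j"
proof
  fix j assume "j \<in> set (start_service u js)"
  then obtain i where i: "i < length js" "j = start_service u js ! i" by (auto simp: in_set_conv_nth)
  have "proper_job (js ! i)" using assms i by simp
  then have "finite (insert 0 (ran (job_att (js ! i))))" "\<forall>a\<in>insert 0 (ran (job_att (js ! i))). 0 \<le> a"
    by (auto simp: proper_job_def)
  then have "finite (insert 0 (ran (job_att j)))" "\<forall>a\<in>insert 0 (ran (job_att j)). 0 \<le> a"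
    unfolding i(2) ran_start_service[OF i(1)] by auto
  then show "proper_job j" by (auto simp: proper_job_def)
qed

lemma residuals_nth: "i < length js \<Longrightarrow> residuals js i = residual (js ! i)"
  by (simp add: residuals_def)

lemma busy_jobs_config: "i \<in> busy_jobs (map job_config js) \<longleftrightarrow> i < length js \<and> dom (job_att (js ! i)) \<noteq> {}"
  by (auto simp: busy_jobs_def job_config_def)

definition proper_state :: "nat \<Rightarrow> nat \<Rightarrow> state \<Rightarrow> bool" where
  "proper_state K d x \<longleftrightarrow> 0 < fst x \<and> valid K d (map job_config (snd x)) \<and>
     (\<forall>j\<in>set (snd x). proper_job j \<and> 0 < residual j)"

lemma finite_event_clocks:
  assumes "\<forall>j\<in>set js. proper_job j"
  shows "finite (\<Union>j\<in>set js. (\<lambda>a. job_req j - a) ` ran (job_att j))"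
  using assms by (auto simp: proper_job_def)

lemma event_clock_cases:
  assumes "\<forall>j\<in>set js. proper_job j" "e \<in> (\<Union>j\<in>set js. (\<lambda>a. job_req j - a) ` ran (job_att j))"
  obtains i where "i \<in> busy_jobs (map job_config js)" "residuals js i \<le> e"
proof -
  from assms(2) obtain j a where ja: "j \<in> set js" "a \<in> ran (job_att j)" "e = job_req j - a" by auto
  then obtain i where i: "i < length js" "j = js ! i" by (auto simp: in_set_conv_nth)
  have "dom (job_att j) \<noteq> {}" using ja(2) ran_empty_iff[of "job_att j"] by auto
  moreover have "residual j \<le> e" using residual_le[of j a] ja assms(1) by simp
  ultimately show ?thesis using that[of i] i by (simp add: busy_jobs_config residuals_nth)
qed

lemma holding_time_arrival:
  assumes "\<forall>j\<in>set js. proper_job j" "arrival_first (map job_config js) t (residuals js)"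
  shows "holding_time (t, js) = t"
proof -
  let ?E = "\<Union>j\<in>set js. (\<lambda>a. job_req j - a) ` ran (job_att j)"
  have "Min (insert t ?E) = t"
  proof (rule Min_eqI)
    show "finite (insert t ?E)" using finite_event_clocks[OF assms(1)] by simp
    fix e assume "e \<in> insert t ?E"
    then show "t \<le> e"
      using event_clock_cases[OF assms(1), of e] assms(2)
      unfolding arrival_first_def by (metis insertE less_imp_le order.refl order.trans)
  qed simp
  then show ?thesis by (simp add: holding_time_def)
qed

lemma holding_time_departure:
  assumes js: "\<forall>j\<in>set js. proper_job j" and j: "j \<in> busy_jobs (map job_config js)"
    and dep: "departure_first (map job_config js) j t (residuals js)"
  shows "holding_time (t, js) = residuals js j"
proof -
  let ?E = "\<Union>j\<in>set js. (\<lambda>a. job_req j - a) ` ran (job_att j)"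
  have jl: "j < length js" "dom (job_att (js ! j)) \<noteq> {}" using j by (auto simp: busy_jobs_config)
  have pj: "proper_job (js ! j)" using js jl by simp
  have "Min (insert t ?E) = residuals js j"
  proof (rule Min_eqI)
    show "finite (insert t ?E)" using finite_event_clocks[OF js] by simp
    show "residuals js j \<in> insert t ?E"
      using max_attained_in_service(2)[OF pj jl(2)] jl by (auto simp: residuals_nth residual_def)
    fix e assume "e \<in> insert t ?E"
    then consider "e = t" | i where "i \<in> busy_jobs (map job_config js)" "residuals js i \<le> e"
      using event_clock_cases[OF js, of e] by blast
    then show "residuals js j \<le> e"
    proof cases
      case 2
      then show ?thesis using dep unfolding departure_first_def
        by (cases "i = j") (auto dest!: bspec[of _ _ i])
    qed (use dep in \<open>simp add: departure_first_def\<close>)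
  qed
  then show ?thesis by (simp add: holding_time_def)
qed

lemma holding_time_pos:
  assumes "proper_state K d x" shows "0 < holding_time x"
proof -
  let ?E = "\<Union>j\<in>set (snd x). (\<lambda>a. job_req j - a) ` ran (job_att j)"
  have js: "\<forall>j\<in>set (snd x). proper_job j" and pos: "\<forall>j\<in>set (snd x). 0 < residual j" and t: "0 < fst x"
    using assms by (auto simp: proper_state_def)
  have fin: "finite (insert (fst x) ?E)" using finite_event_clocks[OF js] by simp
  have "0 < e" if "e \<in> insert (fst x) ?E" for e
  proof (cases "e = fst x")
    case False
    with that have "e \<in> ?E" by simp
    then obtain i where i: "i \<in> busy_jobs (map job_config (snd x))" "residuals (snd x) i \<le> e"
      by (rule event_clock_cases[OF js])
    then have "i < length (snd x)" by (simp add: busy_jobs_config)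
    then have "0 < residuals (snd x) i" using pos by (simp add: residuals_nth)
    with i show ?thesis by linarith
  qed (simp add: t)
  then show ?thesis unfolding holding_time_def using fin by (subst Min_gr_iff) auto
qed

text \<open>
The dynamics of the system, seen through configurations and residuals, are those built into \<open>one_step\<close>;
attained services have disappeared.
\<close>

lemma next_state_arrival:
  assumes js: "\<forall>j\<in>set js. proper_job j" and t: "0 < t"
    and arr: "arrival_first (map job_config js) t (residuals js)"
  shows "fst (next_state (t', c, b, u) (t, js)) = t'"
    and "map job_config (snd (next_state (t', c, b, u) (t, js))) = config_start u (map job_config js @ [(c, {})])"
    and "residuals (snd (next_state (t', c, b, u) (t, js))) = arrival_clocks (map job_config js) t (residuals js) b"
    and "\<forall>j\<in>set (snd (next_state (t', c, b, u) (t, js))). proper_job j"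
proof -
  have "\<not> completed (serve t (js ! i))" if "i < length js" for i
    using arr that js t busy_jobs_config[of i js]
    by (auto simp: completed_serve_iff arrival_first_def residuals_nth dest!: bspec[of _ _ i])
  then have "filter (\<lambda>j. \<not> completed j) (map (serve t) js) = map (serve t) js"
    by (auto simp: filter_id_conv in_set_conv_nth)
  then have ns: "next_state (t', c, b, u) (t, js) = (t', start_service u (map (serve t) js @ [Job c b Map.empty]))"
    by (simp add: holding_time_arrival[OF js arr])
  show "fst (next_state (t', c, b, u) (t, js)) = t'" by (simp only: ns fst_conv)
  have cfg: "map job_config (map (serve t) js @ [Job c b Map.empty]) = map job_config js @ [(c, {})]"
    by (simp add: o_def) (simp add: job_config_def)
  show "map job_config (snd (next_state (t', c, b, u) (t, js))) = config_start u (map job_config js @ [(c, {})])"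
    unfolding ns snd_conv job_config_start_service cfg ..
  have "residual (Job c b Map.empty) = b" by (simp add: residual_def max_attained_def)
  then have "residuals (map (serve t) js @ [Job c b Map.empty]) i = arrival_clocks (map job_config js) t (residuals js) b i" for i
    using js t by (auto simp: residuals_def arrival_clocks_def run_down_def nth_append residual_serve
        busy_jobs_config less_Suc_eq)
  then show "residuals (snd (next_state (t', c, b, u) (t, js))) = arrival_clocks (map job_config js) t (residuals js) b"
    unfolding ns snd_conv residuals_start_service by (rule ext)
  have "\<forall>j\<in>set (map (serve t) js @ [Job c b Map.empty]). proper_job j"
    using js t by (auto intro!: proper_job_serve) (simp add: proper_job_def)
  then show "\<forall>j\<in>set (snd (next_state (t', c, b, u) (t, js))). proper_job j"
    unfolding ns snd_conv by (rule proper_start_service)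
qed

lemma next_state_departure:
  assumes js: "\<forall>j\<in>set js. proper_job j" and pos: "\<forall>j\<in>set js. 0 < residual j"
    and j: "j \<in> busy_jobs (map job_config js)"
    and dep: "departure_first (map job_config js) j t (residuals js)"
  shows "fst (next_state (t', c, b, u) (t, js)) = t - residuals js j"
    and "map job_config (snd (next_state (t', c, b, u) (t, js))) = config_start u (drop_nth j (map job_config js))"
    and "residuals (snd (next_state (t', c, b, u) (t, js))) = departure_clocks (map job_config js) j (residuals js)"
    and "\<forall>j\<in>set (snd (next_state (t', c, b, u) (t, js))). proper_job j"
proof -
  let ?h = "residuals js j"
  have jl: "j < length js" "dom (job_att (js ! j)) \<noteq> {}" using j by (auto simp: busy_jobs_config)
  have h: "0 < ?h" using jl pos by (simp add: residuals_nth)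
  have "\<not> completed (serve ?h (js ! i)) \<longleftrightarrow> i \<noteq> j" if "i < length js" for i
  proof (cases "i = j")
    case True
    then show ?thesis using js jl h by (simp add: completed_serve_iff residuals_nth)
  next
    case False
    have "proper_job (js ! i)" using js that by simp
    moreover have "?h < residuals js i" if "dom (job_att (js ! i)) \<noteq> {}"
      using dep that False \<open>i < length js\<close> unfolding departure_first_def by (simp add: busy_jobs_config)
    ultimately show ?thesis using False h that by (auto simp: completed_serve_iff residuals_nth)
  qed
  then have "filter (\<lambda>j. \<not> completed j) (map (serve ?h) js) = drop_nth j (map (serve ?h) js)"
    using jl by (intro filter_eq_drop_nth) auto
  moreover have "t \<noteq> ?h" using dep by (simp add: departure_first_def)
  ultimately have ns: "next_state (t', c, b, u) (t, js) = (t - ?h, start_service u (drop_nth j (map (serve ?h) js)))"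
    by (simp add: holding_time_departure[OF js j dep] Let_def)
  show "fst (next_state (t', c, b, u) (t, js)) = t - ?h" by (simp only: ns fst_conv)
  have cfg: "map job_config (drop_nth j (map (serve ?h) js)) = drop_nth j (map job_config js)"
    by (simp add: drop_nth_def take_map[symmetric] drop_map[symmetric] o_def)
  show "map job_config (snd (next_state (t', c, b, u) (t, js))) = config_start u (drop_nth j (map job_config js))"
    unfolding ns snd_conv job_config_start_service cfg ..
  have "residuals (drop_nth j (map (serve ?h) js)) i = departure_clocks (map job_config js) j (residuals js) i" for i
  proof (cases "i < length js - 1")
    case True
    have sl: "skip j i < length js" by (rule skip_less[OF jl(1) True])
    have "drop_nth j (map (serve ?h) js) ! i = serve ?h (js ! skip j i)"
      using jl True sl by (subst nth_drop_nth) auto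
    moreover have "proper_job (js ! skip j i)" using js sl by simp
    ultimately show ?thesis
      using True jl sl h skip_neq[of j i]
      by (simp add: residuals_def departure_clocks_def run_down_def residual_serve busy_jobs_config)
  next
    case False
    then show ?thesis using jl by (simp add: residuals_def departure_clocks_def)
  qed
  then show "residuals (snd (next_state (t', c, b, u) (t, js))) = departure_clocks (map job_config js) j (residuals js)"
    unfolding ns snd_conv residuals_start_service by (rule ext)
  have "\<forall>j\<in>set (map (serve ?h) js). proper_job j"
    using js h by (auto intro!: proper_job_serve)
  then have "\<forall>x\<in>set (drop_nth j (map (serve ?h) js)). proper_job x"
    using set_drop_nth[of j "map (serve ?h) js"] by blast
  then show "\<forall>j\<in>set (snd (next_state (t', c, b, u) (t, js))). proper_job j"
    unfolding ns snd_conv by (rule proper_start_service)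
qed

section \<open>Mean return times\<close>

text \<open>
The recursion of \<open>state_after\<close> turned around, so that induction can peel off the first event as
\<open>cost\<close> does.
\<close>

fun trajectory :: "state \<Rightarrow> innovation stream \<Rightarrow> nat \<Rightarrow> state" where
  "trajectory x z 0 = x"
| "trajectory x z (Suc n) = trajectory (next_state (shd z) x) (stl z) n"

lemma trajectory_Suc: "trajectory x z (Suc n) = next_state (z !! n) (trajectory x z n)"
proof (induction n arbitrary: x z)
  case (Suc n)
  have "trajectory x z (Suc (Suc n)) = trajectory (next_state (shd z) x) (stl z) (Suc n)" by simp
  also have "\<dots> = next_state (stl z !! n) (trajectory (next_state (shd z) x) (stl z) n)" by (rule Suc.IH)
  finally show ?case by simp
qed simp

lemma state_after_eq_trajectory:
  "state_after D (t, b, z) n = trajectory (state_after D (t, b, z) 0) z n"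
  by (induction n) (simp_all only: state_after.simps(2) trajectory_Suc trajectory.simps(1))

context redundancy_system
begin

abbreviation config_of :: "state \<Rightarrow> config" where "config_of x \<equiv> map job_config (snd x)"

abbreviation cost_from :: "(nat set \<Rightarrow> nat) \<Rightarrow> nat \<Rightarrow> state \<Rightarrow> innovation stream \<Rightarrow> ennreal" where
  "cost_from v k x z \<equiv> cost v k (config_of x) (fst x) (residuals (snd x)) z"

lemma residuals_pos_iff: "(\<forall>j\<in>set js. 0 < residual j) \<longleftrightarrow> (\<forall>i<length js. 0 < residuals js i)"
  by (auto simp: residuals_nth all_set_conv_all_nth)

text \<open>
Finite cost rules out ties and degenerate innovations at the first event. Then exactly one summand of
\<open>one_step\<close> describes the next state, whose clocks are again positive.
\<close>

lemma cost_finite_step: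
  assumes x: "proper_state K d x" and fin: "cost_from v (Suc k) x z < \<infinity>"
  defines "x' \<equiv> next_state (shd z) x"
  shows "proper_state K d x'"
    and "0 < holding_time x" "holding_time x \<le> fst x"
    and "ennreal (fst x + 1) \<le> cost_from v (Suc k) x z"
    and "config_of x' \<notin> has_counts v \<Longrightarrow> ennreal (fst x + 1) + cost_from v k x' (stl z) \<le> cost_from v (Suc k) x z"
proof -
  obtain t js where xe: "x = (t, js)" by (cases x)
  obtain t' c b u where s: "shd z = (t', c, b, u)" by (cases "shd z") auto
  let ?C = "map job_config js" and ?r = "residuals js"
  have t: "0 < t" and C: "valid K d ?C" and js: "\<forall>j\<in>set js. proper_job j" and pos: "\<forall>j\<in>set js. 0 < residual j"
    using x by (auto simp: proper_state_def xe)
  have con: "consistent K d ?C" using C by (simp add: valid_def)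
  let ?g = "stopped v (cost v k)"
  let ?a = "\<lambda>c. after_arrival ?g ?C c t ?r (shd z) (stl z)"
  let ?b = "\<lambda>j. after_departure ?g ?C j t ?r (shd z) (stl z)"
  define A where "A = (\<Sum>c\<in>job_types K d. ?a c)"
  define B where "B = (\<Sum>j\<in>busy_jobs ?C. ?b j)"
  define R :: ennreal where "R = (if no_tie ?C t ?r then 0 else \<infinity>)"
  define G :: ennreal where "G = (if good_innovation (shd z) then 0 else \<infinity>)"
  have cost: "cost_from v (Suc k) x z = ennreal (t + 1) + R + G + A + B"
    unfolding cost.simps(2) one_step_def A_def B_def R_def G_def xe fst_conv snd_conv ..
  have "R \<noteq> \<infinity>" "G \<noteq> \<infinity>" using fin unfolding cost by (auto simp: less_top[symmetric])
  then have race: "no_tie ?C t ?r"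
    and good: "good_innovation (shd z)"
    by (auto simp: R_def G_def split: if_splits)
  from good have t': "0 < t'" and c: "c \<in> job_types K d" and b: "0 < b" and u: "choices_ok K u"
    by (auto simp: good_innovation_def s)
  have RG: "R = 0" "G = 0" using race good by (auto simp: R_def G_def)
  show "0 < holding_time x" by (rule holding_time_pos[OF x])
  show "holding_time x \<le> fst x"
    unfolding holding_time_def xe using finite_event_clocks[OF js] by (intro Min_le) auto
  show "ennreal (fst x + 1) \<le> cost_from v (Suc k) x z"
    unfolding cost RG by (simp add: xe add.assoc)
  consider (arrival) "arrival_first ?C t ?r" | (departure) j where "j \<in> busy_jobs ?C" "departure_first ?C j t ?r"
    using race unfolding no_tie_def by blast
  then have "proper_state K d x' \<and> (config_of x' \<notin> has_counts v \<longrightarrow> cost_from v k x' (stl z) \<le> A + B)"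
  proof cases
    case arrival
    note n = next_state_arrival[OF js t arrival, of t' c b u, folded s xe, folded x'_def]
    have "valid K d (config_of x')" unfolding n(2) by (rule valid_after_arrival[OF C c u])
    moreover have "\<forall>j\<in>set (snd x'). 0 < residual j"
    proof -
      have l: "length (snd x') = Suc (length js)" using arg_cong[OF n(2), of length] by simp
      show ?thesis unfolding residuals_pos_iff n(3) l
        using b pos arrival
        by (auto simp: arrival_clocks_def run_down_def arrival_first_def residuals_nth less_Suc_eq)
    qed
    moreover have "cost_from v k x' (stl z) \<le> A + B" if "config_of x' \<notin> has_counts v"
    proof -
      have "cost_from v k x' (stl z) = ?a c"
        using arrival that unfolding n(1,2,3) by (simp add: after_arrival_def stopped_def s)
      also have "\<dots> \<le> A" unfolding A_def by (rule member_le_sum[where f="?a", OF c]) simp_all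
      also have "A \<le> A + B" by simp
      finally show ?thesis .
    qed
    ultimately show ?thesis using n(1,4) t' by (simp add: proper_state_def)
  next
    case (departure j)
    note n = next_state_departure[OF js pos departure, of t' c b u, folded s xe, folded x'_def]
    have jl: "j < length js" using departure(1) by (simp add: busy_jobs_config)
    have "valid K d (config_of x')" unfolding n(2) by (rule valid_after_departure[OF C departure(1) u])
    moreover have "\<forall>j\<in>set (snd x'). 0 < residual j"
    proof -
      have l: "length (snd x') = length js - 1" using arg_cong[OF n(2), of length] jl by simp
      have "0 < departure_clocks ?C j ?r i" if i: "i < length js - 1" for i
      proof -
        have sl: "skip j i < length js" by (rule skip_less[OF jl i])
        have "skip j i \<in> busy_jobs ?C \<Longrightarrow> ?r j < ?r (skip j i)"
          using departure(2) skip_neq[of j i] by (simp add: departure_first_def)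
        moreover have "0 < ?r (skip j i)" using pos sl by (simp add: residuals_nth)
        ultimately show ?thesis
          using sl i skip_neq[of j i] by (simp add: departure_clocks_def run_down_def)
      qed
      then show ?thesis unfolding residuals_pos_iff n(3) l by blast
    qed
    moreover have "cost_from v k x' (stl z) \<le> A + B" if "config_of x' \<notin> has_counts v"
    proof -
      have "cost_from v k x' (stl z) = ?b j"
        using departure that unfolding n(1,2,3) by (simp add: after_departure_def stopped_def s)
      also have "\<dots> \<le> B" unfolding B_def by (rule member_le_sum[where f="?b", OF departure(1)]) simp_all
      also have "B \<le> A + B" by simp
      finally show ?thesis .
    qed
    moreover have "0 < t - ?r j" using departure(2) by (simp add: departure_first_def)
    ultimately show ?thesis using n(1,4) by (simp add: proper_state_def)
  qed
  then show "proper_state K d x'"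
    and "config_of x' \<notin> has_counts v \<Longrightarrow> ennreal (fst x + 1) + cost_from v k x' (stl z) \<le> cost_from v (Suc k) x z"
    unfolding cost RG by (auto simp: xe add.assoc intro: add_left_mono)
qed

text \<open>
Each event before hitting is charged at least \<open>1\<close>, which gives the first alternative if there is no hit
among the first \<open>k\<close> events, and at least its holding time, which gives the second. Positive holding times
up to and including the hit are recorded because the process is read off at a time, not at an event.
\<close>

lemma cost_bounds_hitting_time:
  assumes "proper_state K d x" "cost_from v k x z < \<infinity>"
  shows "of_nat k \<le> cost_from v k x z \<or>
    (\<exists>m\<ge>1. config_of (trajectory x z m) \<in> has_counts v \<and>
       (\<forall>i\<le>m. 0 < holding_time (trajectory x z i)) \<and>
       ennreal (\<Sum>i<m. holding_time (trajectory x z i)) \<le> cost_from v k x z)"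
  using assms
proof (induction k arbitrary: x z)
  case (Suc k)
  let ?x = "next_state (shd z) x"
  note step = cost_finite_step[OF Suc.prems]
  have t: "0 < fst x" using Suc.prems(1) by (simp add: proper_state_def)
  show ?case
  proof (cases "config_of ?x \<in> has_counts v")
    case True
    have "ennreal (\<Sum>i<1. holding_time (trajectory x z i)) \<le> ennreal (fst x + 1)"
      using step(3) by (intro ennreal_leI) simp
    also note step(4)
    finally have "ennreal (\<Sum>i<1. holding_time (trajectory x z i)) \<le> cost_from v (Suc k) x z" .
    moreover have "\<forall>i\<le>1. 0 < holding_time (trajectory x z i)"
      using step(2) holding_time_pos[OF step(1)] by (simp add: le_Suc_eq)
    ultimately show ?thesis using True by (intro disjI2 exI[of _ 1]) simp
  next
    case False
    note le = step(5)[OF False]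
    have "cost_from v k ?x (stl z) \<le> cost_from v (Suc k) x z"
      using le by (rule order.trans[rotated]) simp
    then have "cost_from v k ?x (stl z) < \<infinity>" using Suc.prems(2) by (rule le_less_trans)
    from Suc.IH[OF step(1) this] show ?thesis
    proof (elim disjE exE conjE)
      assume k: "of_nat k \<le> cost_from v k ?x (stl z)"
      have "of_nat (Suc k) = 1 + (of_nat k :: ennreal)" by simp
      also have "\<dots> \<le> ennreal (fst x + 1) + cost_from v k ?x (stl z)"
        using t k by (intro add_mono) (auto simp flip: ennreal_1 intro: ennreal_leI)
      also note le
      finally show ?thesis ..
    next
      fix m assume m: "1 \<le> m" "config_of (trajectory ?x (stl z) m) \<in> has_counts v"
        "\<forall>i\<le>m. 0 < holding_time (trajectory ?x (stl z) i)"
        "ennreal (\<Sum>i<m. holding_time (trajectory ?x (stl z) i)) \<le> cost_from v k ?x (stl z)"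
      have "(\<Sum>i<Suc m. holding_time (trajectory x z i)) = holding_time x + (\<Sum>i<m. holding_time (trajectory ?x (stl z) i))"
        by (subst sum.lessThan_Suc_shift) simp
      then have "ennreal (\<Sum>i<Suc m. holding_time (trajectory x z i))
         = ennreal (holding_time x) + ennreal (\<Sum>i<m. holding_time (trajectory ?x (stl z) i))"
      proof -
        have "0 \<le> (\<Sum>i<m. holding_time (trajectory ?x (stl z) i))"
          by (intro sum_nonneg) (use m(3) in \<open>auto intro: less_imp_le\<close>)
        then show ?thesis using \<open>(\<Sum>i<Suc m. _ i) = _\<close> by (simp only: ennreal_plus[OF less_imp_le[OF step(2)]])
      qed
      also have "\<dots> \<le> ennreal (fst x + 1) + cost_from v k ?x (stl z)"
        using step(3) m(4) by (intro add_mono ennreal_leI) auto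
      also note le
      finally have "ennreal (\<Sum>i<Suc m. holding_time (trajectory x z i)) \<le> cost_from v (Suc k) x z" .
      moreover have "\<forall>i\<le>Suc m. 0 < holding_time (trajectory x z i)"
      proof (intro allI impI)
        fix i assume "i \<le> Suc m"
        then show "0 < holding_time (trajectory x z i)" using step(2) m(3) by (cases i) auto
      qed
      ultimately show ?thesis using m(2) by (intro disjI2 exI[of _ "Suc m"]) simp
    qed
  qed
qed simp

lemma has_counts_iff:
  "config_of x \<in> has_counts v \<longleftrightarrow> (\<lambda>c. length (filter (\<lambda>j. job_type j = c) (snd x))) = v"
proof -
  have "count_list (map fst (config_of x)) c = length (filter (\<lambda>j. job_type j = c) (snd x))" for c
    by (induction "snd x" arbitrary: x) (auto simp: job_config_def count_list_eq_length_filter o_def filter_map eq_commute)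
  then show ?thesis by (auto simp: has_counts_def fun_eq_iff)
qed

text \<open>
With positive holding times the event times increase strictly, so at the time of the \<open>m\<close>-th event the
process shows the state right after it.
\<close>

lemma return_time_le:
  assumes m: "1 \<le> m" and hit: "config_of (state_after D \<omega> m) \<in> has_counts v"
    and pos: "\<forall>i\<le>m. 0 < holding_time (state_after D \<omega> i)"
  shows "return_time D v \<omega> \<le> ennreal (event_time D \<omega> m)"
proof -
  have mono: "event_time D \<omega> i \<le> event_time D \<omega> j" if "i \<le> j" "j \<le> m" for i j
    unfolding event_time_def using that pos by (intro sum_mono2) (auto intro: less_imp_le)
  have "(LEAST n. event_time D \<omega> m < event_time D \<omega> (Suc n)) = m"
  proof (rule Least_equality)
    show "event_time D \<omega> m < event_time D \<omega> (Suc m)" using pos by (simp add: event_time_def)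
    fix n assume "event_time D \<omega> m < event_time D \<omega> (Suc n)"
    then show "m \<le> n" using mono[of "Suc n" m] by linarith
  qed
  then have "N_ROS D \<omega> (event_time D \<omega> m) = v"
    using hit unfolding has_counts_iff by (simp add: N_ROS_def fun_eq_iff)
  moreover have "event_time D \<omega> 1 \<le> event_time D \<omega> m" using mono[of 1 m] m by simp
  ultimately show ?thesis unfolding return_time_def by (intro INF_lower) simp
qed

lemma one_step_mono:
  assumes "\<And>C t r z. g C t r z \<le> h C t r z"
  shows "one_step g C t r z \<le> one_step h C t r z"
  unfolding one_step_def after_arrival_def after_departure_def
  by (intro add_mono order.refl sum_mono) (simp_all add: assms)

lemma cost_Suc_mono: "cost v k C t r z \<le> cost v (Suc k) C t r z"
proof (induction k arbitrary: C t r z)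
  case (Suc k)
  have "one_step (stopped v (cost v k)) C t r z \<le> one_step (stopped v (cost v (Suc k))) C t r z"
    by (rule one_step_mono) (simp add: stopped_def Suc.IH del: cost.simps)
  then show ?case by (simp only: cost.simps(2))
qed simp

lemma mean_total_cost:
  assumes C: "valid K d C" and v: "\<And>c. c \<notin> job_types K d \<Longrightarrow> v c = 0" and stable: "lam < \<mu> * real K"
  shows "(\<integral>\<^sup>+\<omega>. (SUP k. cost v k C (fst \<omega>) (fst (snd \<omega>)) (snd (snd \<omega>))) \<partial>outcome_law (length C)) < \<infinity>"
proof -
  have con: "consistent K d C" using C by (simp add: valid_def)
  obtain R where R: "R < \<infinity>" "\<And>n. (\<Sum>k<n. survival (has_counts v) k C) \<le> R"
    using finite_expected_hitting[where v=v, OF stable v C] by blast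
  have "(\<integral>\<^sup>+\<omega>. (SUP k. cost v k C (fst \<omega>) (fst (snd \<omega>)) (snd (snd \<omega>))) \<partial>outcome_law (length C)) = (SUP k. mean (cost v k) C)"
    unfolding mean_def
    by (rule nn_integral_monotone_convergence_SUP)
      (auto intro!: incseq_SucI le_funI cost_Suc_mono measurable_functionalD[OF measurable_cost con measurable_outcome_law])
  also have "\<dots> \<le> ennreal (1 / lam + 1) * R"
    by (intro SUP_least) (simp only: mean_cost[OF C], intro mult_left_mono R(2), simp)
  also have "\<dots> < \<infinity>" using R(1) by (simp add: ennreal_mult_less_top)
  finally show ?thesis .
qed

lemma exp_law_tail:
  assumes "0 \<le> m" shows "emeasure (exp_law \<mu>) {m<..} = ennreal (exp (- \<mu> * m))"
proof -
  have "emeasure (exp_law \<mu>) {m<..} = (\<integral>\<^sup>+y. indicator {m<..} y \<partial>exp_law \<mu>)"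
    by (rule nn_integral_indicator[symmetric]) simp
  also have "\<dots> = (\<integral>\<^sup>+y. (if m < y then (\<lambda>_. 1) (y - m) else 0) \<partial>exp_law \<mu>)"
    by (intro nn_integral_cong) (simp add: indicator_def)
  also have "\<dots> = ennreal (exp (- \<mu> * m)) * (\<integral>\<^sup>+y. 1 \<partial>exp_law \<mu>)"
    by (rule exp_law_memoryless[OF \<mu>_pos assms]) simp
  finally show ?thesis
    by (simp only: prob_space_nn_integral_const[OF M.prob_space_axioms] mult_1_right)
qed

text \<open>
A requirement conditioned to exceed the attained service leaves an exponential residual.
\<close>

lemma exp_law_conditioned:
  assumes m: "0 \<le> m" and f: "f \<in> borel_measurable borel"
  shows "(\<integral>\<^sup>+y. f (y - m) \<partial>uniform_measure (exp_law \<mu>) {m<..}) = (\<integral>\<^sup>+y. f y \<partial>exp_law \<mu>)"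
proof -
  note [measurable] = f
  let ?e = "ennreal (exp (- \<mu> * m))"
  have "(\<integral>\<^sup>+y. f (y - m) \<partial>uniform_measure (exp_law \<mu>) {m<..}) = (\<integral>\<^sup>+y. f (y - m) * indicator {m<..} y \<partial>exp_law \<mu>) / ?e"
    by (subst nn_integral_uniform_measure) (simp_all add: exp_law_tail[OF m])
  also have "(\<integral>\<^sup>+y. f (y - m) * indicator {m<..} y \<partial>exp_law \<mu>) = (\<integral>\<^sup>+y. (if m < y then f (y - m) else 0) \<partial>exp_law \<mu>)"
    by (intro nn_integral_cong) (simp add: indicator_def)
  also have "\<dots> = ?e * (\<integral>\<^sup>+y. f y \<partial>exp_law \<mu>)" by (rule exp_law_memoryless[OF \<mu>_pos m f])
  also have "?e * (\<integral>\<^sup>+y. f y \<partial>exp_law \<mu>) / ?e = (\<integral>\<^sup>+y. f y \<partial>exp_law \<mu>)"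
    by (subst mult.commute, rule mult_divide_eq_ennreal) simp_all
  finally show ?thesis .
qed

lemma prob_space_conditioned: "prob_space (uniform_measure (exp_law \<mu>) {m<..})"
proof (rule prob_space_uniform_measure)
  have "emeasure (exp_law \<mu>) {max 0 m<..} \<le> emeasure (exp_law \<mu>) {m<..}" by (rule emeasure_mono) auto
  moreover have "0 < emeasure (exp_law \<mu>) {max 0 m<..}"
    unfolding exp_law_tail[OF max.cobounded1] by simp
  ultimately show "emeasure (exp_law \<mu>) {m<..} \<noteq> 0" by (metis leD)
  show "emeasure (exp_law \<mu>) {m<..} \<noteq> \<infinity>" by (simp add: M.emeasure_eq_measure)
qed

lemma descriptorsD:
  assumes D: "D \<in> descriptors K d" and p: "p \<in> set D"
  shows "fst p \<in> job_types K d" "dom (snd p) \<subseteq> fst p" "\<forall>a\<in>ran (snd p). 0 \<le> a" "finite (ran (snd p))"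
    and "s \<in> fst p \<Longrightarrow> \<exists>!i. i < length D \<and> snd (D ! i) s \<noteq> None"
proof -
  have 1: "\<forall>(c, A)\<in>set D. c \<in> job_types K d \<and> dom A \<subseteq> c \<and> (\<forall>a\<in>ran A. 0 \<le> a)"
    and 2: "\<forall>s. (\<exists>(c, A)\<in>set D. s \<in> c) \<longrightarrow> (\<exists>!i. i < length D \<and> snd (D ! i) s \<noteq> None)"
    using D unfolding descriptors_def by blast+
  show t: "fst p \<in> job_types K d" "dom (snd p) \<subseteq> fst p" "\<forall>a\<in>ran (snd p). 0 \<le> a"
    using bspec[OF 1 p] by (simp_all add: case_prod_beta)
  have "finite (dom (snd p))" using t(2) job_typesD[OF t(1)] finite_subset by blast
  then show "finite (ran (snd p))" by (rule finite_ran)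
  have "\<exists>(c, A)\<in>set D. s \<in> c" if "s \<in> fst p"
    by (rule bexI[OF _ p]) (simp add: case_prod_beta that)
  with 2 show "s \<in> fst p \<Longrightarrow> \<exists>!i. i < length D \<and> snd (D ! i) s \<noteq> None" by blast
qed

definition descriptor_config :: "descriptor \<Rightarrow> config" where
  "descriptor_config D = map (\<lambda>(c, A). (c, dom A)) D"

lemma valid_descriptor_config:
  assumes D: "D \<in> descriptors K d"
  shows "valid K d (descriptor_config D)"
proof -
  note types = descriptorsD(1,2)[OF D] and uniq = descriptorsD(5)[OF D]
  have nth: "snd (descriptor_config D ! i) = dom (snd (D ! i))" "fst (descriptor_config D ! i) = fst (D ! i)" if "i < length D" for i
    using that by (auto simp: descriptor_config_def case_prod_beta)
  have len [simp]: "length (descriptor_config D) = length D" by (simp add: descriptor_config_def)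
  show ?thesis
    unfolding valid_def consistent_def work_conserving_def
  proof (intro conjI ballI allI impI)
    fix p assume "p \<in> set (descriptor_config D)"
    then obtain q where "q \<in> set D" "p = (fst q, dom (snd q))"
      by (auto simp: descriptor_config_def case_prod_beta)
    then show "fst p \<in> job_types K d" "snd p \<subseteq> fst p" using types[of q] by simp_all
  next
    fix s i j assume ij: "i < length (descriptor_config D)" "j < length (descriptor_config D)"
      "s \<in> snd (descriptor_config D ! i)" "s \<in> snd (descriptor_config D ! j)"
    then have "D ! i \<in> set D" "s \<in> fst (D ! i)" using types(2)[of "D ! i"] by (auto simp: nth)
    then have ex1: "\<exists>!i. i < length D \<and> snd (D ! i) s \<noteq> None" by (rule uniq)
    have "i < length D \<and> snd (D ! i) s \<noteq> None" "j < length D \<and> snd (D ! j) s \<noteq> None"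
      using ij by (simp_all add: nth dom_def)
    then show "i = j" using ex1 by blast
  next
    fix p s assume "p \<in> set (descriptor_config D)" "s \<in> fst p"
    then obtain q where q: "q \<in> set D" "s \<in> fst q"
      by (auto simp: descriptor_config_def case_prod_beta)
    obtain i where "i < length D" "snd (D ! i) s \<noteq> None" using uniq[OF q] by blast
    then show "\<not> config_idle (descriptor_config D) s" by (auto simp: config_idle_iff nth dom_def)
  qed
qed

definition initial_residuals :: "descriptor \<Rightarrow> (nat \<Rightarrow> real) \<Rightarrow> nat \<Rightarrow> real" where
  "initial_residuals D b = (\<lambda>i\<in>{..<length D}. b i - max_attained (D ! i))"

lemma initial_state:
  "fst (state_after D (t, b, z) 0) = t"
  "config_of (state_after D (t, b, z) 0) = descriptor_config D"
  "residuals (snd (state_after D (t, b, z) 0)) = initial_residuals D b"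
  by (auto intro!: nth_equalityI simp: job_config_def descriptor_config_def case_prod_beta
      residuals_def residual_def initial_residuals_def fun_eq_iff)

lemma proper_initial_state:
  assumes D: "D \<in> descriptors K d" and t: "0 < t" and b: "\<And>i. i < length D \<Longrightarrow> max_attained (D ! i) < b i"
  shows "proper_state K d (state_after D (t, b, z) 0)"
proof -
  have "proper_job j" if "j \<in> set (snd (state_after D (t, b, z) 0))" for j
  proof -
    obtain i where i: "i < length D" "j = Job (fst (D ! i)) (b i) (snd (D ! i))" using \<open>j \<in> _\<close> by auto
    have "D ! i \<in> set D" using i(1) by simp
    then show ?thesis using descriptorsD(3,4)[OF D] by (simp add: proper_job_def i(2))
  qed
  moreover have "\<forall>j\<in>set (snd (state_after D (t, b, z) 0)). 0 < residual j"
    unfolding residuals_pos_iff initial_state using b by (simp add: initial_residuals_def)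
  ultimately show ?thesis
    using valid_descriptor_config[OF D] t unfolding proper_state_def initial_state by blast
qed

text \<open>
If the total cost is finite, some \<open>k\<close> exceeds it, and then \<open>cost_bounds_hitting_time\<close> leaves
only the alternative of a hit among the first \<open>k\<close> events.
\<close>

lemma return_time_le_total_cost:
  assumes D: "D \<in> descriptors K d" and t: "0 < t" and b: "\<And>i. i < length D \<Longrightarrow> max_attained (D ! i) < b i"
  shows "return_time D v (t, b, z) \<le> (SUP k. cost v k (descriptor_config D) t (initial_residuals D b) z)"
    (is "_ \<le> ?S")
proof (cases "?S = \<infinity>")
  case True
  show ?thesis unfolding True by simp
next
  case False
  let ?x = "state_after D (t, b, z) 0"
  have x: "proper_state K d ?x" by (rule proper_initial_state[OF D t b])
  have cost: "cost_from v k ?x z = cost v k (descriptor_config D) t (initial_residuals D b) z" for k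
    unfolding initial_state ..
  have le: "cost_from v k ?x z \<le> ?S" for k unfolding cost by (rule SUP_upper) simp
  define S where "S = ?S"
  have S: "S < \<infinity>" using False by (simp add: S_def less_top[symmetric])
  then obtain k :: nat where k: "S < of_nat k"
    using ennreal_Ex_less_of_nat[of S] by auto
  have "cost_from v k ?x z < \<infinity>" using le[of k, folded S_def] S by (rule le_less_trans)
  moreover have "\<not> of_nat k \<le> cost_from v k ?x z" using le_less_trans[OF le[of k, folded S_def] k] by (simp only: not_le)
  ultimately obtain m where m: "1 \<le> m" "config_of (trajectory ?x z m) \<in> has_counts v"
      "\<forall>i\<le>m. 0 < holding_time (trajectory ?x z i)"
      "ennreal (\<Sum>i<m. holding_time (trajectory ?x z i)) \<le> cost_from v k ?x z"
    using cost_bounds_hitting_time[OF x] by blast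
  have "return_time D v (t, b, z) \<le> ennreal (event_time D (t, b, z) m)"
    by (rule return_time_le[OF m(1)]) (use m(2,3) in \<open>simp_all only: state_after_eq_trajectory[symmetric]\<close>)
  also have "\<dots> \<le> cost_from v k ?x z"
    using m(4) unfolding event_time_def by (simp only: state_after_eq_trajectory[symmetric])
  also note le
  finally show ?thesis .
qed

text \<open>
The initial law, with requirements conditioned on the attained services, becomes the law of fresh clocks once
requirements are replaced by residuals. The mean return time is then bounded by a mean total cost.
\<close>

lemma mean_return_time_finite:
  assumes D: "D \<in> descriptors K d" and v: "\<And>c. c \<notin> job_types K d \<Longrightarrow> v c = 0" and stable: "lam < \<mu> * real K"
  shows "(\<integral>\<^sup>+\<omega>. return_time D v \<omega> \<partial>system_law K d lam \<mu> D) < \<infinity>"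
proof -
  let ?n = "length D" and ?C = "descriptor_config D"
  let ?m = "\<lambda>i. max_attained (D ! i)"
  let ?Q = "\<lambda>i. uniform_measure (exp_law \<mu>) {?m i<..}"
  let ?B = "PiM {..<?n} ?Q"
  have C: "valid K d ?C" by (rule valid_descriptor_config[OF D])
  have con: "consistent K d ?C" using C by (simp add: valid_def)
  have len: "length ?C = ?n" by (simp add: descriptor_config_def)
  interpret B: prob_space ?B by (intro prob_space_PiM prob_space_conditioned)
  interpret BZ: pair_prob_space ?B Z ..
  interpret LBZ: pair_prob_space "exp_law lam" "?B \<Otimes>\<^sub>M Z" ..
  have sQ: "sets (?Q i) = sets borel" for i by simp
  have sB: "sets ?B = sets (clocks {..<?n})" by (rule sets_PiM_cong[OF refl sQ])
  have m0: "0 \<le> ?m i" if "i < ?n" for i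
    using descriptorsD(4)[OF D nth_mem[OF that]] by (simp add: max_attained_def)
  define F where "F t r z = (SUP k. cost v k ?C t r z)" for t r z
  have F: "(\<lambda>w. F (t w) (r w) (z w)) \<in> borel_measurable N"
    if "t \<in> borel_measurable N" "r \<in> measurable N (clocks {..<?n})" "z \<in> measurable N Z" for t r z and N :: "'w measure"
    unfolding F_def by (intro borel_measurable_SUP measurable_functionalD[OF measurable_cost con]) (use that len in auto)
  have shift: "(\<lambda>w. initial_residuals D (b w)) \<in> measurable N (clocks {..<?n})"
    if "b \<in> measurable N (clocks {..<?n})" for b and N :: "'w measure"
    unfolding initial_residuals_def
    by (intro measurable_restrict borel_measurable_diff measurable_clock[OF that] borel_measurable_const) auto
  have law: "system_law K d lam \<mu> D = exp_law lam \<Otimes>\<^sub>M ?B \<Otimes>\<^sub>M Z"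
    by (simp add: system_law_def)
  let ?f = "\<lambda>\<omega>. F (fst \<omega>) (initial_residuals D (fst (snd \<omega>))) (snd (snd \<omega>))"
  have mf: "fst \<in> borel_measurable (exp_law lam \<Otimes>\<^sub>M ?B \<Otimes>\<^sub>M Z)"
    using measurable_fst[of "exp_law lam" "?B \<Otimes>\<^sub>M Z"] by (simp add: measurable_cong_sets[OF refl sets_exp_law])
  have mb: "(\<lambda>\<omega>. fst (snd \<omega>)) \<in> measurable (exp_law lam \<Otimes>\<^sub>M ?B \<Otimes>\<^sub>M Z) (clocks {..<?n})"
    using measurable_compose[OF measurable_snd measurable_fst, of "exp_law lam" ?B Z]
    by (simp only: measurable_cong_sets[OF refl sB])
  have mz: "(\<lambda>\<omega>. snd (snd \<omega>)) \<in> measurable (exp_law lam \<Otimes>\<^sub>M ?B \<Otimes>\<^sub>M Z) Z" by measurable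
  note fm = F[OF mf shift[OF mb] mz]
  have AEt: "AE \<omega> in exp_law lam \<Otimes>\<^sub>M ?B \<Otimes>\<^sub>M Z. 0 < fst \<omega>"
  proof -
    have "AE t in distr (exp_law lam \<Otimes>\<^sub>M ?B \<Otimes>\<^sub>M Z) (exp_law lam) fst. 0 < t"
      unfolding BZ.distr_pair_fst by (rule AE_exp_law_pos)
    then show ?thesis by (rule AE_distrD[OF measurable_fst])
  qed
  have AEb: "AE \<omega> in exp_law lam \<Otimes>\<^sub>M ?B \<Otimes>\<^sub>M Z. \<forall>i\<in>{..<?n}. ?m i < fst (snd \<omega>) i"
  proof -
    have "AE b in ?B. \<forall>i\<in>{..<?n}. ?m i < b i"
    proof (rule AE_finite_allI[OF finite_lessThan])
      fix i assume i: "i \<in> {..<?n}"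
      have "AE y in ?Q i. ?m i < y" by (rule AE_uniform_measureI) auto
      then show "AE b in ?B. ?m i < b i" by (intro AE_PiM_component[OF prob_space_conditioned i])
    qed
    then have "AE y in ?B \<Otimes>\<^sub>M Z. \<forall>i\<in>{..<?n}. ?m i < fst y i"
      by (intro AE_distrD[OF measurable_fst]) (simp only: Z.distr_pair_fst)
    moreover have "Measurable.pred (exp_law lam \<Otimes>\<^sub>M ?B \<Otimes>\<^sub>M Z) (\<lambda>\<omega>. \<forall>i\<in>{..<?n}. ?m i < fst (snd \<omega>) i)"
    proof (rule pred_intros_finite(3)[OF finite_lessThan])
      fix i assume "i \<in> {..<?n}"
      note [measurable] = measurable_clock[OF mb this]
      show "Measurable.pred (exp_law lam \<Otimes>\<^sub>M ?B \<Otimes>\<^sub>M Z) (\<lambda>\<omega>. ?m i < fst (snd \<omega>) i)" by measurable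
    qed
    ultimately show ?thesis
      by (intro LBZ.AE_pair_measure) (simp_all only: snd_conv pred_def, simp)
  qed
  have "(\<integral>\<^sup>+\<omega>. return_time D v \<omega> \<partial>system_law K d lam \<mu> D) \<le> (\<integral>\<^sup>+\<omega>. ?f \<omega> \<partial>system_law K d lam \<mu> D)"
    unfolding law
  proof (rule nn_integral_mono_AE, use AEt AEb in eventually_elim)
    fix \<omega> :: outcome assume "0 < fst \<omega>" "\<forall>i\<in>{..<?n}. ?m i < fst (snd \<omega>) i"
    then show "return_time D v \<omega> \<le> ?f \<omega>"
      using return_time_le_total_cost[OF D, of "fst \<omega>" "fst (snd \<omega>)" v "snd (snd \<omega>)"] by (simp add: F_def)
  qed
  also have "\<dots> = (\<integral>\<^sup>+t. \<integral>\<^sup>+b. \<integral>\<^sup>+z. F t (initial_residuals D b) z \<partial>Z \<partial>?B \<partial>exp_law lam)"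
  proof -
    have "(\<integral>\<^sup>+\<omega>. ?f \<omega> \<partial>system_law K d lam \<mu> D) = (\<integral>\<^sup>+t. \<integral>\<^sup>+y. ?f (t, y) \<partial>(?B \<Otimes>\<^sub>M Z) \<partial>exp_law lam)"
      unfolding law by (rule BZ.nn_integral_fst[symmetric, OF fm])
    also have "\<dots> = (\<integral>\<^sup>+t. \<integral>\<^sup>+b. \<integral>\<^sup>+z. ?f (t, b, z) \<partial>Z \<partial>?B \<partial>exp_law lam)"
      by (intro nn_integral_cong Z.nn_integral_fst[symmetric] measurable_compose[OF measurable_Pair1' fm])
    finally show ?thesis by (simp only: fst_conv snd_conv)
  qed
  also have "\<dots> = (\<integral>\<^sup>+t. \<integral>\<^sup>+r. \<integral>\<^sup>+z. F t r z \<partial>Z \<partial>clock_law ?n \<partial>exp_law lam)"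
  proof (rule nn_integral_cong)
    fix t
    define H where "H r = (\<integral>\<^sup>+z. F t r z \<partial>Z)" for r
    have H: "H \<in> borel_measurable (clocks {..<?n})"
      unfolding H_def
      by (rule Z.borel_measurable_nn_integral) (unfold case_prod_beta', intro F, measurable)
    have "(\<integral>\<^sup>+b. (\<Prod>i\<in>{..<?n}. 1) * H (\<lambda>i\<in>{..<?n}. b i - ?m i) \<partial>?B) = (\<Prod>i\<in>{..<?n}. 1) * (\<integral>\<^sup>+r. H r \<partial>PiM {..<?n} (\<lambda>_. exp_law \<mu>))"
      by (rule nn_integral_PiM_weighted_map[OF _ _ _ _ _ _ _ _ H])
        (auto intro!: prob_space_imp_sigma_finite prob_space_conditioned prob_space_exp_law[OF \<mu>_pos] exp_law_conditioned[OF m0])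
    then show "(\<integral>\<^sup>+b. \<integral>\<^sup>+z. F t (initial_residuals D b) z \<partial>Z \<partial>?B) = (\<integral>\<^sup>+r. \<integral>\<^sup>+z. F t r z \<partial>Z \<partial>clock_law ?n)"
      by (simp add: H_def initial_residuals_def clock_law_def)
  qed
  also have "\<dots> = (\<integral>\<^sup>+\<omega>. F (fst \<omega>) (fst (snd \<omega>)) (snd (snd \<omega>)) \<partial>outcome_law ?n)"
    by (subst nn_integral_outcome_law[OF F[OF measurable_outcome_law]]) simp
  also have "\<dots> < \<infinity>" using mean_total_cost[OF C v stable] by (simp add: F_def len)
  finally show ?thesis .
qed

end

theorem proposition19:
  fixes K d :: nat and lam \<mu> \<rho> :: real
  assumes "1 \<le> d" and "d \<le> K"
    and "lam > 0" and "\<mu> > 0"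
    and "\<rho> = lam / (\<mu> * real K)"
    and "\<rho> < 1"
  shows "ergodic_ROS K d lam \<mu>"
proof -
  interpret redundancy_system K d lam \<mu>
    using assms by unfold_locales auto
  have "0 < \<mu> * real K" using assms by simp
  then have "lam < \<mu> * real K" using assms(5,6) by (simp add: pos_divide_less_eq)
  then show ?thesis
    unfolding ergodic_ROS_def using mean_return_time_finite by blast
qed

end
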